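(* Let $\kappa\ge1$ and $o\in V_\kappa$. The map $j_o: B_\Gamma(\ell^2(V_\kappa))\to B(\ell^2(V_\kappa)_{\mathrm{rad}(o)})$, $T[\varphi]\mapsto P_{\mathrm{rad}(o)}T[\varphi]P_{\mathrm{rad}(o)}$ (viewed as an operator on $\ell^2(V_\kappa)_{\mathrm{rad}(o)}$), is an isometric embedding of $C^*$-algebras. Moreover, letting $U_o:\ell^2(V_\kappa)_{\mathrm{rad}(o)}\to L^2(\Pi_\kappa)$ be the unitary operator determined by $U_o\big(\mathbf{1}_{S_n(o)}/\sqrt{\#S_n(o)}\big)=P_n/\|P_n\|_{L^2(\Pi_\kappa)}$ for all $n\ge0$, we have, simultaneously for all $\varphi\in L^\infty(\Pi_\kappa)$, $$U_o\,P_{\mathrm{rad}(o)}T[\varphi]P_{\mathrm{rad}(o)}=M_\varphi\,U_o\quad\text{on }\ell^2(V_\kappa)_{\mathrm{rad}(o)},$$ where $M_\varphi\psi=\varphi\psi$ is the multiplication operator on $L^2(\Pi_\kappa)$.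
   Context: $\mathrm{T}_\kappa=(V_\kappa,E_\kappa)$ is the Cayley tree of order $\kappa$ (infinite connected acyclic graph, every vertex of degree $\kappa+1$), $d$ its graph distance, $S_n(o)=\{x\in V_\kappa: d(x,o)=n\}$. Bounded operators on $\ell^2(V_\kappa)$ are identified with kernels $A(x,y)=\langle A\delta_y,\delta_x\rangle$; $B_\Gamma(\ell^2(V_\kappa))$ is the $C^*$-algebra of bounded operators whose kernel has the form $\alpha(d(x,y))$ for some $\alpha:\mathbb{N}_0\to\mathbb{C}$. $\ell^2(V_\kappa)_{\mathrm{rad}(o)}$ is the subspace of $\eta\in\ell^2(V_\kappa)$ with $\eta_x=\eta_y$ whenever $d(x,o)=d(y,o)$, and $P_{\mathrm{rad}(o)}$ the orthogonal projection onto it. Cartier–Dunau polynomials: $P_0=1$, $P_1(t)=t$, $tP_n=\frac{\kappa}{\kappa+1}P_{n+1}+\frac1{\kappa+1}P_{n-1}$ ($n\ge1$). $d\Pi_\kappa(t)=\frac{\kappa+1}{2\pi}\frac{\sqrt{4\kappa(\kappa+1)^{-2}-t^2}}{1-t^2}\mathbf{1}_{[-2\sqrt\kappa/(\kappa+1),\,2\sqrt\kappa/(\kappa+1)]}(t)dt$ (a probability measure for which $(P_n)$ is orthogonal). For $\varphi\in L^1(\Pi_\kappa)$, $\widehat\varphi(n)=\int P_n\varphi\,d\Pi_\kappa$ and $T[\varphi](x,y)=\widehat\varphi(d(x,y))$; every element of $B_\Gamma(\ell^2(V_\kappa))$ is of the form $T[\varphi]$ with $\varphi\in L^\infty(\Pi_\kappa)$.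 *)

theory Defs
  imports "HOL-Analysis.Analysis"
begin

definition walk :: "('v \<Rightarrow> 'v \<Rightarrow> bool) \<Rightarrow> 'v list \<Rightarrow> bool" where
  "walk E xs \<longleftrightarrow> xs \<noteq> [] \<and> (\<forall>i. Suc i < length xs \<longrightarrow> E (xs ! i) (xs ! Suc i))"

definition cayley_tree :: "nat \<Rightarrow> ('v \<Rightarrow> 'v \<Rightarrow> bool) \<Rightarrow> bool" where
  "cayley_tree k E \<longleftrightarrow>
     (\<forall>x y. E x y \<longrightarrow> E y x) \<and> (\<forall>x. \<not> E x x) \<and>
     (\<forall>x. finite {y. E x y} \<and> card {y. E x y} = k + 1) \<and>
     (\<forall>x y. \<exists>xs. walk E xs \<and> hd xs = x \<and> last xs = y) \<and>
     \<not> (\<exists>xs. 3 \<le> length xs \<and> distinct xs \<and> walk E xs \<and> E (last xs) (hd xs))"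

definition gdist :: "('v \<Rightarrow> 'v \<Rightarrow> bool) \<Rightarrow> 'v \<Rightarrow> 'v \<Rightarrow> nat" where
  "gdist E x y = (LEAST n. \<exists>xs. walk E xs \<and> hd xs = x \<and> last xs = y \<and> length xs = Suc n)"

definition sphere :: "('v \<Rightarrow> 'v \<Rightarrow> bool) \<Rightarrow> 'v \<Rightarrow> nat \<Rightarrow> 'v set" where
  "sphere E o0 n = {x. gdist E x o0 = n}"

definition is_l2 :: "('v \<Rightarrow> complex) \<Rightarrow> bool" where
  "is_l2 f \<longleftrightarrow> (\<lambda>x. (cmod (f x))\<^sup>2) summable_on UNIV"

definition l2norm :: "('v \<Rightarrow> complex) \<Rightarrow> real" where
  "l2norm f = sqrt (\<Sum>\<^sub>\<infinity>x. (cmod (f x))\<^sup>2)"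

definition l2inner :: "('v \<Rightarrow> complex) \<Rightarrow> ('v \<Rightarrow> complex) \<Rightarrow> complex" where
  "l2inner f g = (\<Sum>\<^sub>\<infinity>x. f x * cnj (g x))"

definition is_rad :: "('v \<Rightarrow> 'v \<Rightarrow> bool) \<Rightarrow> 'v \<Rightarrow> ('v \<Rightarrow> complex) \<Rightarrow> bool" where
  "is_rad E o0 f \<longleftrightarrow> is_l2 f \<and> (\<forall>x y. gdist E x o0 = gdist E y o0 \<longrightarrow> f x = f y)"

text \<open>Orthogonal projection P_rad(o0): averaging over spheres (spheres are finite).\<close>
definition Prad :: "('v \<Rightarrow> 'v \<Rightarrow> bool) \<Rightarrow> 'v \<Rightarrow> ('v \<Rightarrow> complex) \<Rightarrow> 'v \<Rightarrow> complex" where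
  "Prad E o0 f x = (\<Sum>y\<in>sphere E o0 (gdist E x o0). f y) / of_nat (card (sphere E o0 (gdist E x o0)))"

section \<open>Bounded operators given by kernels A(x,y) = <A delta_y, delta_x>\<close>

definition kapply :: "('v \<Rightarrow> 'v \<Rightarrow> complex) \<Rightarrow> ('v \<Rightarrow> complex) \<Rightarrow> 'v \<Rightarrow> complex" where
  "kapply K f x = (\<Sum>\<^sub>\<infinity>y. K x y * f y)"

definition bounded_kernel :: "('v \<Rightarrow> 'v \<Rightarrow> complex) \<Rightarrow> bool" where
  "bounded_kernel K \<longleftrightarrow> (\<exists>C. \<forall>f. is_l2 f \<longrightarrow>
      (\<forall>x. (\<lambda>y. K x y * f y) summable_on UNIV) \<and> is_l2 (kapply K f) \<and>
      l2norm (kapply K f) \<le> C * l2norm f)"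

definition opnorm :: "('v \<Rightarrow> 'v \<Rightarrow> complex) \<Rightarrow> real" where
  "opnorm K = Sup ((\<lambda>f. l2norm (kapply K f)) ` {f. is_l2 f \<and> l2norm f \<le> 1})"

definition kcomp :: "('v \<Rightarrow> 'v \<Rightarrow> complex) \<Rightarrow> ('v \<Rightarrow> 'v \<Rightarrow> complex) \<Rightarrow> 'v \<Rightarrow> 'v \<Rightarrow> complex" where
  "kcomp S T x z = (\<Sum>\<^sub>\<infinity>y. S x y * T y z)"

definition kadj :: "('v \<Rightarrow> 'v \<Rightarrow> complex) \<Rightarrow> 'v \<Rightarrow> 'v \<Rightarrow> complex" where
  "kadj K x y = cnj (K y x)"

definition BGamma :: "('v \<Rightarrow> 'v \<Rightarrow> bool) \<Rightarrow> ('v \<Rightarrow> 'v \<Rightarrow> complex) set" where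
  "BGamma E = {K. bounded_kernel K \<and> (\<exists>\<alpha>. \<forall>x y. K x y = \<alpha> (gdist E x y))}"

definition jo :: "('v \<Rightarrow> 'v \<Rightarrow> bool) \<Rightarrow> 'v \<Rightarrow> ('v \<Rightarrow> 'v \<Rightarrow> complex) \<Rightarrow> ('v \<Rightarrow> complex) \<Rightarrow> 'v \<Rightarrow> complex" where
  "jo E o0 K f = Prad E o0 (kapply K (Prad E o0 f))"

definition rad_opnorm :: "('v \<Rightarrow> 'v \<Rightarrow> bool) \<Rightarrow> 'v \<Rightarrow> (('v \<Rightarrow> complex) \<Rightarrow> 'v \<Rightarrow> complex) \<Rightarrow> real" where
  "rad_opnorm E o0 F = Sup ((\<lambda>f. l2norm (F f)) ` {f. is_rad E o0 f \<and> l2norm f \<le> 1})"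

fun CD :: "nat \<Rightarrow> nat \<Rightarrow> real \<Rightarrow> real" where
  "CD k 0 t = 1"
| "CD k (Suc 0) t = t"
| "CD k (Suc (Suc n)) t = ((real k + 1) * t * CD k (Suc n) t - CD k n t) / real k"

definition Pi_density :: "nat \<Rightarrow> real \<Rightarrow> real" where
  "Pi_density k t = (real k + 1) / (2 * pi) * sqrt (4 * real k / (real k + 1)\<^sup>2 - t\<^sup>2) / (1 - t\<^sup>2)
     * indicator {- 2 * sqrt (real k) / (real k + 1) .. 2 * sqrt (real k) / (real k + 1)} t"

definition Pi_measure :: "nat \<Rightarrow> real measure" where
  "Pi_measure k = density lborel (\<lambda>t. ennreal (Pi_density k t))"

definition is_L2 :: "nat \<Rightarrow> (real \<Rightarrow> complex) \<Rightarrow> bool" where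
  "is_L2 k g \<longleftrightarrow> g \<in> borel_measurable (Pi_measure k) \<and> integrable (Pi_measure k) (\<lambda>t. (cmod (g t))\<^sup>2)"

definition L2norm :: "nat \<Rightarrow> (real \<Rightarrow> complex) \<Rightarrow> real" where
  "L2norm k g = sqrt (integral\<^sup>L (Pi_measure k) (\<lambda>t. (cmod (g t))\<^sup>2))"

definition is_Linf :: "nat \<Rightarrow> (real \<Rightarrow> complex) \<Rightarrow> bool" where
  "is_Linf k \<phi> \<longleftrightarrow> \<phi> \<in> borel_measurable (Pi_measure k) \<and> (\<exists>C. AE t in Pi_measure k. cmod (\<phi> t) \<le> C)"

definition hat :: "nat \<Rightarrow> (real \<Rightarrow> complex) \<Rightarrow> nat \<Rightarrow> complex" where
  "hat k \<phi> n = integral\<^sup>L (Pi_measure k) (\<lambda>t. complex_of_real (CD k n t) * \<phi> t)"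

definition Tphi :: "nat \<Rightarrow> ('v \<Rightarrow> 'v \<Rightarrow> bool) \<Rightarrow> (real \<Rightarrow> complex) \<Rightarrow> 'v \<Rightarrow> 'v \<Rightarrow> complex" where
  "Tphi k E \<phi> x y = hat k \<phi> (gdist E x y)"

definition unitary_rad :: "nat \<Rightarrow> ('v \<Rightarrow> 'v \<Rightarrow> bool) \<Rightarrow> 'v \<Rightarrow> (('v \<Rightarrow> complex) \<Rightarrow> real \<Rightarrow> complex) \<Rightarrow> bool" where
  "unitary_rad k E o0 U \<longleftrightarrow>
     (\<forall>f. is_rad E o0 f \<longrightarrow> is_L2 k (U f) \<and> L2norm k (U f) = l2norm f) \<and>
     (\<forall>f g a b. is_rad E o0 f \<longrightarrow> is_rad E o0 g \<longrightarrow>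
        (AE t in Pi_measure k. U (\<lambda>x. a * f x + b * g x) t = a * U f t + b * U g t)) \<and>
     (\<forall>h. is_L2 k h \<longrightarrow> (\<exists>f. is_rad E o0 f \<and> (AE t in Pi_measure k. U f t = h t)))"

definition sph_vec :: "('v \<Rightarrow> 'v \<Rightarrow> bool) \<Rightarrow> 'v \<Rightarrow> nat \<Rightarrow> 'v \<Rightarrow> complex" where
  "sph_vec E o0 n x = (if gdist E x o0 = n then complex_of_real (1 / sqrt (real (card (sphere E o0 n)))) else 0)"

definition U_values :: "nat \<Rightarrow> ('v \<Rightarrow> 'v \<Rightarrow> bool) \<Rightarrow> 'v \<Rightarrow> (('v \<Rightarrow> complex) \<Rightarrow> real \<Rightarrow> complex) \<Rightarrow> bool" where
  "U_values k E o0 U \<longleftrightarrow> (\<forall>n. AE t in Pi_measure k.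
      U (sph_vec E o0 n) t = complex_of_real (CD k n t / L2norm k (\<lambda>s. complex_of_real (CD k n s))))"

end

theory Submission
  imports Defs
begin

text \<open>In a tree every vertex other than x has exactly one neighbour closer to x. Hence the sphere kernels
  satisfy the three-term recurrence of the Cartier--Dunau polynomials, and summing P over the distances to
  x along the sphere of radius m around z gives #S_m P_m(t) P_d(z,x)(t). Integrating this identity,
  orthogonality reduces to the vanishing of the integrals of P_n for n > 0, which follows from a bounded
  sequence of trigonometric integrals J_n with J_(n+2) = \<kappa> J_n. Together with the Weierstrass theorem
  this yields the unitary U_o, and comparing Fourier coefficients shows that it intertwines T[\<phi>]
  with multiplication by \<phi>.

  For the isometry put H = T* T. All vectors H^n \<delta>_x have the same norm, and for x = o it is at most
  \<parallel>j_o(T)\<parallel>^(2n). So \<parallel>H^n f\<parallel> is at most c_f \<parallel>j_o(T)\<parallel>^(2n) for finitely supported f, whereas the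
  Cauchy--Schwarz inequality gives \<parallel>H^(2n) f\<parallel> \<parallel>f\<parallel> \<ge> \<parallel>H^n f\<parallel>^2; iterating the latter along powers of two
  forces \<parallel>T f\<parallel> \<le> \<parallel>j_o(T)\<parallel> \<parallel>f\<parallel>.\<close>

section \<open>Square-integrable functions\<close>

text \<open>Summing a radial profile over a sphere gives a function of one distance, with the same
  resulting profile for all base points. This uniformity takes the place of a transitive
  automorphism group and comes from counting neighbours alone. The isometry is proved for every
  kernel in \<open>BGamma E\<close> without first representing it by a symbol, so it cannot be read
  off from the norm of a multiplication operator; powers of T* T replace spectral theory. A bounded
  kernel need not be absolutely summable as a double array: sums are exchanged on finitely supported
  vectors and extended by continuity, or regrouped by finite spheres. Functions are not identified
  modulo null sets, so U is linear only almost everywhere. Square integrability is developed over a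
  general measure because both the counting measure on vertices and \<open>Pi_measure k\<close> are
  instances. The degenerate case is \<kappa> = 1: the density is unbounded and the recurrence for
  J_n has no growth.\<close>

definition sqint :: "'a measure \<Rightarrow> ('a \<Rightarrow> complex) \<Rightarrow> bool" where
  "sqint M f \<longleftrightarrow> f \<in> borel_measurable M \<and> integrable M (\<lambda>x. (cmod (f x))\<^sup>2)"

definition L2nrm :: "'a measure \<Rightarrow> ('a \<Rightarrow> complex) \<Rightarrow> real" where
  "L2nrm M f = sqrt (\<integral>x. (cmod (f x))\<^sup>2 \<partial>M)"

definition L2ip :: "'a measure \<Rightarrow> ('a \<Rightarrow> complex) \<Rightarrow> ('a \<Rightarrow> complex) \<Rightarrow> complex" where
  "L2ip M f g = (\<integral>x. f x * cnj (g x) \<partial>M)"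

lemma sqint_measurable [measurable_dest]: "sqint M f \<Longrightarrow> f \<in> borel_measurable M"
  and sqint_integrable_sq: "sqint M f \<Longrightarrow> integrable M (\<lambda>x. (cmod (f x))\<^sup>2)"
  by (auto simp: sqint_def)

lemma sqint_abs_mult_integrable:
  assumes "sqint M f" "sqint M g"
  shows "integrable M (\<lambda>x. cmod (f x) * cmod (g x))"
proof (rule Bochner_Integration.integrable_bound)
  show "integrable M (\<lambda>x. (cmod (f x))\<^sup>2 + (cmod (g x))\<^sup>2)"
    using assms by (auto intro: sqint_integrable_sq)
  show "(\<lambda>x. cmod (f x) * cmod (g x)) \<in> borel_measurable M"
    using assms[THEN sqint_measurable] by measurable
  have "a * b \<le> a\<^sup>2 + b\<^sup>2" if "0 \<le> a" "0 \<le> b" for a b :: real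
    using sum_squares_bound[of a b] mult_nonneg_nonneg[OF that] by simp
  then show "AE x in M. norm (cmod (f x) * cmod (g x)) \<le> norm ((cmod (f x))\<^sup>2 + (cmod (g x))\<^sup>2)"
    by simp
qed

lemma sqint_mult_integrable:
  assumes "sqint M f" "sqint M g"
  shows "integrable M (\<lambda>x. f x * g x)"
proof (rule Bochner_Integration.integrable_bound[OF sqint_abs_mult_integrable[OF assms]])
  show "(\<lambda>x. f x * g x) \<in> borel_measurable M"
    using assms[THEN sqint_measurable] by measurable
qed (auto simp: norm_mult)

lemma sqint_cnj: "sqint M f \<Longrightarrow> sqint M (\<lambda>x. cnj (f x))"
  unfolding sqint_def by (auto intro: borel_measurable_continuous_on[OF continuous_on_cnj[OF continuous_on_id]])

lemma sqint_scale: "sqint M f \<Longrightarrow> sqint M (\<lambda>x. c * f x)"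
  by (auto simp: sqint_def norm_mult power_mult_distrib)

lemma sqint_zero: "sqint M (\<lambda>x. 0)"
  by (auto simp: sqint_def)

lemma sqint_add:
  assumes "sqint M f" "sqint M g"
  shows "sqint M (\<lambda>x. f x + g x)"
  unfolding sqint_def
proof
  show m: "(\<lambda>x. f x + g x) \<in> borel_measurable M"
    using assms[THEN sqint_measurable] by measurable
  show "integrable M (\<lambda>x. (cmod (f x + g x))\<^sup>2)"
  proof (rule Bochner_Integration.integrable_bound)
    show "integrable M (\<lambda>x. 2 * (cmod (f x))\<^sup>2 + 2 * (cmod (g x))\<^sup>2)"
      using assms by (auto intro!: sqint_integrable_sq)
    have "(cmod (u + v))\<^sup>2 \<le> 2 * (cmod u)\<^sup>2 + 2 * (cmod v)\<^sup>2" for u v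
    proof -
      have "(cmod (u + v))\<^sup>2 \<le> (cmod u + cmod v)\<^sup>2"
        by (intro power_mono norm_triangle_ineq) auto
      then show ?thesis
        using sum_squares_bound[of "cmod u" "cmod v"] by (simp add: power2_sum)
    qed
    then show "AE x in M. norm ((cmod (f x + g x))\<^sup>2) \<le> norm (2 * (cmod (f x))\<^sup>2 + 2 * (cmod (g x))\<^sup>2)"
      by simp
  qed (use m in measurable)
qed

lemma sqint_diff: "sqint M f \<Longrightarrow> sqint M g \<Longrightarrow> sqint M (\<lambda>x. f x - g x)"
  using sqint_add[OF _ sqint_scale[of M g "-1"]] by simp

lemma sqint_sum: "(\<And>i. i \<in> I \<Longrightarrow> sqint M (f i)) \<Longrightarrow> sqint M (\<lambda>x. \<Sum>i\<in>I. f i x)"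
  by (induction I rule: infinite_finite_induct) (auto intro: sqint_add simp: sqint_zero)

lemma sqint_mult_bounded:
  assumes "\<phi> \<in> borel_measurable M" "AE x in M. cmod (\<phi> x) \<le> C" "sqint M f"
  shows "sqint M (\<lambda>x. \<phi> x * f x)"
  unfolding sqint_def
proof
  show m: "(\<lambda>x. \<phi> x * f x) \<in> borel_measurable M"
    using assms(1) assms(3)[THEN sqint_measurable] by measurable
  show "integrable M (\<lambda>x. (cmod (\<phi> x * f x))\<^sup>2)"
  proof (rule Bochner_Integration.integrable_bound)
    show "integrable M (\<lambda>x. C\<^sup>2 * (cmod (f x))\<^sup>2)"
      using assms(3) by (auto intro!: sqint_integrable_sq)
    show "AE x in M. norm ((cmod (\<phi> x * f x))\<^sup>2) \<le> norm (C\<^sup>2 * (cmod (f x))\<^sup>2)"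
      using assms(2) by eventually_elim (auto simp: norm_mult power_mult_distrib intro!: mult_right_mono power_mono)
  qed (use m in measurable)
qed

lemma L2nrm_nonneg [simp]: "0 \<le> L2nrm M f"
  by (simp add: L2nrm_def)

lemma L2nrm_sq: "(L2nrm M f)\<^sup>2 = (\<integral>x. (cmod (f x))\<^sup>2 \<partial>M)"
  by (simp add: L2nrm_def)

lemma L2ip_self: "L2ip M f f = complex_of_real ((L2nrm M f)\<^sup>2)"
  unfolding L2ip_def L2nrm_sq
  by (simp flip: integral_complex_of_real add: complex_norm_square[symmetric])

lemma L2nrm_scale: "L2nrm M (\<lambda>x. c * f x) = cmod c * L2nrm M f"
  by (simp add: L2nrm_def norm_mult power_mult_distrib real_sqrt_mult)

lemma L2nrm_cong_AE:
  assumes "sqint M f" "sqint M g" "AE x in M. f x = g x"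
  shows "L2nrm M f = L2nrm M g"
  unfolding L2nrm_def
  using assms by (intro arg_cong[where f = sqrt] integral_cong_AE) (auto dest: sqint_measurable)

lemma L2nrm_eq_0_iff:
  assumes "sqint M f"
  shows "L2nrm M f = 0 \<longleftrightarrow> (AE x in M. f x = 0)"
  unfolding L2nrm_def
  using integral_nonneg_eq_0_iff_AE[OF sqint_integrable_sq[OF assms]] by simp

lemma L2_Cauchy_Schwarz_abs:
  assumes f: "sqint M f" and g: "sqint M g"
  shows "(\<integral>x. cmod (f x) * cmod (g x) \<partial>M) \<le> L2nrm M f * L2nrm M g"
proof -
  let ?a = "L2nrm M f" and ?b = "L2nrm M g" and ?I = "\<integral>x. cmod (f x) * cmod (g x) \<partial>M"
  note int = sqint_integrable_sq[OF f] sqint_integrable_sq[OF g] sqint_abs_mult_integrable[OF f g]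
  show ?thesis
  proof (cases "?a * ?b = 0")
    case True
    then have "AE x in M. cmod (f x) * cmod (g x) = 0"
      using L2nrm_eq_0_iff[OF f] L2nrm_eq_0_iff[OF g] by auto
    then have "?I = 0"
      by (simp add: integral_eq_zero_AE)
    then show ?thesis using True by simp
  next
    case False
    then have pos: "0 < ?a * ?b"
      by (simp add: less_le)
    have "0 \<le> (\<integral>x. (?b * cmod (f x) - ?a * cmod (g x))\<^sup>2 \<partial>M)"
      by simp
    also have "\<dots> = (\<integral>x. ?b\<^sup>2 * (cmod (f x))\<^sup>2 + ?a\<^sup>2 * (cmod (g x))\<^sup>2 - 2 * ?a * ?b * (cmod (f x) * cmod (g x)) \<partial>M)"
      by (intro Bochner_Integration.integral_cong) (auto simp: power2_eq_square algebra_simps)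
    also have "\<dots> = 2 * (?a * ?b) * (?a * ?b - ?I)"
      using int by (simp add: L2nrm_sq[symmetric]) (simp add: power2_eq_square algebra_simps)
    finally show ?thesis
      using pos by (simp add: zero_le_mult_iff)
  qed
qed

lemma L2_Cauchy_Schwarz:
  assumes "sqint M f" "sqint M g"
  shows "cmod (L2ip M f g) \<le> L2nrm M f * L2nrm M g"
proof -
  have "cmod (L2ip M f g) \<le> (\<integral>x. cmod (f x * cnj (g x)) \<partial>M)"
    unfolding L2ip_def by (rule integral_norm_bound)
  also have "\<dots> \<le> L2nrm M f * L2nrm M g"
    using L2_Cauchy_Schwarz_abs[OF assms] by (simp add: norm_mult)
  finally show ?thesis .
qed

lemma L2nrm_triangle:
  assumes f: "sqint M f" and g: "sqint M g"
  shows "L2nrm M (\<lambda>x. f x + g x) \<le> L2nrm M f + L2nrm M g"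
proof (rule power2_le_imp_le)
  note int = sqint_integrable_sq[OF f] sqint_integrable_sq[OF g] sqint_abs_mult_integrable[OF f g]
  have "(L2nrm M (\<lambda>x. f x + g x))\<^sup>2 \<le>
      (\<integral>x. (cmod (f x))\<^sup>2 + (cmod (g x))\<^sup>2 + 2 * (cmod (f x) * cmod (g x)) \<partial>M)"
    unfolding L2nrm_sq
  proof (rule integral_mono)
    show "(cmod (f x + g x))\<^sup>2 \<le> (cmod (f x))\<^sup>2 + (cmod (g x))\<^sup>2 + 2 * (cmod (f x) * cmod (g x))" for x
      using power_mono[OF norm_triangle_ineq[of "f x" "g x"], of 2] by (simp add: power2_sum mult.assoc)
  qed (use int sqint_integrable_sq[OF sqint_add[OF f g]] in auto)
  also have "\<dots> = (L2nrm M f)\<^sup>2 + (L2nrm M g)\<^sup>2 + 2 * (\<integral>x. cmod (f x) * cmod (g x) \<partial>M)"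
    using int by (simp add: L2nrm_sq)
  also have "\<dots> \<le> (L2nrm M f + L2nrm M g)\<^sup>2"
    using L2_Cauchy_Schwarz_abs[OF f g] by (simp add: power2_sum)
  finally show "(L2nrm M (\<lambda>x. f x + g x))\<^sup>2 \<le> (L2nrm M f + L2nrm M g)\<^sup>2" .
qed auto

lemma L2nrm_triangle_diff:
  assumes "sqint M f" "sqint M g"
  shows "\<bar>L2nrm M f - L2nrm M g\<bar> \<le> L2nrm M (\<lambda>x. f x - g x)"
proof -
  have "L2nrm M (\<lambda>x. g x - f x) = L2nrm M (\<lambda>x. f x - g x)"
    by (simp add: L2nrm_def norm_minus_commute)
  then show ?thesis
    using L2nrm_triangle[OF sqint_diff[OF assms] assms(2)] L2nrm_triangle[OF sqint_diff[OF assms(2,1)] assms(1)]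
    by auto
qed

lemma L2nrm_sum_le:
  assumes "\<And>i. i \<in> I \<Longrightarrow> sqint M (f i)"
  shows "L2nrm M (\<lambda>x. \<Sum>i\<in>I. f i x) \<le> (\<Sum>i\<in>I. L2nrm M (f i))"
  using assms
proof (induction I rule: infinite_finite_induct)
  case (insert i I)
  have "L2nrm M (\<lambda>x. f i x + (\<Sum>i\<in>I. f i x)) \<le> L2nrm M (f i) + L2nrm M (\<lambda>x. \<Sum>i\<in>I. f i x)"
    using insert by (intro L2nrm_triangle sqint_sum) auto
  then show ?case
    using insert by fastforce
qed (auto simp: L2nrm_def)

lemma L2ip_add_left: "sqint M f \<Longrightarrow> sqint M g \<Longrightarrow> sqint M h \<Longrightarrow>
    L2ip M (\<lambda>x. f x + g x) h = L2ip M f h + L2ip M g h"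
  unfolding L2ip_def by (simp add: distrib_right sqint_mult_integrable sqint_cnj)

lemma L2ip_diff_left: "sqint M f \<Longrightarrow> sqint M g \<Longrightarrow> sqint M h \<Longrightarrow>
    L2ip M (\<lambda>x. f x - g x) h = L2ip M f h - L2ip M g h"
  unfolding L2ip_def by (simp add: left_diff_distrib sqint_mult_integrable sqint_cnj)

lemma L2ip_scale_left: "L2ip M (\<lambda>x. c * f x) g = c * L2ip M f g"
  unfolding L2ip_def by (simp add: mult.assoc)

lemma L2ip_commute: "L2ip M f g = cnj (L2ip M g f)"
  unfolding L2ip_def by (simp flip: Bochner_Integration.integral_cnj add: mult.commute)

lemma L2ip_sum_left:
  assumes "\<And>i. i \<in> I \<Longrightarrow> sqint M (f i)" "sqint M g"
  shows "L2ip M (\<lambda>x. \<Sum>i\<in>I. f i x) g = (\<Sum>i\<in>I. L2ip M (f i) g)"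
  unfolding L2ip_def sum_distrib_right
  using assms by (intro Bochner_Integration.integral_sum sqint_mult_integrable sqint_cnj)

text \<open>The filter is arbitrary because limits are taken both along partial sums of a series and
  along finite subsets of the vertex set.\<close>

lemma L2ip_tendsto_left:
  assumes "\<And>i. sqint M (f i)" "sqint M h" "sqint M g" "((\<lambda>i. L2nrm M (\<lambda>x. h x - f i x)) \<longlongrightarrow> 0) F"
  shows "((\<lambda>i. L2ip M (f i) g) \<longlongrightarrow> L2ip M h g) F"
proof -
  have "((\<lambda>i. L2nrm M (\<lambda>x. h x - f i x) * L2nrm M g) \<longlongrightarrow> 0) F"
    using tendsto_mult_left_zero[OF assms(4)] by simp
  then have "((\<lambda>i. L2ip M h g - L2ip M (f i) g) \<longlongrightarrow> 0) F"
    by (rule Lim_null_comparison[rotated])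
      (use assms in \<open>auto simp: L2ip_diff_left[symmetric] intro!: always_eventually L2_Cauchy_Schwarz sqint_diff\<close>)
  then show ?thesis
    using tendsto_diff[OF tendsto_const[of "L2ip M h g"]] by fastforce
qed

lemma L2nrm_tendsto:
  assumes "\<And>i. sqint M (f i)" "sqint M h" "((\<lambda>i. L2nrm M (\<lambda>x. h x - f i x)) \<longlongrightarrow> 0) F"
  shows "((\<lambda>i. L2nrm M (f i)) \<longlongrightarrow> L2nrm M h) F"
proof -
  have "((\<lambda>i. L2nrm M h - L2nrm M (f i)) \<longlongrightarrow> 0) F"
    by (rule Lim_null_comparison[OF _ assms(3)])
      (use assms L2nrm_triangle_diff in \<open>auto intro!: always_eventually\<close>)
  then show ?thesis
    using tendsto_diff[OF tendsto_const[of "L2nrm M h"]] by fastforce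
qed

section \<open>Completeness of L2 over a finite measure\<close>

context finite_measure
begin

lemma sqint_bounded:
  assumes "f \<in> borel_measurable M" "AE x in M. cmod (f x) \<le> C"
  shows "sqint M f"
proof -
  have "sqint M (\<lambda>x. 1)" by (simp add: sqint_def)
  from sqint_mult_bounded[OF assms this] show ?thesis by simp
qed

lemma sqint_integrable: "sqint M f \<Longrightarrow> integrable M f"
  using sqint_mult_integrable[of M f "\<lambda>x. 1"] by (simp add: sqint_def)

lemma L1_le_L2nrm:
  assumes "sqint M f"
  shows "(\<integral>x. cmod (f x) \<partial>M) \<le> L2nrm M f * sqrt (measure M (space M))"
  using L2_Cauchy_Schwarz_abs[OF assms, of "\<lambda>x. 1"] by (simp add: sqint_def L2nrm_def)

text \<open>On a finite measure space an L2-Cauchy sequence is L1-Cauchy, so a subsequence converges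
  almost everywhere; Fatou's lemma then transfers the Cauchy bounds to the pointwise limit.\<close>

theorem L2_complete:
  assumes s: "\<And>n. sqint M (s n)"
    and Cauchy: "\<And>e. e > 0 \<Longrightarrow> \<exists>N. \<forall>i\<ge>N. \<forall>j\<ge>N. L2nrm M (\<lambda>x. s i x - s j x) < e"
  obtains h where "sqint M h" "(\<lambda>n. L2nrm M (\<lambda>x. h x - s n x)) \<longlonglongrightarrow> 0"
proof -
  have meas [measurable]: "s n \<in> borel_measurable M" for n
    using s by (rule sqint_measurable)
  \<comment> \<open>The added 1 keeps \<open>K\<close> positive even for the zero measure, so that
    \<open>e / K\<close> is a legitimate tolerance.\<close>
  define K where "K = sqrt (measure M (space M)) + 1"
  have K: "0 < K" unfolding K_def by (simp add: add_nonneg_pos)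
  have "\<exists>N. \<forall>i\<ge>N. \<forall>j\<ge>N. (\<integral>x. norm (s i x - s j x) \<partial>M) < e" if "e > 0" for e
  proof -
    obtain N where N: "\<forall>i\<ge>N. \<forall>j\<ge>N. L2nrm M (\<lambda>x. s i x - s j x) < e / K"
      using Cauchy[of "e / K"] divide_pos_pos[OF \<open>e > 0\<close> K] by blast
    have "(\<integral>x. norm (s i x - s j x) \<partial>M) < e" if "i \<ge> N" "j \<ge> N" for i j
    proof -
      have "(\<integral>x. norm (s i x - s j x) \<partial>M) \<le> L2nrm M (\<lambda>x. s i x - s j x) * K"
        using L1_le_L2nrm[OF sqint_diff[OF s s], of i j] mult_left_mono[of "sqrt (measure M (space M))" K, OF _ L2nrm_nonneg]
        unfolding K_def by (meson less_add_one less_imp_le order_trans)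
      also have "\<dots> < e"
        using N that K by (simp add: pos_less_divide_eq)
      finally show ?thesis .
    qed
    then show ?thesis by blast
  qed
  then obtain r where r: "strict_mono r" "AE x in M. Cauchy (\<lambda>i. s (r i) x)"
    using cauchy_L1_AE_cauchy_subseq[of M s] sqint_integrable[OF s] by blast
  define h where "h x = lim (\<lambda>i. s (r i) x)" for x
  have h_meas [measurable]: "h \<in> borel_measurable M"
    unfolding h_def by measurable
  have lim: "AE x in M. (\<lambda>i. s (r i) x) \<longlonglongrightarrow> h x"
    using r(2) by eventually_elim (simp add: h_def Cauchy_convergent_iff convergent_LIMSEQ_iff)
  \<comment> \<open>With \<open>n\<close> fixed and the subsequence index going to infinity, Fatou
    yields both the integrability of the difference and the tolerance, the strict bound weakened to
    \<le>.\<close>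
  have bound: "integrable M (\<lambda>x. (cmod (h x - s n x))\<^sup>2) \<and> L2nrm M (\<lambda>x. h x - s n x) \<le> e"
    if "e > 0" and N: "\<forall>i\<ge>N. L2nrm M (\<lambda>x. s i x - s n x) < e" for e n N
  proof -
    have "(\<integral>\<^sup>+x. ennreal ((cmod (h x - s n x))\<^sup>2) \<partial>M) \<le>
        (\<integral>\<^sup>+x. liminf (\<lambda>i. ennreal ((cmod (s (r i) x - s n x))\<^sup>2)) \<partial>M)"
    proof (rule nn_integral_mono_AE, use lim in eventually_elim)
      case (elim x)
      have "(\<lambda>i. ennreal ((cmod (s (r i) x - s n x))\<^sup>2)) \<longlonglongrightarrow> ennreal ((cmod (h x - s n x))\<^sup>2)"
        by (intro tendsto_intros elim)
      from lim_imp_Liminf[OF sequentially_bot this] show ?case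
        by simp
    qed
    also have "\<dots> \<le> liminf (\<lambda>i. \<integral>\<^sup>+x. ennreal ((cmod (s (r i) x - s n x))\<^sup>2) \<partial>M)"
      by (rule nn_integral_liminf) measurable
    also have "\<dots> \<le> ennreal (e\<^sup>2)"
    proof -
      have "\<forall>\<^sub>F i in sequentially. (\<integral>\<^sup>+x. ennreal ((cmod (s (r i) x - s n x))\<^sup>2) \<partial>M) \<le> ennreal (e\<^sup>2)"
        using eventually_ge_at_top[of N]
      proof eventually_elim
        case (elim i)
        then have "N \<le> r i" using seq_suble[OF r(1), of i] by simp
        then have "(L2nrm M (\<lambda>x. s (r i) x - s n x))\<^sup>2 \<le> e\<^sup>2"
          using N by (intro power_mono) (auto intro: less_imp_le)
        then show ?case
          using sqint_integrable_sq[OF sqint_diff[OF s s]]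
          by (subst nn_integral_eq_integral) (auto simp: L2nrm_sq)
      qed
      then show ?thesis
        using Liminf_mono[of _ "\<lambda>_. ennreal (e\<^sup>2)" sequentially] by (fastforce simp: Liminf_const)
    qed
    finally have le: "(\<integral>\<^sup>+x. ennreal ((cmod (h x - s n x))\<^sup>2) \<partial>M) \<le> ennreal (e\<^sup>2)" .
    then have int: "integrable M (\<lambda>x. (cmod (h x - s n x))\<^sup>2)"
      by (intro integrableI_bounded) (auto simp: order_le_less_trans)
    then have "(L2nrm M (\<lambda>x. h x - s n x))\<^sup>2 \<le> e\<^sup>2"
      using le unfolding L2nrm_sq by (subst (asm) nn_integral_eq_integral) auto
    then show ?thesis
      using int \<open>e > 0\<close> by (auto intro: power2_le_imp_le)
  qed
  show ?thesis
  proof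
    obtain N where "\<forall>i\<ge>N. \<forall>j\<ge>N. L2nrm M (\<lambda>x. s i x - s j x) < 1"
      using Cauchy[of 1] by auto
    then have "sqint M (\<lambda>x. h x - s N x)"
      using bound[of 1 N N] by (auto simp: sqint_def)
    from sqint_add[OF this s[of N]] show "sqint M h" by simp
    show "(\<lambda>n. L2nrm M (\<lambda>x. h x - s n x)) \<longlonglongrightarrow> 0"
    proof (rule LIMSEQ_I)
      fix e :: real assume "0 < e"
      then obtain N where "\<forall>i\<ge>N. \<forall>j\<ge>N. L2nrm M (\<lambda>x. s i x - s j x) < e / 2"
        using Cauchy[of "e / 2"] by auto
      then have "\<forall>n\<ge>N. L2nrm M (\<lambda>x. h x - s n x) \<le> e / 2"
        using bound[of "e / 2" N] \<open>0 < e\<close> by auto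
      then show "\<exists>N. \<forall>n\<ge>N. norm (L2nrm M (\<lambda>x. h x - s n x) - 0) < e"
        using \<open>0 < e\<close> by (intro exI[of _ N]) force
    qed
  qed
qed

end

section \<open>Fourier expansions in an orthonormal basis\<close>

locale orthonormal_basis = finite_measure M for M :: "'a measure" +
  fixes e :: "nat \<Rightarrow> 'a \<Rightarrow> complex"
  assumes sqint_basis: "sqint M (e n)"
    and orthonormal: "L2ip M (e m) (e n) = (if m = n then 1 else 0)"
    and total: "sqint M h \<Longrightarrow> (\<And>n. L2ip M h (e n) = 0) \<Longrightarrow> AE x in M. h x = 0"
begin

definition fpart :: "(nat \<Rightarrow> complex) \<Rightarrow> nat set \<Rightarrow> 'a \<Rightarrow> complex" where
  "fpart c I x = (\<Sum>n\<in>I. c n * e n x)"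

lemma sqint_fpart: "sqint M (fpart c I)"
  unfolding fpart_def by (intro sqint_sum sqint_scale sqint_basis)

lemma L2ip_fpart: "sqint M g \<Longrightarrow> L2ip M (fpart c I) g = (\<Sum>n\<in>I. c n * L2ip M (e n) g)"
  unfolding fpart_def by (simp add: L2ip_sum_left sqint_scale sqint_basis L2ip_scale_left)

lemma L2ip_fpart_basis: "finite I \<Longrightarrow> L2ip M (fpart c I) (e n) = (if n \<in> I then c n else 0)"
  by (simp add: L2ip_fpart sqint_basis orthonormal if_distrib cong: if_cong)

lemma L2nrm_fpart_sq: "finite I \<Longrightarrow> (L2nrm M (fpart c I))\<^sup>2 = (\<Sum>n\<in>I. (cmod (c n))\<^sup>2)"
proof -
  assume I: "finite I"
  have "complex_of_real ((L2nrm M (fpart c I))\<^sup>2) = (\<Sum>n\<in>I. c n * L2ip M (e n) (fpart c I))"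
    by (simp only: L2ip_self[symmetric] L2ip_fpart[OF sqint_fpart])
  also have "\<dots> = (\<Sum>n\<in>I. c n * cnj (c n))"
    using I by (intro sum.cong refl) (subst L2ip_commute, simp add: L2ip_fpart_basis)
  also have "\<dots> = complex_of_real (\<Sum>n\<in>I. (cmod (c n))\<^sup>2)"
    by (simp only: of_real_sum complex_norm_square)
  finally show ?thesis
    by (simp only: of_real_eq_iff)
qed

lemma fpart_diff: "N \<le> N' \<Longrightarrow> fpart c {..<N'} x - fpart c {..<N} x = fpart c {N..<N'} x"
  unfolding fpart_def by (simp add: sum_diff[symmetric] ivl_disj_un lessThan_minus_lessThan)

text \<open>A relation rather than an operator, since the limit is determined only up to a null
  set.\<close>

definition is_fsum :: "(nat \<Rightarrow> complex) \<Rightarrow> ('a \<Rightarrow> complex) \<Rightarrow> bool" where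
  "is_fsum c h \<longleftrightarrow> sqint M h \<and> (\<lambda>N. L2nrm M (\<lambda>x. h x - fpart c {..<N} x)) \<longlonglongrightarrow> 0"

text \<open>Riesz-Fischer: by orthonormality the squared distance of two partial sums is a block of
  the convergent series of squares.\<close>

lemma ex_fsum:
  assumes c: "summable (\<lambda>n. (cmod (c n))\<^sup>2)"
  shows "\<exists>h. is_fsum c h"
proof -
  have "\<exists>N. \<forall>i\<ge>N. \<forall>j\<ge>N. L2nrm M (\<lambda>x. fpart c {..<i} x - fpart c {..<j} x) < \<epsilon>" if "\<epsilon> > 0" for \<epsilon>
  proof -
    have "\<epsilon>\<^sup>2 > 0"
      using that by simp
    then obtain N where N: "\<And>m n. m \<ge> N \<Longrightarrow> norm (\<Sum>n\<in>{m..<n}. (cmod (c n))\<^sup>2) < \<epsilon>\<^sup>2"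
      using c unfolding summable_Cauchy by blast
    have lt: "L2nrm M (\<lambda>x. fpart c {..<j} x - fpart c {..<i} x) < \<epsilon>" if "N \<le> i" "i \<le> j" for i j
    proof -
      have "(L2nrm M (fpart c {i..<j}))\<^sup>2 < \<epsilon>\<^sup>2"
        using N[OF that(1), of j] by (simp add: L2nrm_fpart_sq)
      then show ?thesis
        using that \<open>\<epsilon> > 0\<close> by (simp add: fpart_diff power2_less_imp_less)
    qed
    have "L2nrm M (\<lambda>x. fpart c {..<i} x - fpart c {..<j} x) < \<epsilon>" if "N \<le> i" "N \<le> j" for i j
      using lt[of i j] lt[of j i] that
      by (cases "i \<le> j") (auto simp: L2nrm_def norm_minus_commute)
    then show ?thesis by blast
  qed
  then show ?thesis
    using L2_complete[of "\<lambda>N. fpart c {..<N}", OF sqint_fpart] unfolding is_fsum_def by blast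
qed

lemma fsum_coeff:
  assumes "is_fsum c h"
  shows "L2ip M h (e n) = c n"
proof -
  have "(\<lambda>N. L2ip M (fpart c {..<N}) (e n)) \<longlonglongrightarrow> L2ip M h (e n)"
    using assms sqint_fpart sqint_basis unfolding is_fsum_def by (intro L2ip_tendsto_left) auto
  moreover have "\<forall>\<^sub>F N in sequentially. L2ip M (fpart c {..<N}) (e n) = c n"
    using eventually_gt_at_top[of n] by eventually_elim (simp add: L2ip_fpart_basis)
  then have "(\<lambda>N. L2ip M (fpart c {..<N}) (e n)) \<longlonglongrightarrow> c n"
    by (rule tendsto_eventually)
  ultimately show ?thesis
    by (rule LIMSEQ_unique)
qed

lemma fsum_norm:
  assumes "is_fsum c h"
  shows "(\<lambda>n. (cmod (c n))\<^sup>2) sums (L2nrm M h)\<^sup>2"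
proof -
  have "(\<lambda>N. L2nrm M (fpart c {..<N})) \<longlonglongrightarrow> L2nrm M h"
    using assms sqint_fpart unfolding is_fsum_def by (intro L2nrm_tendsto) auto
  then have "(\<lambda>N. (L2nrm M (fpart c {..<N}))\<^sup>2) \<longlonglongrightarrow> (L2nrm M h)\<^sup>2"
    by (rule tendsto_power)
  then show ?thesis
    unfolding sums_def by (simp add: L2nrm_fpart_sq)
qed

lemma eq_AE_if_coeffs_eq:
  assumes "sqint M f" "sqint M g" "\<And>n. L2ip M f (e n) = L2ip M g (e n)"
  shows "AE x in M. f x = g x"
  using total[OF sqint_diff[OF assms(1,2)]] assms by (simp add: L2ip_diff_left sqint_basis)

text \<open>For a partial sum p with S = \<parallel>p\<parallel>^2, pairing p with h gives S again,
  so Cauchy-Schwarz reads S \<le> \<parallel>p\<parallel> \<parallel>h\<parallel>.\<close>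

lemma Bessel:
  assumes h: "sqint M h"
  shows "summable (\<lambda>n. (cmod (L2ip M h (e n)))\<^sup>2)"
proof (rule summableI_nonneg_bounded)
  fix N
  define c where "c n = L2ip M h (e n)" for n
  let ?p = "fpart c {..<N}" and ?S = "\<Sum>n<N. (cmod (c n))\<^sup>2"
  have "L2ip M ?p h = (\<Sum>n<N. c n * cnj (c n))"
    unfolding L2ip_fpart[OF h] c_def L2ip_commute[of M _ h, symmetric] ..
  then have "L2ip M ?p h = complex_of_real ?S"
    by (simp only: of_real_sum complex_norm_square)
  then have "cmod (L2ip M ?p h) = ?S"
    by (simp only: norm_of_real abs_of_nonneg[OF sum_nonneg] zero_le_power2)
  then have "?S \<le> L2nrm M ?p * L2nrm M h"
    using L2_Cauchy_Schwarz[OF sqint_fpart h, of c "{..<N}"] by simp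
  then have "L2nrm M ?p * L2nrm M ?p \<le> L2nrm M ?p * L2nrm M h"
    using L2nrm_fpart_sq[of "{..<N}" c] by (simp add: power2_eq_square)
  then have "L2nrm M ?p \<le> L2nrm M h"
    using L2nrm_nonneg[of M ?p] L2nrm_nonneg[of M h] by (cases "L2nrm M ?p = 0") (auto simp: less_le)
  then have "(L2nrm M ?p)\<^sup>2 \<le> (L2nrm M h)\<^sup>2"
    by (intro power_mono) auto
  then show "(\<Sum>n<N. (cmod (L2ip M h (e n)))\<^sup>2) \<le> (L2nrm M h)\<^sup>2"
    by (simp add: L2nrm_fpart_sq c_def)
qed auto

text \<open>The Fourier series of h has a sum g with the same coefficients as h, and totality
  identifies the two almost everywhere.\<close>

theorem Parseval:
  assumes h: "sqint M h"
  shows "is_fsum (\<lambda>n. L2ip M h (e n)) h"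
proof -
  obtain g where g: "is_fsum (\<lambda>n. L2ip M h (e n)) g"
    using ex_fsum[OF Bessel[OF h]] by blast
  then have "sqint M g" by (simp add: is_fsum_def)
  then have ae: "AE x in M. h x = g x"
    using h fsum_coeff[OF g] by (intro eq_AE_if_coeffs_eq) auto
  have "L2nrm M (\<lambda>x. h x - fpart c I x) = L2nrm M (\<lambda>x. g x - fpart c I x)" for c I
    by (rule L2nrm_cong_AE) (use ae h \<open>sqint M g\<close> in \<open>auto intro!: sqint_diff sqint_fpart\<close>)
  then show ?thesis
    using g h unfolding is_fsum_def by simp
qed

lemma Parseval_ip:
  assumes h: "sqint M h" and g: "sqint M g"
  shows "(\<lambda>n. L2ip M h (e n) * cnj (L2ip M g (e n))) sums L2ip M h g"
proof -
  have "(\<lambda>N. L2ip M (fpart (\<lambda>n. L2ip M h (e n)) {..<N}) g) \<longlonglongrightarrow> L2ip M h g"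
    using Parseval[OF h] g sqint_fpart unfolding is_fsum_def by (intro L2ip_tendsto_left) auto
  then show ?thesis
    unfolding sums_def L2ip_fpart[OF g] L2ip_commute[of M _ g, symmetric] .
qed

end

section \<open>Square-summable functions and bounded kernels\<close>

abbreviation counting :: "'v measure" where "counting \<equiv> count_space UNIV"

text \<open>Unordered sums become Bochner integrals over the counting measure, which makes the
  general L2 estimates available for functions on vertices.\<close>

lemma summable_on_iff_integrable_complex:
  fixes f :: "'v \<Rightarrow> complex"
  shows "f summable_on UNIV \<longleftrightarrow> integrable counting f"
  by (simp add: summable_on_iff_abs_summable_on_complex abs_summable_equivalent
      Infinite_Set_Sum.abs_summable_on_def)

lemma summable_on_iff_integrable_real:
  fixes f :: "'v \<Rightarrow> real"
  shows "f summable_on UNIV \<longleftrightarrow> integrable counting f"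
  using summable_on_iff_abs_summable_on_real[of f UNIV] abs_summable_equivalent[of f UNIV]
  unfolding Infinite_Set_Sum.abs_summable_on_def by blast

lemma infsum_eq_integral_complex:
  fixes f :: "'v \<Rightarrow> complex"
  shows "infsum f UNIV = integral\<^sup>L counting f"
proof (cases "integrable counting f")
  case True
  then show ?thesis
    using infsetsum_infsum[of f UNIV] by (simp add: Infinite_Set_Sum.abs_summable_on_def infsetsum_def)
next
  case False
  then show ?thesis
    by (simp add: infsum_not_exists not_integrable_integral_eq summable_on_iff_integrable_complex)
qed

lemma infsum_eq_integral_real:
  fixes f :: "'v \<Rightarrow> real"
  shows "infsum f UNIV = integral\<^sup>L counting f"
proof (cases "integrable counting f")
  case True
  then show ?thesis
    using infsetsum_infsum[of f UNIV] by (simp add: Infinite_Set_Sum.abs_summable_on_def infsetsum_def)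
next
  case False
  then show ?thesis
    by (simp add: infsum_not_exists not_integrable_integral_eq summable_on_iff_integrable_real)
qed

lemma is_l2_iff_sqint: "is_l2 f \<longleftrightarrow> sqint counting f"
  by (simp add: is_l2_def sqint_def summable_on_iff_integrable_real)

lemma l2norm_eq_L2nrm: "l2norm f = L2nrm counting f"
  by (simp add: l2norm_def L2nrm_def infsum_eq_integral_real)

lemma l2inner_eq_L2ip: "l2inner f g = L2ip counting f g"
  by (simp add: l2inner_def L2ip_def infsum_eq_integral_complex)

lemma is_l2_finite_support: "finite {x. f x \<noteq> 0} \<Longrightarrow> is_l2 f"
  unfolding is_l2_def by (rule finite_nonzero_values_imp_summable_on) simp

definition delta :: "'v \<Rightarrow> 'v \<Rightarrow> complex" where
  "delta x y = (if y = x then 1 else 0)"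

lemma is_l2_delta: "is_l2 (delta x)"
  by (rule is_l2_finite_support) (simp add: delta_def)

lemma l2norm_delta: "l2norm (delta x) = 1"
proof -
  have "(\<Sum>\<^sub>\<infinity>y. (cmod (delta x y))\<^sup>2) = (\<Sum>\<^sub>\<infinity>y\<in>{x}. (cmod (delta x y))\<^sup>2)"
    by (rule infsum_cong_neutral) (auto simp: delta_def)
  then show ?thesis
    by (simp add: l2norm_def delta_def)
qed

lemma kapply_delta: "kapply K (delta x) = (\<lambda>y. K y x)"
proof
  fix y
  have "(\<Sum>\<^sub>\<infinity>z. K y z * delta x z) = (\<Sum>\<^sub>\<infinity>z\<in>{x}. K y z * delta x z)"
    by (rule infsum_cong_neutral) (auto simp: delta_def)
  then show "kapply K (delta x) y = K y x"
    by (simp add: kapply_def delta_def)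
qed

definition trunc :: "('v \<Rightarrow> complex) \<Rightarrow> 'v set \<Rightarrow> 'v \<Rightarrow> complex" where
  "trunc f F x = (if x \<in> F then f x else 0)"

lemma is_l2_trunc: "finite F \<Longrightarrow> is_l2 (trunc f F)"
  by (rule is_l2_finite_support) (auto simp: trunc_def intro: finite_subset)

lemma trunc_eq_sum_delta: "finite F \<Longrightarrow> trunc f F = (\<lambda>x. \<Sum>y\<in>F. f y * delta y x)"
  by (rule ext) (simp add: trunc_def delta_def if_distrib cong: if_cong)

lemma l2norm_trunc_sq: "finite F \<Longrightarrow> (l2norm (trunc f F))\<^sup>2 = (\<Sum>x\<in>F. (cmod (f x))\<^sup>2)"
proof -
  assume F: "finite F"
  have "(\<Sum>\<^sub>\<infinity>x. (cmod (trunc f F x))\<^sup>2) = (\<Sum>\<^sub>\<infinity>x\<in>F. (cmod (f x))\<^sup>2)"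
    by (rule infsum_cong_neutral) (auto simp: trunc_def)
  then show ?thesis
    using F by (simp add: l2norm_def sum_nonneg)
qed

lemma l2norm_nonneg [simp]: "0 \<le> l2norm f"
  by (simp add: l2norm_eq_L2nrm)

lemma sum_le_l2norm_sq:
  assumes "is_l2 f" "finite F"
  shows "(\<Sum>x\<in>F. (cmod (f x))\<^sup>2) \<le> (l2norm f)\<^sup>2"
  using assms unfolding is_l2_def l2norm_def
  by (simp add: infsum_nonneg finite_sum_le_infsum)

lemma l2norm_trunc_le: "is_l2 f \<Longrightarrow> finite F \<Longrightarrow> l2norm (trunc f F) \<le> l2norm f"
  using sum_le_l2norm_sq[of f F] by (rule_tac power2_le_imp_le) (simp_all add: l2norm_trunc_sq)

lemma l2_bounded_by_finite_sums:
  assumes "0 \<le> B" "\<And>F. finite F \<Longrightarrow> (\<Sum>x\<in>F. (cmod (f x))\<^sup>2) \<le> B\<^sup>2"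
  shows "is_l2 f" "l2norm f \<le> B"
proof -
  have s: "(\<lambda>x. (cmod (f x))\<^sup>2) summable_on UNIV"
    by (rule nonneg_bdd_above_summable_on) (use assms(2) in \<open>auto intro!: bdd_aboveI[where M = "B\<^sup>2"]\<close>)
  then show "is_l2 f" by (simp add: is_l2_def)
  have "(\<Sum>\<^sub>\<infinity>x. (cmod (f x))\<^sup>2) \<le> B\<^sup>2"
    using s assms(2) by (intro infsum_le_finite_sums) auto
  then show "l2norm f \<le> B"
    using real_sqrt_le_mono[of _ "B\<^sup>2"] assms(1) by (simp add: l2norm_def)
qed

lemma tendsto_trunc:
  assumes "is_l2 f"
  shows "((\<lambda>F. l2norm (\<lambda>x. f x - trunc f F x)) \<longlongrightarrow> 0) (finite_subsets_at_top UNIV)"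
proof -
  let ?s = "\<lambda>x. (cmod (f x))\<^sup>2"
  have s: "?s summable_on UNIV" using assms by (simp add: is_l2_def)
  have "((\<lambda>F. infsum ?s UNIV - sum ?s F) \<longlongrightarrow> infsum ?s UNIV - infsum ?s UNIV) (finite_subsets_at_top UNIV)"
    using s by (intro tendsto_diff tendsto_const infsum_tendsto)
  from tendsto_real_sqrt[OF this]
  have "((\<lambda>F. sqrt (infsum ?s UNIV - sum ?s F)) \<longlongrightarrow> 0) (finite_subsets_at_top UNIV)"
    by simp
  moreover have "l2norm (\<lambda>x. f x - trunc f F x) = sqrt (infsum ?s UNIV - sum ?s F)" if "finite F" for F
  proof -
    have "(\<Sum>\<^sub>\<infinity>x. (cmod (f x - trunc f F x))\<^sup>2) = infsum ?s (UNIV - F)"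
      by (rule infsum_cong_neutral) (auto simp: trunc_def)
    also have "\<dots> = infsum ?s UNIV - infsum ?s F"
      using s that by (intro infsum_Diff) auto
    finally show ?thesis
      using that by (simp add: l2norm_def)
  qed
  then have "\<forall>\<^sub>F F in finite_subsets_at_top UNIV. sqrt (infsum ?s UNIV - sum ?s F) = l2norm (\<lambda>x. f x - trunc f F x)"
    by (auto intro!: eventually_finite_subsets_at_top_weakI)
  ultimately show ?thesis
    by (rule Lim_transform_eventually)
qed

lemma is_l2_add: "is_l2 f \<Longrightarrow> is_l2 g \<Longrightarrow> is_l2 (\<lambda>x. f x + g x)"
  and is_l2_diff: "is_l2 f \<Longrightarrow> is_l2 g \<Longrightarrow> is_l2 (\<lambda>x. f x - g x)"
  and is_l2_scale: "is_l2 f \<Longrightarrow> is_l2 (\<lambda>x. c * f x)"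
  and is_l2_cnj: "is_l2 f \<Longrightarrow> is_l2 (\<lambda>x. cnj (f x))"
  by (simp_all add: is_l2_iff_sqint sqint_add sqint_diff sqint_scale sqint_cnj)

lemma l2norm_cnj: "l2norm (\<lambda>x. cnj (f x)) = l2norm f"
  by (simp add: l2norm_def)

lemma l2norm_scale: "l2norm (\<lambda>x. c * f x) = cmod c * l2norm f"
  by (simp add: l2norm_eq_L2nrm L2nrm_scale)

lemma l2_mult_summable: "is_l2 f \<Longrightarrow> is_l2 g \<Longrightarrow> (\<lambda>x. f x * g x) summable_on UNIV"
  by (simp add: is_l2_iff_sqint summable_on_iff_integrable_complex sqint_mult_integrable)

lemma l2_Cauchy_Schwarz: "is_l2 f \<Longrightarrow> is_l2 g \<Longrightarrow> cmod (l2inner f g) \<le> l2norm f * l2norm g"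
  by (simp add: is_l2_iff_sqint l2inner_eq_L2ip l2norm_eq_L2nrm L2_Cauchy_Schwarz)

lemma l2inner_self: "l2inner f f = complex_of_real ((l2norm f)\<^sup>2)"
  by (simp only: l2inner_eq_L2ip l2norm_eq_L2nrm L2ip_self)

section \<open>Operators given by bounded kernels\<close>

lemma bounded_kernelE:
  fixes K :: "'v \<Rightarrow> 'v \<Rightarrow> complex"
  assumes "bounded_kernel K"
  obtains C where "0 \<le> C" "\<And>f x. is_l2 f \<Longrightarrow> (\<lambda>y. K x y * f y) summable_on UNIV"
    "\<And>f. is_l2 f \<Longrightarrow> is_l2 (kapply K f)" "\<And>f. is_l2 f \<Longrightarrow> l2norm (kapply K f) \<le> C * l2norm f"
proof -
  obtain C where C: "\<forall>f. is_l2 f \<longrightarrow> (\<forall>x. (\<lambda>y. K x y * f y) summable_on UNIV) \<and> is_l2 (kapply K f) \<and>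
      l2norm (kapply K f) \<le> C * l2norm f"
    using assms unfolding bounded_kernel_def by blast
  fix x :: 'v
  \<comment> \<open>Testing on a unit vector shows that the constant, which carries no sign in
    \<open>bounded_kernel\<close>, is nonnegative.\<close>
  have "l2norm (kapply K (delta x)) \<le> C * l2norm (delta x)"
    using C[THEN spec, THEN mp, OF is_l2_delta, THEN conjunct2, THEN conjunct2] .
  then have "0 \<le> C"
    using l2norm_nonneg[of "kapply K (delta x)"] unfolding l2norm_delta by linarith
  then show ?thesis
    by (rule that) (use C in auto)
qed

context
  fixes K :: "'v \<Rightarrow> 'v \<Rightarrow> complex"
  assumes K: "bounded_kernel K"
begin

lemma kapply_summable: "is_l2 f \<Longrightarrow> (\<lambda>y. K x y * f y) summable_on UNIV"
  and is_l2_kapply: "is_l2 f \<Longrightarrow> is_l2 (kapply K f)"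
  using bounded_kernelE[OF K] by metis+

lemma is_l2_column: "is_l2 (\<lambda>y. K y x)"
  using is_l2_kapply[OF is_l2_delta] by (simp add: kapply_delta)

lemma kapply_add: "is_l2 f \<Longrightarrow> is_l2 g \<Longrightarrow> kapply K (\<lambda>x. f x + g x) = (\<lambda>x. kapply K f x + kapply K g x)"
  unfolding kapply_def by (simp add: distrib_left infsum_add kapply_summable)

lemma kapply_scale: "kapply K (\<lambda>x. c * f x) = (\<lambda>x. c * kapply K f x)"
  unfolding kapply_def by (simp add: mult.left_commute[of _ c] infsum_cmult_right')

lemma kapply_diff: "is_l2 f \<Longrightarrow> is_l2 g \<Longrightarrow> kapply K (\<lambda>x. f x - g x) = (\<lambda>x. kapply K f x - kapply K g x)"
  using kapply_add[of f "\<lambda>x. - 1 * g x", OF _ is_l2_scale] kapply_scale[of "- 1" g] by simp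

lemma kapply_sum:
  "(\<And>i. i \<in> I \<Longrightarrow> is_l2 (f i)) \<Longrightarrow> kapply K (\<lambda>x. \<Sum>i\<in>I. f i x) = (\<lambda>x. \<Sum>i\<in>I. kapply K (f i) x)"
proof (induction I rule: infinite_finite_induct)
  case (insert i I)
  have "is_l2 (\<lambda>x. \<Sum>i\<in>I. f i x)"
    using insert by (auto simp: is_l2_iff_sqint intro: sqint_sum)
  then show ?case
    using insert by (simp add: kapply_add)
qed (auto simp: kapply_def)

lemma kapply_trunc: "finite F \<Longrightarrow> kapply K (trunc f F) = (\<lambda>x. \<Sum>y\<in>F. f y * K x y)"
  unfolding trunc_eq_sum_delta
  by (simp add: kapply_sum is_l2_scale is_l2_delta kapply_scale kapply_delta)

lemma tendsto_kapply:
  assumes "is_l2 f" "\<And>i. is_l2 (g i)" "((\<lambda>i. l2norm (\<lambda>x. f x - g i x)) \<longlongrightarrow> 0) F"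
  shows "((\<lambda>i. l2norm (\<lambda>x. kapply K f x - kapply K (g i) x)) \<longlongrightarrow> 0) F"
proof -
  obtain C where C: "0 \<le> C" "\<And>f. is_l2 f \<Longrightarrow> l2norm (kapply K f) \<le> C * l2norm f"
    using bounded_kernelE[OF K] by metis
  have "((\<lambda>i. C * l2norm (\<lambda>x. f x - g i x)) \<longlongrightarrow> 0) F"
    using tendsto_mult_right_zero[OF assms(3)] .
  then show ?thesis
    by (rule Lim_null_comparison[rotated])
      (use assms C in \<open>auto intro!: always_eventually C is_l2_diff simp: kapply_diff[symmetric]\<close>)
qed

lemma kapply_bound_if_finite_support:
  assumes "\<And>F f. finite F \<Longrightarrow> l2norm (kapply K (trunc f F)) \<le> R * l2norm (trunc f F)" "0 \<le> R" "is_l2 f"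
  shows "l2norm (kapply K f) \<le> R * l2norm f"
proof (rule tendsto_upperbound)
  have fin: "\<forall>\<^sub>F F in finite_subsets_at_top (UNIV :: 'v set). finite F"
    by (auto intro!: eventually_finite_subsets_at_top_weakI)
  \<comment> \<open>Set to \<open>f\<close> on infinite sets so that every \<open>g F\<close> lies
    in l2; the limit along finite subsets is unaffected.\<close>
  define g where "g F = (if finite F then trunc f F else f)" for F
  have g: "is_l2 (g F)" for F
    using assms(3) by (simp add: g_def is_l2_trunc)
  have "((\<lambda>F. l2norm (\<lambda>x. f x - g F x)) \<longlongrightarrow> 0) (finite_subsets_at_top UNIV)"
    by (rule Lim_transform_eventually[OF tendsto_trunc[OF assms(3)]])
      (use fin in \<open>eventually_elim, simp add: g_def\<close>)
  then have "((\<lambda>F. L2nrm counting (\<lambda>x. kapply K f x - kapply K (g F) x)) \<longlongrightarrow> 0) (finite_subsets_at_top UNIV)"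
    using tendsto_kapply[OF assms(3) g] by (simp add: l2norm_eq_L2nrm)
  then have "((\<lambda>F. L2nrm counting (kapply K (g F))) \<longlongrightarrow> L2nrm counting (kapply K f)) (finite_subsets_at_top UNIV)"
    using g assms(3) by (intro L2nrm_tendsto) (auto simp: is_l2_iff_sqint[symmetric] is_l2_kapply)
  then show "((\<lambda>F. l2norm (kapply K (g F))) \<longlongrightarrow> l2norm (kapply K f)) (finite_subsets_at_top UNIV)"
    by (simp add: l2norm_eq_L2nrm)
  show "\<forall>\<^sub>F F in finite_subsets_at_top UNIV. l2norm (kapply K (g F)) \<le> R * l2norm f"
    using fin
  proof eventually_elim
    case (elim F)
    have "l2norm (kapply K (trunc f F)) \<le> R * l2norm (trunc f F)"
      using assms(1) elim by blast
    also have "\<dots> \<le> R * l2norm f"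
      using l2norm_trunc_le[OF assms(3) elim] assms(2) by (rule mult_left_mono)
    finally show ?case using elim by (simp add: g_def)
  qed
qed auto

text \<open>The double sum behind this identity need not converge absolutely, so it is verified for
  finitely supported f and extended by continuity of both sides in f.\<close>

lemma l2inner_kapply:
  assumes K': "bounded_kernel (kadj K)" and f: "is_l2 f" and g: "is_l2 g"
  shows "l2inner (kapply K f) g = l2inner f (kapply (kadj K) g)"
proof -
  define h where "h F = (if finite F then trunc f F else f)" for F
  have h: "is_l2 (h F)" for F
    using f by (simp add: h_def is_l2_trunc)
  have K'g: "is_l2 (kapply (kadj K) g)"
    using bounded_kernelE[OF K'] g by metis
  have fin: "\<forall>\<^sub>F F in finite_subsets_at_top (UNIV :: 'v set). finite F"
    by (auto intro!: eventually_finite_subsets_at_top_weakI)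
  have lim: "((\<lambda>F. l2norm (\<lambda>x. f x - h F x)) \<longlongrightarrow> 0) (finite_subsets_at_top UNIV)"
    by (rule Lim_transform_eventually[OF tendsto_trunc[OF f]])
      (use fin in \<open>eventually_elim, simp add: h_def\<close>)
  have lim1: "((\<lambda>F. l2inner (kapply K (h F)) g) \<longlongrightarrow> l2inner (kapply K f) g) (finite_subsets_at_top UNIV)"
    using tendsto_kapply[OF f h lim] f g h is_l2_kapply
    unfolding l2inner_eq_L2ip l2norm_eq_L2nrm is_l2_iff_sqint by (intro L2ip_tendsto_left) auto
  have lim2: "((\<lambda>F. l2inner (h F) (kapply (kadj K) g)) \<longlongrightarrow> l2inner f (kapply (kadj K) g)) (finite_subsets_at_top UNIV)"
    using lim f K'g h
    unfolding l2inner_eq_L2ip l2norm_eq_L2nrm is_l2_iff_sqint by (intro L2ip_tendsto_left) auto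
  have "l2inner (kapply K (trunc f F)) g = l2inner (trunc f F) (kapply (kadj K) g)" if F: "finite F" for F
  proof -
    have "l2inner (kapply K (trunc f F)) g = (\<Sum>y\<in>F. f y * l2inner (\<lambda>x. K x y) g)"
      using F g is_l2_column unfolding l2inner_eq_L2ip is_l2_iff_sqint
      by (simp add: kapply_trunc L2ip_sum_left sqint_scale L2ip_scale_left)
    moreover have "l2inner (trunc f F) (kapply (kadj K) g) = (\<Sum>y\<in>F. f y * l2inner (delta y) (kapply (kadj K) g))"
      using F K'g unfolding l2inner_eq_L2ip is_l2_iff_sqint
      by (simp add: trunc_eq_sum_delta L2ip_sum_left sqint_scale L2ip_scale_left
          is_l2_delta[unfolded is_l2_iff_sqint])
    \<comment> \<open>Pairing with a delta reads off one coordinate, and the coordinate of the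
      adjoint at y is the conjugate of the pairing of column y of \<open>K\<close> with g.\<close>
    moreover have "l2inner (delta y) (kapply (kadj K) g) = l2inner (\<lambda>x. K x y) g" for y
    proof -
      have "l2inner (delta y) u = cnj (u y)" for u
      proof -
        have "(\<Sum>\<^sub>\<infinity>x. delta y x * cnj (u x)) = (\<Sum>\<^sub>\<infinity>x\<in>{y}. delta y x * cnj (u x))"
          by (rule infsum_cong_neutral) (auto simp: delta_def)
        then show ?thesis by (simp add: l2inner_def delta_def)
      qed
      then have "l2inner (delta y) (kapply (kadj K) g) = cnj (kapply (kadj K) g y)" .
      also have "\<dots> = l2inner (\<lambda>x. K x y) g"
        by (simp add: kapply_def kadj_def l2inner_def flip: infsum_cnj)
      finally show ?thesis .
    qed
    ultimately show ?thesis by simp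
  qed
  then have "\<forall>\<^sub>F F in finite_subsets_at_top UNIV. l2inner (h F) (kapply (kadj K) g) = l2inner (kapply K (h F)) g"
    by (intro eventually_finite_subsets_at_top_weakI) (simp add: h_def)
  from tendsto_unique[OF finite_subsets_at_top_neq_bot lim1 Lim_transform_eventually[OF lim2 this]]
  show ?thesis .
qed

end

lemma kadj_kadj: "kadj (kadj K) = K"
  by (intro ext) (simp add: kadj_def)

text \<open>The exchange of the two sums is the adjoint relation for T, applied to the conjugated
  row of S at x.\<close>

lemma kapply_kcomp:
  assumes S: "bounded_kernel S" and T: "bounded_kernel T" "bounded_kernel (kadj T)"
    and row: "is_l2 (S x)" and f: "is_l2 f"
  shows "kapply (kcomp S T) f x = kapply S (kapply T f) x"
proof -
  have "kapply S (kapply T f) x = l2inner (kapply T f) (\<lambda>y. cnj (S x y))"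
    by (simp add: kapply_def l2inner_def mult.commute)
  also have "\<dots> = l2inner f (kapply (kadj T) (\<lambda>y. cnj (S x y)))"
    by (intro l2inner_kapply T f is_l2_cnj row)
  also have "\<dots> = kapply (kcomp S T) f x"
    unfolding kapply_def l2inner_def kcomp_def kadj_def
    by (simp flip: infsum_cnj add: mult.commute)
  finally show ?thesis ..
qed

text \<open>Finitely many output coordinates are controlled while the input truncation grows; only
  then is the set of output coordinates enlarged.\<close>

lemma bounded_kernelI_finite_support:
  fixes K :: "'v \<Rightarrow> 'v \<Rightarrow> complex"
  assumes row: "\<And>x. is_l2 (K x)" and C: "0 \<le> C"
    and bound: "\<And>f F. finite F \<Longrightarrow> is_l2 (\<lambda>x. \<Sum>y\<in>F. f y * K x y) \<and>
      l2norm (\<lambda>x. \<Sum>y\<in>F. f y * K x y) \<le> C * l2norm (trunc f F)"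
  shows "bounded_kernel K"
  unfolding bounded_kernel_def
proof (intro exI allI impI conjI)
  fix f :: "'v \<Rightarrow> complex" assume f: "is_l2 f"
  show sm: "(\<lambda>y. K x y * f y) summable_on UNIV" for x
    using row f by (rule l2_mult_summable)
  have "(\<Sum>x\<in>G. (cmod (kapply K f x))\<^sup>2) \<le> (C * l2norm f)\<^sup>2" if G: "finite G" for G
  proof (rule tendsto_upperbound)
    show "((\<lambda>F. \<Sum>x\<in>G. (cmod (\<Sum>y\<in>F. K x y * f y))\<^sup>2) \<longlongrightarrow> (\<Sum>x\<in>G. (cmod (kapply K f x))\<^sup>2)) (finite_subsets_at_top UNIV)"
      unfolding kapply_def by (intro tendsto_sum tendsto_power tendsto_norm infsum_tendsto sm)
    show "\<forall>\<^sub>F F in finite_subsets_at_top UNIV. (\<Sum>x\<in>G. (cmod (\<Sum>y\<in>F. K x y * f y))\<^sup>2) \<le> (C * l2norm f)\<^sup>2"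
    proof (rule eventually_finite_subsets_at_top_weakI)
      fix F :: "'v set" assume F: "finite F"
      have "(\<Sum>x\<in>G. (cmod (\<Sum>y\<in>F. K x y * f y))\<^sup>2) = (\<Sum>x\<in>G. (cmod (\<Sum>y\<in>F. f y * K x y))\<^sup>2)"
        by (simp add: mult.commute)
      also have "\<dots> \<le> (l2norm (\<lambda>x. \<Sum>y\<in>F. f y * K x y))\<^sup>2"
        using bound[OF F] G by (intro sum_le_l2norm_sq) auto
      also have "\<dots> \<le> (C * l2norm f)\<^sup>2"
        using bound[OF F, of f] mult_left_mono[OF l2norm_trunc_le[OF f F] C] by (intro power_mono) auto
      finally show "(\<Sum>x\<in>G. (cmod (\<Sum>y\<in>F. K x y * f y))\<^sup>2) \<le> (C * l2norm f)\<^sup>2" .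
    qed
  qed auto
  then show "is_l2 (kapply K f)" "l2norm (kapply K f) \<le> C * l2norm f"
    using C by (auto intro!: l2_bounded_by_finite_sums[of "C * l2norm f"])
qed

section \<open>Distances and spheres in the Cayley tree\<close>

lemma walk_iff_successively: "walk E xs \<longleftrightarrow> xs \<noteq> [] \<and> successively E xs"
  by (auto simp: walk_def successively_conv_nth)

lemma walk_Cons: "walk E xs \<Longrightarrow> E x (hd xs) \<Longrightarrow> walk E (x # xs)"
  by (auto simp: walk_iff_successively successively_Cons)

text \<open>Cutting out the stretch between two visits to a vertex keeps the ends. The vertex set
  only shrinks, so a vertex avoided before is still avoided; this is needed when a path is closed to
  a cycle.\<close>

lemma walk_shorten:
  assumes "walk E xs"
  shows "\<exists>zs. walk E zs \<and> hd zs = hd xs \<and> last zs = last xs \<and> distinct zs \<and> set zs \<subseteq> set xs"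
  using assms
proof (induction "length xs" arbitrary: xs rule: less_induct)
  case less
  show ?case
  proof (cases "distinct xs")
    case False
    then obtain as y bs counting where xs: "xs = as @ [y] @ bs @ [y] @ counting"
      using not_distinct_decomp by blast
    define ws where "ws = as @ [y] @ counting"
    have "walk E ws"
      using less.prems unfolding xs ws_def walk_iff_successively
      by (auto simp: successively_append_iff successively_Cons)
    moreover have "length ws < length xs" "hd ws = hd xs" "last ws = last xs" "set ws \<subseteq> set xs"
      by (auto simp: xs ws_def hd_append)
    ultimately show ?thesis
      using less.hyps[of ws] by fastforce
  qed (use less in blast)
qed

locale tree_graph =
  fixes k :: nat and E :: "'v \<Rightarrow> 'v \<Rightarrow> bool"
  assumes k_pos: "1 \<le> k" and tree: "cayley_tree k E"
begin

lemma edge_sym: "E x y \<Longrightarrow> E y x"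
  and edge_irrefl: "\<not> E x x"
  and finite_nbrs: "finite {y. E x y}"
  and card_nbrs: "card {y. E x y} = k + 1"
  and ex_walk: "\<exists>xs. walk E xs \<and> hd xs = x \<and> last xs = y"
  using tree unfolding cayley_tree_def by auto

lemma no_cycle: "3 \<le> length xs \<Longrightarrow> distinct xs \<Longrightarrow> walk E xs \<Longrightarrow> \<not> E (last xs) (hd xs)"
  using tree unfolding cayley_tree_def by blast

lemma walk_rev: "walk E xs \<Longrightarrow> walk E (rev xs)"
  unfolding walk_iff_successively successively_rev
  by (auto intro: successively_mono edge_sym)

lemma gdist_walk: "\<exists>xs. walk E xs \<and> hd xs = x \<and> last xs = y \<and> length xs = Suc (gdist E x y)"
proof -
  obtain xs where xs: "walk E xs" "hd xs = x" "last xs = y"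
    using ex_walk by blast
  then have "length xs = Suc (length xs - 1)"
    by (cases xs) (auto simp: walk_def)
  then have "\<exists>n xs. walk E xs \<and> hd xs = x \<and> last xs = y \<and> length xs = Suc n"
    using xs by blast
  then show ?thesis
    unfolding gdist_def by (rule LeastI_ex)
qed

lemma gdist_le_walk:
  assumes "walk E xs" "hd xs = x" "last xs = y" "length xs \<le> Suc n"
  shows "gdist E x y \<le> n"
proof -
  have "length xs = Suc (length xs - 1)"
    using assms by (cases xs) (auto simp: walk_def)
  then have "gdist E x y \<le> length xs - 1"
    unfolding gdist_def using assms by (intro Least_le) blast
  then show ?thesis
    using assms by simp
qed

lemma gdist_self [simp]: "gdist E x x = 0"
  using gdist_le_walk[of "[x]" x x 0] by (simp add: walk_def)

lemma gdist_eq_0_iff [simp]: "gdist E x y = 0 \<longleftrightarrow> x = y"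
proof
  assume "gdist E x y = 0"
  then show "x = y"
    using gdist_walk[of x y] by (auto simp: length_Suc_conv)
qed simp

lemma gdist_commute: "gdist E x y = gdist E y x"
proof -
  have "gdist E x y \<le> gdist E y x" for x y
  proof -
    obtain xs where xs: "walk E xs" "hd xs = y" "last xs = x" "length xs = Suc (gdist E y x)"
      using gdist_walk by blast
    then show ?thesis
      by (intro gdist_le_walk[OF walk_rev[OF xs(1)]])
        (auto simp: hd_rev last_rev walk_def)
  qed
  then show ?thesis
    by (simp add: antisym)
qed

lemma gdist_edge_le: "E z w \<Longrightarrow> gdist E z y \<le> Suc (gdist E w y)"
proof -
  assume zw: "E z w"
  obtain xs where xs: "walk E xs" "hd xs = w" "last xs = y" "length xs = Suc (gdist E w y)"
    using gdist_walk by blast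
  then show ?thesis
    using zw by (intro gdist_le_walk[OF walk_Cons[OF xs(1)]]) (auto simp: walk_def)
qed

lemma gdist_edge_bounds:
  assumes "E z w"
  shows "gdist E z y \<le> Suc (gdist E w y)" "gdist E w y \<le> Suc (gdist E z y)"
  using assms gdist_edge_le edge_sym by blast+

lemma ex_closer_nbr:
  assumes "gdist E z y = Suc n"
  shows "\<exists>w. E z w \<and> gdist E w y = n"
proof -
  obtain xs where xs: "walk E xs" "hd xs = z" "last xs = y" "length xs = Suc (Suc n)"
    using gdist_walk[of z y] assms by auto
  then obtain w ws where ws: "xs = z # w # ws"
    by (cases xs; cases "tl xs") auto
  have zw: "E z w" and "walk E (w # ws)"
    using xs(1) by (auto simp: ws walk_iff_successively)
  then have "gdist E w y \<le> n"
    using xs by (intro gdist_le_walk[of "w # ws"]) (auto simp: ws)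
  then show ?thesis
    using zw gdist_edge_le[OF zw, of y] assms by force
qed

text \<open>Descend to x through ever closer neighbours: after the first vertex all distances lie
  below that of y, and the first vertex differs from y by assumption.\<close>

lemma ex_avoiding_walk:
  assumes "gdist E u x \<le> gdist E y x" "u \<noteq> y"
  shows "\<exists>xs. walk E xs \<and> hd xs = u \<and> last xs = x \<and> y \<notin> set xs"
  using assms
proof (induction "gdist E u x" arbitrary: u)
  case 0
  then show ?case
    by (intro exI[of _ "[x]"]) (auto simp: walk_def)
next
  case (Suc n)
  then obtain w where w: "E u w" "gdist E w x = n"
    using ex_closer_nbr by metis
  then have "gdist E w x \<le> gdist E y x" "w \<noteq> y"
    using Suc by auto
  then obtain xs where xs: "walk E xs" "hd xs = w" "last xs = x" "y \<notin> set xs"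
    using Suc.hyps(1)[of w] w by auto
  then have "xs \<noteq> []"
    by (simp add: walk_def)
  then show ?case
    using Suc.prems w xs walk_Cons[OF xs(1), of u] by (intro exI[of _ "u # xs"]) auto
qed

text \<open>Two descending walks that avoid y meet at x; joined and shortened they give a path from
  u to v, which y closes to a cycle. The bounds are \<le>, so once y has a closer neighbour,
  neighbours at equal distance are excluded too.\<close>

lemma closer_nbr_unique:
  assumes "E y u" "E y v" "gdist E u x \<le> gdist E y x" "gdist E v x \<le> gdist E y x"
  shows "u = v"
proof (rule ccontr)
  assume "u \<noteq> v"
  have "u \<noteq> y" "v \<noteq> y"
    using assms edge_irrefl by blast+
  then obtain p q where p: "walk E p" "hd p = u" "last p = x" "y \<notin> set p"
    and q: "walk E q" "hd q = v" "last q = x" "y \<notin> set q"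
    using ex_avoiding_walk[of u x y] ex_avoiding_walk[of v x y] assms by blast
  obtain q' where q': "rev q = x # q'"
    using q by (cases "rev q") (auto simp: walk_def last_rev hd_rev dest: arg_cong[of _ _ hd])
  obtain p' where p': "p = p' @ [x]"
    using p by (metis append_butlast_last_id walk_def)
  have "walk E (p' @ x # q')"
    using p(1) walk_rev[OF q(1)] unfolding q' p'
    by (auto simp: walk_iff_successively successively_append_iff successively_Cons)
  then obtain zs where zs: "walk E zs" "hd zs = hd (p' @ x # q')" "last zs = last (p' @ x # q')"
      "distinct zs" "set zs \<subseteq> set (p' @ x # q')"
    using walk_shorten by blast
  have h: "hd zs = u"
    using zs(2) p(2) p' by (auto simp: hd_append split: if_splits)
  have "last (rev q) = v"
    using q by (auto simp: last_rev walk_def)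
  then have l: "last zs = v"
    using zs(3) q' by simp
  have "set (rev q) = insert x (set q')"
    unfolding q' by simp
  then have y: "y \<notin> set zs"
    using zs(5) p(4) q(4) p' by auto
  have "length zs \<noteq> 1" "zs \<noteq> []"
    using \<open>u \<noteq> v\<close> h l zs(1) by (auto simp: length_Suc_conv walk_def)
  then have "3 \<le> length (y # zs)"
    by (cases zs) (auto simp: Suc_le_eq)
  moreover have "walk E (y # zs)"
    using zs h assms by (auto intro: walk_Cons)
  moreover have "E (last (y # zs)) (hd (y # zs))"
    using l assms \<open>zs \<noteq> []\<close> by (auto intro: edge_sym)
  ultimately show False
    using no_cycle y zs(4) by (metis distinct.simps(2))
qed

text \<open>These counts are the coefficients in the product of the neighbour operator with the
  sphere operator of radius m + 1. The value k + 1 belongs to z = y, where no neighbour leads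
  back.\<close>

lemma card_nbrs_at_dist:
  "card {w. E z w \<and> gdist E w y = Suc m} =
     (if gdist E z y = Suc (Suc m) then 1
      else if gdist E z y = m then (if m = 0 then k + 1 else k) else 0)"
proof (cases "gdist E z y")
  case 0
  then have "z = y" by simp
  have "gdist E w y = 1" if "E z w" for w
    using gdist_edge_bounds[OF that, of y] that 0 edge_irrefl by (auto simp: le_Suc_eq)
  then have "{w. E z w \<and> gdist E w y = Suc m} = (if m = 0 then {w. E z w} else {})"
    by auto
  then show ?thesis
    using 0 card_nbrs by auto
next
  case (Suc n)
  then obtain u where u: "E z u" "gdist E u y = n"
    using ex_closer_nbr by blast
  have far: "gdist E w y = Suc (Suc n)" if "E z w" "w \<noteq> u" for w
    using closer_nbr_unique[of z w u y] gdist_edge_bounds[OF that(1), of y] that u Suc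
    by (auto simp: le_Suc_eq)
  have "{w. E z w \<and> gdist E w y = Suc m} =
      (if Suc m = n then {u} else if m = Suc n then {w. E z w} - {u} else {})"
  proof -
    have "E z w \<and> gdist E w y = Suc m \<longleftrightarrow> (w = u \<and> Suc m = n) \<or> (E z w \<and> w \<noteq> u \<and> m = Suc n)" for w
      using far[of w] u by (cases "w = u") auto
    then show ?thesis by auto
  qed
  then show ?thesis
    using Suc card_nbrs[of z] finite_nbrs[of z] u by auto
qed

lemma finite_sphere: "finite (sphere E z m)"
proof (induction m arbitrary: z)
  case 0
  have "sphere E z 0 = {z}" by (auto simp: sphere_def)
  then show ?case by simp
next
  case (Suc m)
  have "sphere E z (Suc m) \<subseteq> (\<Union>w\<in>{w. E z w}. sphere E w m)"
  proof
    fix x assume "x \<in> sphere E z (Suc m)"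
    then have "gdist E z x = Suc m"
      by (simp add: sphere_def gdist_commute)
    then show "x \<in> (\<Union>w\<in>{w. E z w}. sphere E w m)"
      using ex_closer_nbr by (fastforce simp: sphere_def gdist_commute)
  qed
  then show ?case
    using Suc finite_nbrs by (meson finite_UN finite_subset)
qed

lemma sphere_0 [simp]: "sphere E z 0 = {z}"
  by (auto simp: sphere_def)

lemma sphere_1: "sphere E z (Suc 0) = {w. E z w}"
proof -
  have "gdist E w z = Suc 0 \<longleftrightarrow> E z w" for w
  proof
    assume "gdist E w z = Suc 0"
    then show "E z w" using ex_closer_nbr edge_sym by fastforce
  next
    assume "E z w"
    then show "gdist E w z = Suc 0"
      using gdist_edge_bounds[of z w z] edge_irrefl by (auto simp: le_Suc_eq)
  qed
  then show ?thesis by (auto simp: sphere_def)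
qed

text \<open>With A_n the sphere operators, this is A_1 A_(m+1) = A_(m+2) + c A_m. The ring is
  general because real and complex profiles are both needed.\<close>

lemma sum_nbrs_spheres:
  fixes f :: "'v \<Rightarrow> 'b :: comm_ring_1"
  shows "(\<Sum>w | E z w. \<Sum>y\<in>sphere E w (Suc m). f y) =
    (\<Sum>y\<in>sphere E z (Suc (Suc m)). f y) + of_nat (if m = 0 then k + 1 else k) * (\<Sum>y\<in>sphere E z m. f y)"
proof -
  \<comment> \<open>A vertex at distance m + 1 from a neighbour of z has distance m or m + 2 from z,
    never m + 1. The common finite range for y allows the sums to be swapped.\<close>
  let ?B = "sphere E z (Suc (Suc m)) \<union> sphere E z m"
  have fin: "finite ?B" by (simp add: finite_sphere)
  have sub: "y \<in> ?B" if "E z w" "gdist E w y = Suc m" for w y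
  proof -
    have "card {w. E z w \<and> gdist E w y = Suc m} > 0"
      using that finite_nbrs[of z] by (subst card_gt_0_iff) auto
    then show ?thesis
      by (auto simp: card_nbrs_at_dist sphere_def gdist_commute split: if_splits)
  qed
  have "(\<Sum>w | E z w. \<Sum>y\<in>sphere E w (Suc m). f y) =
      (\<Sum>w | E z w. \<Sum>y\<in>?B. if gdist E w y = Suc m then f y else 0)"
  proof (rule sum.cong[OF refl])
    fix w assume "w \<in> {w. E z w}"
    then have "sphere E w (Suc m) = {y \<in> ?B. gdist E w y = Suc m}"
      using sub[of w] unfolding sphere_def by (auto simp: gdist_commute[of _ w])
    then show "(\<Sum>y\<in>sphere E w (Suc m). f y) = (\<Sum>y\<in>?B. if gdist E w y = Suc m then f y else 0)"
      by (simp only: sum.inter_filter[OF fin])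
  qed
  also have "\<dots> = (\<Sum>y\<in>?B. \<Sum>w | E z w. if gdist E w y = Suc m then f y else 0)"
    by (rule sum.swap)
  also have "\<dots> = (\<Sum>y\<in>?B. of_nat (card {w. E z w \<and> gdist E w y = Suc m}) * f y)"
    by (simp add: sum.inter_filter[OF finite_nbrs, symmetric])
  also have "\<dots> = (\<Sum>y\<in>sphere E z (Suc (Suc m)). of_nat (card {w. E z w \<and> gdist E w y = Suc m}) * f y)
      + (\<Sum>y\<in>sphere E z m. of_nat (card {w. E z w \<and> gdist E w y = Suc m}) * f y)"
    by (rule sum.union_disjoint[OF finite_sphere finite_sphere]) (auto simp: sphere_def)
  also have "\<dots> = (\<Sum>y\<in>sphere E z (Suc (Suc m)). f y) + (\<Sum>y\<in>sphere E z m. of_nat (if m = 0 then k + 1 else k) * f y)"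
    by (intro arg_cong2[where f = "(+)"] sum.cong)
      (auto simp: card_nbrs_at_dist sphere_def gdist_commute[of z])
  finally show ?thesis
    by (simp add: sum_distrib_left)
qed

lemma sum_nbrs_radial:
  fixes f :: "nat \<Rightarrow> 'b :: comm_ring_1"
  shows "(\<Sum>w | E z w. f (gdist E w x)) =
    (case gdist E z x of 0 \<Rightarrow> of_nat (k + 1) * f 1 | Suc n \<Rightarrow> f n + of_nat k * f (Suc (Suc n)))"
proof (cases "gdist E z x")
  case 0
  then have "\<And>w. E z w \<Longrightarrow> gdist E w x = 1"
    using sphere_1[of x] by (auto simp: sphere_def)
  then have "(\<Sum>w | E z w. f (gdist E w x)) = (\<Sum>w | E z w. f 1)"
    by (intro sum.cong) auto
  then show ?thesis using 0 by (simp add: card_nbrs)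
next
  case (Suc n)
  then obtain u where u: "E z u" "gdist E u x = n"
    using ex_closer_nbr by blast
  have far: "gdist E w x = Suc (Suc n)" if "E z w" "w \<noteq> u" for w
    using closer_nbr_unique[of z w u x] gdist_edge_bounds[OF that(1), of x] that u Suc
    by (auto simp: le_Suc_eq)
  have "(\<Sum>w | E z w. f (gdist E w x)) = f n + (\<Sum>w\<in>{w. E z w} - {u}. f (gdist E w x))"
    using u finite_nbrs by (subst sum.remove[of _ u]) auto
  also have "(\<Sum>w\<in>{w. E z w} - {u}. f (gdist E w x)) = (\<Sum>w\<in>{w. E z w} - {u}. f (Suc (Suc n)))"
    using far by (intro sum.cong) auto
  finally show ?thesis
    using Suc u card_nbrs[of z] finite_nbrs[of z] by simp
qed

text \<open>The function g is chosen before x and z; the three-term recurrence in m carries this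
  uniformity along.\<close>

lemma sphere_sum_radial:
  fixes f :: "nat \<Rightarrow> 'b :: comm_ring_1"
  shows "\<exists>g. \<forall>x z. (\<Sum>y\<in>sphere E z m. f (gdist E y x)) = g (gdist E z x)"
proof (induction m rule: induct_nat_012)
  case 0
  show ?case by auto
next
  case 1
  show ?case
    by (auto simp: sphere_1 sum_nbrs_radial)
next
  case (ge2 m)
  then obtain g h where g: "\<And>x z. (\<Sum>y\<in>sphere E z m. f (gdist E y x)) = g (gdist E z x)"
    and h: "\<And>x z. (\<Sum>y\<in>sphere E z (Suc m). f (gdist E y x)) = h (gdist E z x)"
    by blast
  have "(\<Sum>y\<in>sphere E z (Suc (Suc m)). f (gdist E y x)) =
      (case gdist E z x of 0 \<Rightarrow> of_nat (k + 1) * h 1 | Suc n \<Rightarrow> h n + of_nat k * h (Suc (Suc n)))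
      - of_nat (if m = 0 then k + 1 else k) * g (gdist E z x)" for x z
    using sum_nbrs_spheres[where z = z and m = m and f = "\<lambda>y. f (gdist E y x)"]
    unfolding g h sum_nbrs_radial by (simp add: algebra_simps)
  then show ?case
    by (intro exI[of _ "\<lambda>l. (case l of 0 \<Rightarrow> of_nat (k + 1) * h 1 | Suc n \<Rightarrow> h n + of_nat k * h (Suc (Suc n)))
      - of_nat (if m = 0 then k + 1 else k) * g l"]) blast
qed

section \<open>Cartier-Dunau polynomials as spherical functions\<close>

definition sphere_size :: "nat \<Rightarrow> nat" where
  "sphere_size m = (if m = 0 then 1 else (k + 1) * k ^ (m - 1))"

lemma sphere_size_pos: "0 < sphere_size m"
  using k_pos by (simp add: sphere_size_def)

lemma CD_rec: "(real k + 1) * t * CD k (Suc n) t = real k * CD k (Suc (Suc n)) t + CD k n t"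
  using k_pos by simp

text \<open>The recurrence of the polynomials is the eigenvalue equation of the neighbour sum for a
  radial function, with eigenvalue (k + 1) t.\<close>

lemma nbr_sum_CD: "(\<Sum>w | E z w. CD k (gdist E w x) t) = (real k + 1) * t * CD k (gdist E z x) t"
proof (cases "gdist E z x")
  case 0
  then show ?thesis
    unfolding sum_nbrs_radial[where f = "\<lambda>n. CD k n t"] by simp
next
  case (Suc n)
  then show ?thesis
    unfolding sum_nbrs_radial[where f = "\<lambda>n. CD k n t"] Suc CD_rec by simp
qed

text \<open>Sphere operators are polynomials in the neighbour operator, so they keep its
  eigenfunctions; the eigenvalues follow the recurrence of \<open>CD\<close> up to the factor
  \<open>sphere_size m\<close>.\<close>

lemma sphere_sum_CD:
  "(\<Sum>y\<in>sphere E z m. CD k (gdist E y x) t) = sphere_size m * CD k m t * CD k (gdist E z x) t"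
proof (induction m arbitrary: z rule: induct_nat_012)
  case 0
  show ?case by (simp add: sphere_size_def)
next
  case 1
  show ?case
    unfolding sphere_1 nbr_sum_CD by (simp add: sphere_size_def)
next
  case (ge2 m)
  let ?P = "CD k (gdist E z x) t"
  have nbrs: "(\<Sum>w | E z w. sphere_size (Suc m) * CD k (Suc m) t * CD k (gdist E w x) t) =
      sphere_size (Suc m) * CD k (Suc m) t * ((real k + 1) * t * ?P)"
    by (simp only: sum_distrib_left[symmetric] nbr_sum_CD)
  have "(\<Sum>y\<in>sphere E z (Suc (Suc m)). CD k (gdist E y x) t) =
      (\<Sum>w | E z w. \<Sum>y\<in>sphere E w (Suc m). CD k (gdist E y x) t)
      - of_nat (if m = 0 then k + 1 else k) * (\<Sum>y\<in>sphere E z m. CD k (gdist E y x) t)"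
    unfolding sum_nbrs_spheres by simp
  also have "\<dots> = sphere_size (Suc m) * ((real k + 1) * t * CD k (Suc m) t) * ?P
      - of_nat (if m = 0 then k + 1 else k) * (sphere_size m * CD k m t * ?P)"
    unfolding ge2 nbrs by (simp only: mult_ac)
  also have "\<dots> = sphere_size (Suc (Suc m)) * CD k (Suc (Suc m)) t * ?P"
  proof -
    have size1: "sphere_size (Suc m) = (if m = 0 then k + 1 else k) * sphere_size m"
      by (cases m) (simp_all add: sphere_size_def distrib_left)
    have size2: "sphere_size (Suc (Suc m)) = k * sphere_size (Suc m)"
      by (simp add: sphere_size_def distrib_left)
    \<comment> \<open>The \<open>P0\<close> terms cancel because the coefficient \<open>c\<close> of
      the lower sphere is also the ratio of consecutive sphere sizes.\<close>
    have "s1 * (k' * P2 + P0) * P - c * (s0 * P0 * P) = k' * s1 * P2 * P"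
      if "s1 = c * s0" for s0 s1 k' c P0 P2 P :: real
      using that by algebra
    then show ?thesis
      unfolding CD_rec size2 of_nat_mult by this (simp only: size1 of_nat_mult)
  qed
  finally show ?case .
qed

lemma CD_at_1: "CD k n 1 = 1"
  using k_pos by (induction n rule: induct_nat_012) auto

text \<open>At t = 1 every polynomial equals 1, and the product formula turns into a count.\<close>

lemma card_sphere: "card (sphere E z m) = sphere_size m"
proof -
  have "real (card (sphere E z m)) = real (sphere_size m)"
    using sphere_sum_CD[where t = 1 and x = z and z = z and m = m] unfolding CD_at_1 by simp
  then show ?thesis by simp
qed

end

section \<open>The orthogonality measure of the Cartier--Dunau polynomials\<close>

lemma has_integral_cos_multiple:
  "((\<lambda>x. cos (real n * x)) has_integral (if n = 0 then pi else 0)) {0..pi}"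
proof (cases "n = 0")
  case True
  then show ?thesis
    using has_integral_const_real[of "1::real" 0 pi] by simp
next
  case False
  have "((\<lambda>x. cos (real n * x)) has_integral (sin (real n * pi) / n - sin (real n * 0) / n)) {0..pi}"
    by (rule fundamental_theorem_of_calculus)
      (use False in \<open>auto intro!: derivative_eq_intros simp: has_real_derivative_iff_has_vector_derivative[symmetric]\<close>)
  then show ?thesis
    using False by simp
qed

lemma has_integral_sin_sin:
  "((\<lambda>x. sin x * sin ((real n + 1) * x)) has_integral (if n = 0 then pi / 2 else 0)) {0..pi}"
proof -
  have "((\<lambda>x. (cos (real n * x) - cos (real (n + 2) * x)) / 2) has_integral
      ((if n = 0 then pi else 0) - (if n + 2 = 0 then pi else 0)) / 2) {0..pi}"
    by (intro has_integral_divide has_integral_diff has_integral_cos_multiple)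
  moreover have "(cos (real n * x) - cos (real (n + 2) * x)) / 2 = sin x * sin ((real n + 1) * x)" for x
    using cos_diff[of "(real n + 1) * x" x] cos_add[of "(real n + 1) * x" x] by (simp add: algebra_simps)
  ultimately show ?thesis
    by auto
qed

text \<open>Under the substitution t = - r cos x, with r the right end point of the support of the measure, the
  integrand P_n becomes CD_wave, up to a constant factor. For k = 1 the kernel vanishes at x = 0 and x = pi,
  where the quotients below have the junk value 0.\<close>

definition CD_kernel :: "nat \<Rightarrow> real \<Rightarrow> real" where
  "CD_kernel k x = (real k + 1)\<^sup>2 - 4 * real k * (cos x)\<^sup>2"

definition CD_wave :: "nat \<Rightarrow> nat \<Rightarrow> real \<Rightarrow> real" where
  "CD_wave k n x = sin x * (real k * sin ((real n + 1) * x) - sin ((real n - 1) * x)) / CD_kernel k x"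

text \<open>In this form the kernel is visibly nonnegative, at least 1 for k \<ge> 2, and for k = 1
  zero only where sin x = 0.\<close>

lemma CD_kernel_alt: "CD_kernel k x = (real k - 1)\<^sup>2 + 4 * real k * (sin x)\<^sup>2"
  unfolding CD_kernel_def cos_squared_eq by (simp add: power2_eq_square algebra_simps)

text \<open>The kernel is |k - exp(2ix)|^2 = k^2 + 1 - 2k cos 2x. Sines whose indices differ from n
  + 1 by two add up to a multiple of cos 2x, so the combined numerator contains the kernel as a
  factor.\<close>

lemma CD_wave_rec:
  assumes "CD_kernel k x \<noteq> 0"
  shows "real k * CD_wave k n x - CD_wave k (n + 2) x = sin x * sin ((real n + 1) * x)"
proof -
  let ?s = "sin ((real n + 1) * x)"
  have D: "CD_kernel k x = (real k)\<^sup>2 + 1 - 2 * real k * cos (2 * x)"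
    unfolding CD_kernel_def cos_double_cos by (simp add: power2_eq_square algebra_simps)
  have "sin ((real n + 3) * x) + sin ((real n - 1) * x) = 2 * cos (2 * x) * ?s"
    using sin_add[of "(real n + 1) * x" "2 * x"] sin_diff[of "(real n + 1) * x" "2 * x"]
    by (simp add: algebra_simps)
  then have "real k * (real k * ?s - sin ((real n - 1) * x)) - (real k * sin ((real n + 3) * x) - ?s) = CD_kernel k x * ?s"
    unfolding D by algebra
  moreover have "real k * CD_wave k n x - CD_wave k (n + 2) x =
      sin x * (real k * (real k * ?s - sin ((real n - 1) * x)) - (real k * sin ((real n + 3) * x) - ?s)) / CD_kernel k x"
    unfolding CD_wave_def by (simp add: diff_divide_distrib right_diff_distrib mult_ac add_ac)
  ultimately show ?thesis
    using assms by simp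
qed

text \<open>For k \<ge> 2 a nonzero J_n with n \<ge> 1 would grow like powers of k although the
  integrals are bounded. For k = 1 this growth is absent, but there the wave is just
  cos(nx)/2.\<close>

lemma has_integral_CD_wave:
  assumes k: "1 \<le> k"
  shows "(CD_wave k n has_integral (if n = 0 then pi / (2 * real k) else 0)) {0..pi}"
proof (cases "k = 1")
  case True
  have "((\<lambda>x. cos (real n * x) / 2) has_integral (if n = 0 then pi else 0) / 2) (cbox 0 pi)"
    by (intro has_integral_divide) (simp add: has_integral_cos_multiple)
  \<comment> \<open>Only the interior counts: at the end points the quotient has its default value 0
    instead of cos(nx)/2.\<close>
  moreover have "CD_wave k n x = cos (real n * x) / 2" if "x \<in> box 0 pi" for x
  proof -
    have "sin x \<noteq> 0" using that sin_gt_zero by fastforce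
    moreover have "sin ((real n + 1) * x) - sin ((real n - 1) * x) = 2 * cos (real n * x) * sin x"
      using sin_add[of "real n * x" x] sin_diff[of "real n * x" x] by (simp add: algebra_simps)
    ultimately show ?thesis
      using True unfolding CD_wave_def CD_kernel_alt by (simp add: power2_eq_square)
  qed
  ultimately have "(CD_wave k n has_integral (if n = 0 then pi else 0) / 2) (cbox 0 pi)"
    by (rule has_integral_spike_interior) auto
  then show ?thesis using True by auto
next
  case False
  then have k2: "2 \<le> real k" using k by simp
  have "1\<^sup>2 \<le> (real k - 1)\<^sup>2"
    using k2 by (intro power_mono) auto
  then have ge1: "1 \<le> CD_kernel k x" for x
    unfolding CD_kernel_alt by (simp add: add_increasing2)
  then have nz: "CD_kernel k x \<noteq> 0" for x
    using not_one_le_zero by (metis)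
  define J where "J n = integral {0..pi} (CD_wave k n)" for n
  have "continuous_on {0..pi} (CD_wave k n)" for n
    using nz unfolding CD_wave_def CD_kernel_def by (intro continuous_intros) auto
  then have J: "(CD_wave k n has_integral J n) {0..pi}" for n
    unfolding J_def by (intro integrable_integral integrable_continuous_real)
  \<comment> \<open>The inhomogeneous term survives at n = 0 alone, by orthogonality of sin x and
    sin((n + 1) x).\<close>
  have rec: "J (n + 2) = real k * J n - (if n = 0 then pi / 2 else 0)" for n
  proof -
    have "((\<lambda>x. real k * CD_wave k n x - CD_wave k (n + 2) x) has_integral real k * J n - J (n + 2)) {0..pi}"
      by (intro has_integral_diff has_integral_mult_right J)
    then have "real k * J n - J (n + 2) = (if n = 0 then pi / 2 else 0)"
      unfolding CD_wave_rec[OF nz] using has_integral_sin_sin by (rule has_integral_unique)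
    then show ?thesis by linarith
  qed
  have bound: "\<bar>J n\<bar> \<le> (real k + 1) * pi" for n
  proof -
    have "\<bar>CD_wave k n x\<bar> \<le> real k + 1" for x
    proof -
      let ?u = "real k * sin ((real n + 1) * x) - sin ((real n - 1) * x)"
      have "\<bar>?u\<bar> \<le> \<bar>real k * sin ((real n + 1) * x)\<bar> + \<bar>sin ((real n - 1) * x)\<bar>"
        by (rule abs_triangle_ineq4)
      also have "\<dots> \<le> real k * 1 + 1"
        unfolding abs_mult by (intro add_mono mult_mono) auto
      finally have "\<bar>sin x\<bar> * \<bar>?u\<bar> \<le> 1 * (real k + 1)"
        by (intro mult_mono) auto
      then have "\<bar>sin x\<bar> * \<bar>?u\<bar> \<le> (real k + 1) * CD_kernel k x"
        using mult_left_mono[OF ge1[of x], of "real k + 1"] by linarith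
      then show ?thesis
        unfolding CD_wave_def abs_divide abs_mult using ge1[of x] by (simp add: pos_divide_le_eq)
    qed
    then show ?thesis
      using has_integral_bound_real[OF _ finite.emptyI J[of n], of "real k + 1"] by simp
  qed
  have zero: "J n = 0" if "n \<ge> 1" for n
  proof (rule ccontr)
    assume "J n \<noteq> 0"
    have iter: "J (n + 2 * j) = real k ^ j * J n" for j
    proof (induction j)
      case (Suc j)
      then show ?case
        using rec[of "n + 2 * j"] that by (simp add: algebra_simps)
    qed simp
    obtain j where "(real k + 1) * pi / \<bar>J n\<bar> < real k ^ j"
      using real_arch_pow[of "real k" "(real k + 1) * pi / \<bar>J n\<bar>"] k2 by auto
    then have "(real k + 1) * pi < \<bar>J (n + 2 * j)\<bar>"
      using \<open>J n \<noteq> 0\<close> by (simp add: iter abs_mult pos_divide_less_eq)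
    then show False
      using bound[of "n + 2 * j"] by simp
  qed
  \<comment> \<open>J_2 = 0 by the growth argument, so the inhomogeneous relation at n = 0
    determines J_0.\<close>
  have "J 0 = pi / (2 * real k)"
    using rec[of 0] zero[of "0 + 2"] k2 by (simp add: field_simps)
  then show ?thesis
    using J[of n] zero[of n] by (cases "n = 0") auto
qed

definition CD_radius :: "nat \<Rightarrow> real" where
  "CD_radius k = 2 * sqrt (real k) / (real k + 1)"

lemma CD_radius_bounds: "0 \<le> CD_radius k" "CD_radius k \<le> 1"
proof -
  show "0 \<le> CD_radius k" by (simp add: CD_radius_def)
  have "2 * sqrt (real k) * 1 \<le> (sqrt (real k))\<^sup>2 + 1\<^sup>2"
    by (rule sum_squares_bound)
  then show "CD_radius k \<le> 1" by (simp add: CD_radius_def)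
qed

lemma CD_radius_sq: "(CD_radius k)\<^sup>2 = 4 * real k / (real k + 1)\<^sup>2"
  by (simp add: CD_radius_def power_divide power_mult_distrib)

text \<open>This is the Chebyshev form k^(-n/2) (k U_n - U_(n-2)) / (k + 1) with U_n of the second
  kind, multiplied by sin x so that it also holds where sin x vanishes.\<close>

lemma CD_cos:
  assumes k: "1 \<le> k"
  shows "CD k n (CD_radius k * cos x) * sin x =
    (1 / sqrt (real k)) ^ n * (real k * sin ((real n + 1) * x) - sin ((real n - 1) * x)) / (real k + 1)"
proof -
  define r where "r = sqrt (real k)"
  have r: "r > 0" "r * r = real k"
    using k by (auto simp: r_def)
  define v where "v n = real k * sin ((real n + 1) * x) - sin ((real n - 1) * x)" for n
  have v: "2 * cos x * v (Suc n) = v (Suc (Suc n)) + v n" for n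
  proof -
    have p: "2 * cos x * sin A = sin (A + x) + sin (A - x)" for A
      by (simp add: sin_add sin_diff)
    have "2 * cos x * v (Suc n) = real k * (2 * cos x * sin ((real n + 2) * x)) - 2 * cos x * sin (real n * x)"
      by (simp add: v_def algebra_simps)
    also have "\<dots> = v (Suc (Suc n)) + v n"
      unfolding p by (simp add: v_def algebra_simps)
    finally show ?thesis .
  qed
  have "CD k n (CD_radius k * cos x) * sin x = (1 / r) ^ n * v n / (real k + 1)"
  proof (induction n rule: induct_nat_012)
    case 0
    show ?case by (simp add: v_def field_simps)
  next
    case 1
    have "v 1 = real k * (2 * sin x * cos x)"
      by (simp add: v_def sin_double)
    then show ?case
      using r(1) by (simp add: CD_radius_def r_def[symmetric] r(2)[symmetric])
  next
    case (ge2 n)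
    let ?c = "CD_radius k * cos x"
    have a: "(real k + 1) * ?c = 2 * r * cos x"
      by (simp add: CD_radius_def r_def add_eq_0_iff)
    define q where "q = (1 / r) ^ n"
    have q: "(1 / r) ^ Suc n = q / r" "(1 / r) ^ Suc (Suc n) = q / real k"
      by (simp_all add: q_def r(2)[symmetric])
    have "CD k (Suc (Suc n)) ?c * sin x =
        ((real k + 1) * ?c * (CD k (Suc n) ?c * sin x) - CD k n ?c * sin x) / real k"
      by (simp add: left_diff_distrib)
    also have "\<dots> = (2 * r * cos x * (q / r * v (Suc n) / (real k + 1)) - q * v n / (real k + 1)) / real k"
      unfolding ge2 a q q_def[symmetric] ..
    also have "\<dots> = (q * (2 * cos x * v (Suc n)) - q * v n) / (real k + 1) / real k"
      using r(1) by (simp add: diff_divide_distrib)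
    also have "\<dots> = (1 / r) ^ Suc (Suc n) * v (Suc (Suc n)) / (real k + 1)"
      unfolding v q by (simp add: algebra_simps)
    finally show ?case .
  qed
  then show ?thesis
    by (simp add: v_def r_def)
qed

text \<open>Parity reconciles the substitution t = - r cos x, chosen because it increases on
  [0, pi], with the trigonometric form, which is stated at r cos x.\<close>

lemma CD_minus: "CD k n (- t) = (- 1) ^ n * CD k n t"
  by (induction n rule: induct_nat_012) (simp_all add: right_diff_distrib diff_divide_distrib mult_ac)

definition CD_weight :: "nat \<Rightarrow> real \<Rightarrow> real" where
  "CD_weight k t = (real k + 1) / (2 * pi) * sqrt (4 * real k / (real k + 1)\<^sup>2 - t\<^sup>2) / (1 - t\<^sup>2)"

lemma Pi_density_eq: "Pi_density k t = CD_weight k t * indicator {- CD_radius k .. CD_radius k} t"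
  by (simp add: Pi_density_def CD_weight_def CD_radius_def)

lemma CD_weight_nonneg: "t \<in> {- CD_radius k .. CD_radius k} \<Longrightarrow> 0 \<le> CD_weight k t"
proof -
  assume "t \<in> {- CD_radius k .. CD_radius k}"
  then have "\<bar>t\<bar> \<le> CD_radius k" by auto
  then have t: "t\<^sup>2 \<le> (CD_radius k)\<^sup>2"
    using CD_radius_bounds(1)[of k] by (metis abs_le_square_iff abs_of_nonneg)
  then have "t\<^sup>2 \<le> 1"
    using CD_radius_bounds[of k] power_mono[of "CD_radius k" 1 2] by simp
  then show ?thesis
    using t unfolding CD_weight_def CD_radius_sq by simp
qed

lemma Pi_density_nonneg: "0 \<le> Pi_density k t"
  using CD_weight_nonneg[of t k] by (auto simp: Pi_density_eq indicator_def)

lemma CD_weight_measurable [measurable]: "CD_weight k \<in> borel_measurable borel"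
  unfolding CD_weight_def by measurable

lemma Pi_density_measurable [measurable]: "Pi_density k \<in> borel_measurable borel"
  unfolding Pi_density_eq by measurable

text \<open>The square root contributes one factor r sin x and the derivative of the substitution
  another; for k = 1 they cancel the singularity at the ends.\<close>

lemma CD_weight_subst:
  assumes k: "1 \<le> k" and x: "x \<in> {0..pi}"
  shows "CD_weight k (- (CD_radius k * cos x)) * (CD_radius k * sin x) =
    2 * real k * (real k + 1) / pi * (sin x)\<^sup>2 / CD_kernel k x"
proof -
  have s: "0 \<le> sin x" using x by (simp add: sin_ge_zero)
  have "4 * real k / (real k + 1)\<^sup>2 - (- (CD_radius k * cos x))\<^sup>2 = (CD_radius k * sin x)\<^sup>2"
    unfolding CD_radius_sq[symmetric] sin_squared_eq power_mult_distrib by (simp add: algebra_simps)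
  then have sq: "sqrt (4 * real k / (real k + 1)\<^sup>2 - (- (CD_radius k * cos x))\<^sup>2) = CD_radius k * sin x"
    using s CD_radius_bounds(1)[of k] by (metis abs_of_nonneg mult_nonneg_nonneg real_sqrt_abs)
  have D: "1 - (- (CD_radius k * cos x))\<^sup>2 = CD_kernel k x / (real k + 1)\<^sup>2"
    unfolding CD_kernel_def power_mult_distrib power2_minus CD_radius_sq
    by (simp add: field_simps)
  have "CD_weight k (- (CD_radius k * cos x)) * (CD_radius k * sin x) =
      (real k + 1) / (2 * pi) * ((CD_radius k)\<^sup>2 * (sin x)\<^sup>2) / (CD_kernel k x / (real k + 1)\<^sup>2)"
    unfolding CD_weight_def sq D by (simp add: power2_eq_square)
  also have "\<dots> = 2 * real k * (real k + 1) / pi * (sin x)\<^sup>2 / CD_kernel k x"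
  proof -
    \<comment> \<open>At a zero of the kernel both sides are quotients by zero and hence 0.\<close>
    have "u / (2 * p) * (4 * K / c * s) / (D / c) = 2 * K * u / p * s / D" if "c \<noteq> 0" for u p K c s D :: real
      using that by (cases "D = 0") (auto simp: field_simps)
    then show ?thesis
      unfolding CD_radius_sq by this (simp add: add_eq_0_iff)
  qed
  finally show ?thesis .
qed

lemma CD_subst_deriv:
  "((\<lambda>x. - (CD_radius k * cos x)) has_real_derivative CD_radius k * sin x) (at x)"
  by (auto intro!: derivative_eq_intros)

text \<open>For k = 1 the weight is 1 / (pi sqrt(1 - t^2)) and unbounded, so integrability is read
  off after the substitution, where the integrand is bounded.\<close>

lemma CD_weight_integrable:
  assumes k: "1 \<le> k"
  shows "set_integrable lborel {- CD_radius k .. CD_radius k} (CD_weight k)"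
proof -
  let ?a = "CD_radius k" and ?g = "\<lambda>x. - (CD_radius k * cos x)" and ?C = "(real k + 1) / (2 * pi)"
  have "(\<integral>\<^sup>+x. ennreal (CD_weight k x * indicator {?g 0..?g pi} x) \<partial>lborel) =
      (\<integral>\<^sup>+x. ennreal (CD_weight k (?g x) * (?a * sin x) * indicator {0..pi} x) \<partial>lborel)"
    by (rule nn_integral_substitution)
      (auto intro!: continuous_intros CD_subst_deriv mult_nonneg_nonneg sin_ge_zero CD_radius_bounds
        simp: set_borel_measurable_def)
  also have "\<dots> \<le> (\<integral>\<^sup>+x. ennreal ?C * indicator {0..pi} x \<partial>lborel)"
  proof (rule nn_integral_mono)
    fix x
    have "CD_weight k (?g x) * (?a * sin x) \<le> ?C" if "x \<in> {0..pi}"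
    proof -
      have le: "4 * real k * (sin x)\<^sup>2 \<le> CD_kernel k x"
        unfolding CD_kernel_alt by simp
      have "(sin x)\<^sup>2 / CD_kernel k x \<le> 1 / (4 * real k)"
      proof (cases "CD_kernel k x = 0")
        case False
        moreover have "0 \<le> 4 * real k * (sin x)\<^sup>2" by simp
        ultimately have "0 < CD_kernel k x" using le by linarith
        then show ?thesis using le k by (simp add: field_simps)
      qed simp
      then have "2 * real k * (real k + 1) / pi * ((sin x)\<^sup>2 / CD_kernel k x) \<le> 2 * real k * (real k + 1) / pi * (1 / (4 * real k))"
        by (intro mult_left_mono) auto
      also have "\<dots> = ?C" using k by (simp add: field_simps)
      finally show ?thesis
        unfolding CD_weight_subst[OF k that] by simp
    qed
    then show "ennreal (CD_weight k (?g x) * (?a * sin x) * indicator {0..pi} x) \<le> ennreal ?C * indicator {0..pi} x"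
      by (auto simp: indicator_def intro!: ennreal_leI)
  qed
  also have "\<dots> < \<infinity>"
    by (simp add: nn_integral_cmult_indicator ennreal_mult_less_top)
  finally have fin: "(\<integral>\<^sup>+x. ennreal (CD_weight k x * indicator {- ?a..?a} x) \<partial>lborel) < \<infinity>"
    by simp
  have "integrable lborel (\<lambda>x. CD_weight k x * indicator {- ?a..?a} x)"
    by (rule integrableI_nonneg) (use fin CD_weight_nonneg in \<open>auto simp: indicator_def\<close>)
  then show ?thesis
    by (simp add: set_integrable_def mult.commute)
qed

lemma Pi_density_integrable:
  assumes "1 \<le> k"
  shows "integrable lborel (Pi_density k)"
  using CD_weight_integrable[OF assms] unfolding set_integrable_def Pi_density_eq by (simp add: mult.commute)

lemma CD_continuous: "continuous_on A (CD k n)"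
proof (cases "k = 0")
  case True
  show ?thesis
    by (induction n rule: induct_nat_012) (auto simp: True intro!: continuous_intros)
next
  case False
  show ?thesis
    by (induction n rule: induct_nat_012) (use False in \<open>auto intro!: continuous_intros\<close>)
qed

lemma CD_measurable [measurable]: "CD k n \<in> borel_measurable borel"
  using CD_continuous by (rule borel_measurable_continuous_onI)

lemma Pi_density_bounded_integrable:
  fixes F :: "real \<Rightarrow> real"
  assumes k: "1 \<le> k" and F: "continuous_on UNIV F"
  shows "integrable lborel (\<lambda>t. Pi_density k t * F t)"
proof -
  have "bounded (F ` {- CD_radius k .. CD_radius k})"
    by (intro compact_imp_bounded compact_continuous_image continuous_on_subset[OF F]) auto
  then obtain B where B: "\<And>t. t \<in> {- CD_radius k .. CD_radius k} \<Longrightarrow> \<bar>F t\<bar> \<le> B"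
    unfolding bounded_iff by (auto simp del: atLeastAtMost_iff)
  show ?thesis
  proof (rule Bochner_Integration.integrable_bound)
    show "integrable lborel (\<lambda>t. Pi_density k t * B)"
      using Pi_density_integrable[OF k] by simp
    have "\<bar>Pi_density k t * F t\<bar> \<le> \<bar>Pi_density k t * B\<bar>" for t
    proof (cases "t \<in> {- CD_radius k .. CD_radius k}")
      case True
      then show ?thesis unfolding abs_mult using B[OF True] by (intro mult_left_mono) auto
    qed (auto simp: Pi_density_eq)
    then show "AE t in lborel. norm (Pi_density k t * F t) \<le> norm (Pi_density k t * B)"
      by simp
    show "(\<lambda>t. Pi_density k t * F t) \<in> borel_measurable lborel"
      using borel_measurable_continuous_onI[OF F] by measurable
  qed
qed

lemma integral_CD_lborel:
  assumes k: "1 \<le> k"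
  shows "(LBINT t. Pi_density k t * CD k n t) = (if n = 0 then 1 else 0)"
proof -
  let ?a = "CD_radius k" and ?g = "\<lambda>x. - (CD_radius k * cos x)"
  let ?f = "\<lambda>t. CD_weight k t * CD k n t"
  \<comment> \<open>The factors come from parity, from the weight after cancelling k + 1, and from
    the trigonometric form of \<open>CD\<close>. At n = 0 the product with pi / (2k) is 1, which
    makes the total mass one.\<close>
  let ?c = "(- 1) ^ n * (2 * real k / pi) * (1 / sqrt (real k)) ^ n"
  have "set_integrable lborel {- ?a..?a} ?f"
    using Pi_density_bounded_integrable[OF k CD_continuous]
    unfolding set_integrable_def Pi_density_eq by (simp add: mult_ac)
  then have int: "set_integrable lborel {?g 0..?g pi} ?f" by simp
  have "continuous_on {0..pi} (\<lambda>x. ?a * sin x)" "\<And>x. x \<in> {0..pi} \<Longrightarrow> 0 \<le> ?a * sin x"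
    by (auto intro!: continuous_intros mult_nonneg_nonneg sin_ge_zero CD_radius_bounds)
  note subst = integral_substitution[OF int CD_subst_deriv this pi_ge_zero]
  have "(LBINT t. ?f t * indicator {?g 0..?g pi} t) = (LBINT x. ?f (?g x) * (?a * sin x) * indicator {0..pi} x)"
    and int': "set_integrable lborel {0..pi} (\<lambda>x. ?f (?g x) * (?a * sin x))"
    using subst by (simp_all only:)
  then have "(LBINT t. ?f t * indicator {- ?a..?a} t) = (LBINT x:{0..pi}. ?f (?g x) * (?a * sin x))"
    by (simp add: set_lebesgue_integral_def mult_ac)
  also have "\<dots> = integral {0..pi} (\<lambda>x. ?f (?g x) * (?a * sin x))"
    using int' by (rule set_borel_integral_eq_integral(2))
  also have "\<dots> = integral {0..pi} (\<lambda>x. ?c * CD_wave k n x)"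
  proof (rule Henstock_Kurzweil_Integration.integral_cong)
    fix x assume x: "x \<in> {0..pi}"
    have "?f (?g x) * (?a * sin x) = CD_weight k (?g x) * (?a * sin x) * CD k n (?g x)"
      by simp
    also have "\<dots> = 2 * real k * (real k + 1) / pi * sin x / CD_kernel k x * ((-1) ^ n * (CD k n (?a * cos x) * sin x))"
      unfolding CD_weight_subst[OF k x] using CD_minus[of k n "?a * cos x"] by (simp add: power2_eq_square)
    also have "\<dots> = ?c * CD_wave k n x"
    proof -
      have "2 * K * u / p * s / D * (e * (q * w / u)) = e * (2 * K / p) * q * (s * w / D)"
        if "u \<noteq> 0" for K u p s D e q w :: real
        using that by simp
      then show ?thesis
        unfolding CD_cos[OF k] CD_wave_def by this (simp add: add_eq_0_iff)
    qed
    finally show "?f (?g x) * (?a * sin x) = ?c * CD_wave k n x" .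
  qed
  also have "\<dots> = ?c * (if n = 0 then pi / (2 * real k) else 0)"
    using has_integral_mult_right[OF has_integral_CD_wave[OF k], of ?c n] by (rule integral_unique)
  also have "\<dots> = (if n = 0 then 1 else 0)"
    using k by auto
  finally show ?thesis
    unfolding Pi_density_eq by (simp add: mult_ac)
qed

lemma space_Pi [simp]: "space (Pi_measure k) = UNIV"
  and sets_Pi [simp, measurable_cong]: "sets (Pi_measure k) = sets borel"
  by (simp_all add: Pi_measure_def)

lemma integral_Pi_CD:
  assumes "1 \<le> k"
  shows "(\<integral>t. CD k n t \<partial>Pi_measure k) = (if n = 0 then 1 else 0)"
  unfolding Pi_measure_def
  by (subst integral_density) (auto simp: Pi_density_nonneg integral_CD_lborel[OF assms])

lemma finite_measure_Pi:
  assumes "1 \<le> k"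
  shows "finite_measure (Pi_measure k)"
proof
  have "emeasure (Pi_measure k) (space (Pi_measure k)) = ennreal (LBINT t. Pi_density k t)"
    unfolding Pi_measure_def
    using nn_integral_eq_integral[OF Pi_density_integrable[OF assms]] by (simp add: emeasure_density Pi_density_nonneg)
  then show "emeasure (Pi_measure k) (space (Pi_measure k)) \<noteq> \<infinity>" by simp
qed

text \<open>Polynomials are bounded on the support only; this is what makes them square integrable
  for the measure.\<close>

lemma AE_Pi_support: "AE t in Pi_measure k. t \<in> {- CD_radius k .. CD_radius k}"
  unfolding Pi_measure_def by (subst AE_density) (auto simp: Pi_density_eq indicator_def)

lemma sqint_Pi_continuous:
  assumes k: "1 \<le> k" and F: "continuous_on UNIV F"
  shows "sqint (Pi_measure k) (\<lambda>t. complex_of_real (F t))"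
proof -
  interpret finite_measure "Pi_measure k" using k by (rule finite_measure_Pi)
  have "bounded (F ` {- CD_radius k .. CD_radius k})"
    by (intro compact_imp_bounded compact_continuous_image continuous_on_subset[OF F]) auto
  then obtain B where B: "\<And>t. t \<in> {- CD_radius k .. CD_radius k} \<Longrightarrow> \<bar>F t\<bar> \<le> B"
    unfolding bounded_iff by (auto simp del: atLeastAtMost_iff)
  have "AE t in Pi_measure k. cmod (complex_of_real (F t)) \<le> B"
    using AE_Pi_support by eventually_elim (use B in simp)
  moreover have "(\<lambda>t. complex_of_real (F t)) \<in> borel_measurable (Pi_measure k)"
    using borel_measurable_continuous_onI[OF F] by measurable
  ultimately show ?thesis
    by (intro sqint_bounded)
qed

lemma sqint_CD: "1 \<le> k \<Longrightarrow> sqint (Pi_measure k) (\<lambda>t. complex_of_real (CD k n t))"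
  by (intro sqint_Pi_continuous CD_continuous)

text \<open>Induction on the power j trades one factor t for \<open>CD\<close> at neighbouring
  indices. The instance n = 0 then covers all monomials without inverting the polynomial
  basis.\<close>

lemma Pi_orthogonal_monomial:
  assumes k: "1 \<le> k" and h: "sqint (Pi_measure k) h"
    and orth: "\<And>n. (\<integral>t. complex_of_real (CD k n t) * h t \<partial>Pi_measure k) = 0"
  shows "(\<integral>t. complex_of_real (t ^ j * CD k n t) * h t \<partial>Pi_measure k) = 0"
proof (induction j arbitrary: n)
  case 0
  then show ?case using orth by simp
next
  case (Suc j)
  show ?case
  proof (cases n)
    case 0
    then show ?thesis using Suc[of 1] by (simp add: mult.commute)
  next
    case (Suc m)
    have int: "integrable (Pi_measure k) (\<lambda>t. complex_of_real (t ^ j * CD k i t) * h t)" for i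
      by (intro sqint_mult_integrable sqint_Pi_continuous k h continuous_intros CD_continuous)
    have eq: "complex_of_real (t ^ Suc j * CD k (Suc m) t) * h t =
        complex_of_real (real k / (real k + 1)) * (complex_of_real (t ^ j * CD k (Suc (Suc m)) t) * h t)
        + complex_of_real (1 / (real k + 1)) * (complex_of_real (t ^ j * CD k m t) * h t)" for t
    proof -
      have nz: "real k \<noteq> 0" "real k + 1 \<noteq> 0" using k by auto
      then have "t * CD k (Suc m) t = real k / (real k + 1) * CD k (Suc (Suc m)) t + 1 / (real k + 1) * CD k m t"
        by (simp add: add_divide_distrib[symmetric])
      then have "t ^ Suc j * CD k (Suc m) t =
          real k / (real k + 1) * (t ^ j * CD k (Suc (Suc m)) t) + 1 / (real k + 1) * (t ^ j * CD k m t)"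
        by (simp only: power_Suc2 mult.assoc) (simp only: distrib_left mult_ac)
      then show ?thesis
        by (simp only: of_real_add of_real_mult distrib_right mult.assoc)
    qed
    show ?thesis
      unfolding Suc eq
      by (subst Bochner_Integration.integral_add)
        (use int Suc.IH in \<open>simp_all del: CD.simps(3) of_real_mult of_real_divide of_real_power\<close>)
  qed
qed

lemma Pi_orthogonal_continuous:
  assumes k: "1 \<le> k" and h: "sqint (Pi_measure k) h"
    and orth: "\<And>n. (\<integral>t. complex_of_real (CD k n t) * h t \<partial>Pi_measure k) = 0"
    and F: "continuous_on UNIV F"
  shows "(\<integral>t. complex_of_real (F t) * h t \<partial>Pi_measure k) = 0"
proof -
  interpret finite_measure "Pi_measure k" using k by (rule finite_measure_Pi)
  let ?I = "\<integral>t. cmod (h t) \<partial>Pi_measure k"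
  note int = sqint_mult_integrable[OF sqint_Pi_continuous[OF k] h]
  have poly: "(\<integral>t. complex_of_real (p t) * h t \<partial>Pi_measure k) = 0" if "real_polynomial_function p" for p
  proof -
    obtain a n where p: "p = (\<lambda>x. \<Sum>i\<le>n. a i * x ^ i)"
      using \<open>real_polynomial_function p\<close> unfolding real_polynomial_function_iff_sum by blast
    have mono: "integrable (Pi_measure k) (\<lambda>t. complex_of_real (t ^ i) * h t)" for i :: nat
      by (intro int continuous_intros)
    have "(\<integral>t. complex_of_real (p t) * h t \<partial>Pi_measure k) =
        (\<integral>t. (\<Sum>i\<le>n. complex_of_real (a i) * (complex_of_real (t ^ i) * h t)) \<partial>Pi_measure k)"
      unfolding p by (simp add: sum_distrib_right mult.assoc)
    also have "\<dots> = (\<Sum>i\<le>n. complex_of_real (a i) * (\<integral>t. complex_of_real (t ^ i) * h t \<partial>Pi_measure k))"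
      using mono by (subst Bochner_Integration.integral_sum) auto
    also have "\<dots> = 0"
      using Pi_orthogonal_monomial[OF k h orth, of _ 0] by simp
    finally show ?thesis .
  qed
  \<comment> \<open>Polynomials integrate to zero against h, so F may be replaced by F - p, which is
    below e uniformly on the support.\<close>
  have "cmod (\<integral>t. complex_of_real (F t) * h t \<partial>Pi_measure k) \<le> e * ?I" if "e > 0" for e
  proof -
    obtain p where p: "real_polynomial_function p" "\<And>t. t \<in> {- CD_radius k .. CD_radius k} \<Longrightarrow> \<bar>F t - p t\<bar> < e"
      using Stone_Weierstrass_real_polynomial_function[OF compact_Icc continuous_on_subset[OF F subset_UNIV] \<open>e > 0\<close>]
      by blast
    have pc: "continuous_on UNIV p"
      using p(1) by (simp add: continuous_on_polymonial_function real_polynomial_function_eq)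
    have "(\<integral>t. complex_of_real (F t) * h t \<partial>Pi_measure k) =
        (\<integral>t. complex_of_real (F t) * h t - complex_of_real (p t) * h t \<partial>Pi_measure k)"
      using poly[OF p(1)] int[OF F] int[OF pc] by simp
    also have "cmod \<dots> \<le> (\<integral>t. cmod (complex_of_real (F t) * h t - complex_of_real (p t) * h t) \<partial>Pi_measure k)"
      by (rule integral_norm_bound)
    also have "\<dots> \<le> (\<integral>t. e * cmod (h t) \<partial>Pi_measure k)"
    proof (rule integral_mono_AE)
      show "AE t in Pi_measure k. cmod (complex_of_real (F t) * h t - complex_of_real (p t) * h t) \<le> e * cmod (h t)"
        using AE_Pi_support
      proof eventually_elim
        case (elim t)
        have "cmod (complex_of_real (F t) * h t - complex_of_real (p t) * h t) = \<bar>F t - p t\<bar> * cmod (h t)"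
          by (simp flip: of_real_diff add: left_diff_distrib[symmetric] norm_mult)
        then show ?case
          using p(2)[OF elim] by (simp add: mult_right_mono less_imp_le)
      qed
    qed (use int[OF F] int[OF pc] sqint_integrable[OF h] in auto)
    finally show ?thesis by simp
  qed
  then have "cmod (\<integral>t. complex_of_real (F t) * h t \<partial>Pi_measure k) \<le> 0 * ?I"
  proof (intro tendsto_lowerbound[of "\<lambda>e. e * ?I" _ "at_right 0"])
    show "((\<lambda>e. e * ?I) \<longlongrightarrow> 0 * ?I) (at_right 0)"
      by (intro tendsto_intros)
    show "\<forall>\<^sub>F e in at_right 0. cmod (\<integral>t. complex_of_real (F t) * h t \<partial>Pi_measure k) \<le> e * ?I"
      if "\<And>e. 0 < e \<Longrightarrow> cmod (\<integral>t. complex_of_real (F t) * h t \<partial>Pi_measure k) \<le> e * ?I"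
      using that by (auto simp: eventually_at_right_less eventually_at_filter)
  qed auto
  then show ?thesis by simp
qed

text \<open>Closed half-lines form an intersection-stable generator and the sets with vanishing
  integral a Dynkin system; the total integral takes care of complements.\<close>

lemma AE_zero_if_orthogonal_atMost:
  fixes h :: "real \<Rightarrow> complex"
  assumes "finite_measure M" and borel: "sets M = sets borel" and h: "integrable M h"
    and orth: "\<And>b. (\<integral>t. indicator {..b} t *\<^sub>R h t \<partial>M) = 0"
    and total: "(\<integral>t. h t \<partial>M) = 0"
  shows "AE t in M. h t = 0"
proof (rule sigma_finite_measure.density_zero[OF finite_measure.axioms(1)[OF assms(1)] h])
  have int: "integrable M (\<lambda>t. indicator A t *\<^sub>R h t)" if "A \<in> sets borel" for A
    using that borel h by (intro integrable_mult_indicator) auto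
  fix A assume "A \<in> sets M"
  then have "A \<in> sigma_sets UNIV (range atMost)"
    unfolding borel borel_eq_atMost by simp
  then have "A \<in> sets borel \<and> (\<integral>t. indicator A t *\<^sub>R h t \<partial>M) = 0"
  proof (induction rule: sigma_sets_induct_disjoint[rotated 2, consumes 1, case_names basic empty compl union stable closed])
    case (basic A)
    then show ?case using orth by auto
  next
    case (compl A)
    have "(\<integral>t. indicator (UNIV - A) t *\<^sub>R h t \<partial>M) = (\<integral>t. h t - indicator A t *\<^sub>R h t \<partial>M)"
      by (intro Bochner_Integration.integral_cong) (auto simp: indicator_def)
    then show ?case
      using compl h int total by auto
  next
    case (union A)
    have UN: "(\<Union>n. A n) \<in> sets borel"
      using union by (intro sets.countable_UN) auto
    have "set_lebesgue_integral M (\<Union>n. A n) h = (\<Sum>n. set_lebesgue_integral M (A n) h)"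
      using union int[OF UN] borel
      by (intro lebesgue_integral_countable_add) (auto simp: set_integrable_def disjoint_family_on_def)
    then show ?case
      using union by (auto simp: set_lebesgue_integral_def)
  qed (auto simp: Int_stable_def)
  then show "set_lebesgue_integral M A h = 0"
    by (simp add: set_lebesgue_integral_def)
qed

theorem CD_total:
  assumes k: "1 \<le> k" and h: "sqint (Pi_measure k) h"
    and orth: "\<And>n. (\<integral>t. complex_of_real (CD k n t) * h t \<partial>Pi_measure k) = 0"
  shows "AE t in Pi_measure k. h t = 0"
proof -
  interpret finite_measure "Pi_measure k" using k by (rule finite_measure_Pi)
  note hint = sqint_integrable[OF h]
  show ?thesis
  proof (rule AE_zero_if_orthogonal_atMost[OF finite_measure_Pi[OF k]])
    fix b
    \<comment> \<open>For n > 0 a ramp falling from 1 at b to 0 at b + 1/n: continuous, between 0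
      and 1, and converging pointwise to the indicator.\<close>
    define F where "F n t = max 0 (min 1 (1 - real n * (t - b)))" for n t
    have F: "continuous_on UNIV (F n)" for n
      unfolding F_def by (intro continuous_intros)
    have lim: "(\<lambda>n. F n t) \<longlonglongrightarrow> indicator {..b} t" for t
    proof (cases "t \<le> b")
      case True
      then have "F n t = 1" for n
        unfolding F_def using mult_nonneg_nonpos[of "real n" "t - b"] by auto
      then show ?thesis using True by simp
    next
      case False
      obtain N where N: "1 < real N * (t - b)"
        using reals_Archimedean3[of "t - b"] False by auto
      have "\<forall>\<^sub>F n in sequentially. F n t = 0"
        using eventually_ge_at_top[of N]
      proof eventually_elim
        case (elim n)
        then have "real N * (t - b) \<le> real n * (t - b)"
          using False by (intro mult_right_mono) auto
        then show ?case using N by (simp add: F_def)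
      qed
      then show ?thesis
        using False by (simp add: tendsto_eventually)
    qed
    have "(\<lambda>n. \<integral>t. complex_of_real (F n t) * h t \<partial>Pi_measure k) \<longlonglongrightarrow>
        (\<integral>t. indicator {..b} t *\<^sub>R h t \<partial>Pi_measure k)"
    proof (rule integral_dominated_convergence[where w = "\<lambda>t. cmod (h t)"])
      show "AE t in Pi_measure k. (\<lambda>n. complex_of_real (F n t) * h t) \<longlonglongrightarrow> indicator {..b} t *\<^sub>R h t"
        unfolding scaleR_conv_of_real by (intro AE_I2 tendsto_intros lim)
      show "AE t in Pi_measure k. norm (complex_of_real (F n t) * h t) \<le> cmod (h t)" for n
        by (auto simp: norm_mult F_def intro!: mult_left_le_one_le)
      show "(\<lambda>t. complex_of_real (F n t) * h t) \<in> borel_measurable (Pi_measure k)" for n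
        using borel_measurable_continuous_onI[OF F] h[THEN sqint_measurable] by measurable
      show "(\<lambda>t. indicator {..b} t *\<^sub>R h t) \<in> borel_measurable (Pi_measure k)"
        using h[THEN sqint_measurable] by measurable
    qed (use hint in auto)
    then show "(\<integral>t. indicator {..b} t *\<^sub>R h t \<partial>Pi_measure k) = 0"
      unfolding Pi_orthogonal_continuous[OF k h orth F] by (simp add: LIMSEQ_const_iff)
  next
    show "(\<integral>t. h t \<partial>Pi_measure k) = 0"
      using orth[of 0] by simp
  qed (use hint in auto)
qed

section \<open>Radial operators\<close>

context tree_graph
begin

lemma sphere_nonempty: "\<exists>y. gdist E y x = n"
  using card_sphere[of x n] sphere_size_pos[of n] unfolding sphere_def
  by (metis (mono_tags, lifting) card.empty empty_Collect_eq less_irrefl)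

text \<open>Regrouping by finite spheres turns an unordered sum over vertices into a series indexed
  by the radius, which can be matched with a Parseval series. The centre z may be chosen
  freely.\<close>

lemma sphere_sums:
  fixes F :: "'v \<Rightarrow> 'b :: {topological_comm_monoid_add, t3_space}"
  assumes "F summable_on UNIV"
  shows "(\<lambda>n. \<Sum>y\<in>sphere E z n. F y) sums infsum F UNIV"
proof -
  have "(F has_sum infsum F UNIV) UNIV"
    using assms by simp
  then have "((\<lambda>p. F (snd p)) has_sum infsum F UNIV) (Sigma UNIV (sphere E z))"
    by (subst has_sum_reindex_bij_witness[where i = "\<lambda>x. (gdist E x z, x)" and j = snd and h = F and T = UNIV])
      (auto simp: sphere_def)
  then have "((\<lambda>n. \<Sum>y\<in>sphere E z n. F y) has_sum infsum F UNIV) UNIV"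
    by (rule has_sum_SigmaD) (simp add: finite_sphere)
  then show ?thesis
    by (rule has_sum_imp_sums)
qed

lemma nonneg_sphere_summable:
  fixes F :: "'v \<Rightarrow> real"
  assumes nonneg: "\<And>x. 0 \<le> F x" and summable: "summable (\<lambda>n. \<Sum>y\<in>sphere E z n. F y)"
  shows "F summable_on UNIV"
proof (rule nonneg_bdd_above_summable_on)
  have "sum F X \<le> (\<Sum>n. \<Sum>y\<in>sphere E z n. F y)" if X: "finite X" for X
  proof -
    define N where "N = Suc (Max (insert 0 ((\<lambda>x. gdist E x z) ` X)))"
    have "X \<subseteq> (\<Union>n<N. sphere E z n)"
      using X by (auto simp: sphere_def N_def less_Suc_eq_le)
    then have "sum F X \<le> sum F (\<Union>n<N. sphere E z n)"
      using nonneg by (intro sum_mono2) (auto simp: finite_sphere)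
    also have "\<dots> = (\<Sum>n<N. \<Sum>y\<in>sphere E z n. F y)"
      by (rule sum.UNION_disjoint) (auto simp: finite_sphere, auto simp: sphere_def)
    also have "\<dots> \<le> (\<Sum>n. \<Sum>y\<in>sphere E z n. F y)"
      using nonneg by (intro sum_le_suminf summable) (auto intro: sum_nonneg)
    finally show ?thesis .
  qed
  then show "bdd_above (sum F ` {X. X \<subseteq> UNIV \<and> finite X})"
    by (auto intro!: bdd_aboveI)
qed (use nonneg in auto)

lemma l2norm_radial:
  assumes "is_l2 (\<lambda>y. \<phi> (gdist E y x))"
  shows "(\<lambda>n. real (sphere_size n) * (cmod (\<phi> n))\<^sup>2) sums (l2norm (\<lambda>y. \<phi> (gdist E y x)))\<^sup>2"
proof -
  have "(\<Sum>y\<in>sphere E x n. (cmod (\<phi> (gdist E y x)))\<^sup>2) = real (sphere_size n) * (cmod (\<phi> n))\<^sup>2" for n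
  proof -
    have "(\<Sum>y\<in>sphere E x n. (cmod (\<phi> (gdist E y x)))\<^sup>2) = (\<Sum>y\<in>sphere E x n. (cmod (\<phi> n))\<^sup>2)"
      by (intro sum.cong) (auto simp: sphere_def)
    then show ?thesis by (simp add: card_sphere)
  qed
  then show ?thesis
    using sphere_sums[of "\<lambda>y. (cmod (\<phi> (gdist E y x)))\<^sup>2" x] assms
    by (simp add: is_l2_def l2norm_def infsum_nonneg)
qed

lemma is_l2_radialI:
  assumes "summable (\<lambda>n. real (sphere_size n) * (cmod (\<phi> n))\<^sup>2)"
  shows "is_l2 (\<lambda>y. \<phi> (gdist E y x))"
  unfolding is_l2_def
proof (rule nonneg_sphere_summable)
  have "(\<Sum>y\<in>sphere E x n. (cmod (\<phi> (gdist E y x)))\<^sup>2) = real (sphere_size n) * (cmod (\<phi> n))\<^sup>2" for n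
  proof -
    have "(\<Sum>y\<in>sphere E x n. (cmod (\<phi> (gdist E y x)))\<^sup>2) = (\<Sum>y\<in>sphere E x n. (cmod (\<phi> n))\<^sup>2)"
      by (intro sum.cong) (auto simp: sphere_def)
    then show ?thesis by (simp add: card_sphere)
  qed
  then show "summable (\<lambda>n. \<Sum>y\<in>sphere E x n. (cmod (\<phi> (gdist E y x)))\<^sup>2)"
    using assms by simp
qed auto

text \<open>Grouping the sum over y by spheres about z, on which the kernel is constant, leaves
  sphere sums of a radial profile. The profile \<psi> serves all x at once.\<close>

lemma kapply_radial:
  assumes T: "T \<in> BGamma E"
  shows "\<exists>\<psi>. \<forall>x. is_l2 (\<lambda>y. \<phi> (gdist E y x)) \<longrightarrow>
    kapply T (\<lambda>y. \<phi> (gdist E y x)) = (\<lambda>z. \<psi> (gdist E z x))"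
proof -
  obtain \<alpha> where \<alpha>: "\<And>x y. T x y = \<alpha> (gdist E x y)" and bd: "bounded_kernel T"
    using T unfolding BGamma_def by auto
  have "\<forall>m. \<exists>g. \<forall>x z. (\<Sum>y\<in>sphere E z m. \<phi> (gdist E y x)) = g (gdist E z x)"
    using sphere_sum_radial by blast
  then obtain g where g: "\<And>m x z. (\<Sum>y\<in>sphere E z m. \<phi> (gdist E y x)) = g m (gdist E z x)"
    by metis
  have "kapply T (\<lambda>y. \<phi> (gdist E y x)) z = (\<Sum>m. \<alpha> m * g m (gdist E z x))"
    if "is_l2 (\<lambda>y. \<phi> (gdist E y x))" for x z
  proof -
    have "(\<Sum>y\<in>sphere E z m. T z y * \<phi> (gdist E y x)) = \<alpha> m * g m (gdist E z x)" for m
    proof -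
      have "(\<Sum>y\<in>sphere E z m. T z y * \<phi> (gdist E y x)) = (\<Sum>y\<in>sphere E z m. \<alpha> m * \<phi> (gdist E y x))"
        by (intro sum.cong) (auto simp: sphere_def \<alpha> gdist_commute[of z])
      then show ?thesis by (simp only: sum_distrib_left[symmetric] g)
    qed
    then have "(\<lambda>m. \<alpha> m * g m (gdist E z x)) sums kapply T (\<lambda>y. \<phi> (gdist E y x)) z"
      using sphere_sums[OF kapply_summable[OF bd that], of z z] unfolding kapply_def by simp
    then show ?thesis by (simp add: sums_iff)
  qed
  then show ?thesis
    by (intro exI[of _ "\<lambda>l. \<Sum>m. \<alpha> m * g m l"]) auto
qed

definition sphere_rep :: "'v \<Rightarrow> nat \<Rightarrow> 'v" where
  "sphere_rep o0 n = (SOME y. gdist E y o0 = n)"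

lemma gdist_sphere_rep [simp]: "gdist E (sphere_rep o0 n) o0 = n"
  unfolding sphere_rep_def using sphere_nonempty by (rule someI_ex)

lemma is_rad_eq: "is_rad E o0 f \<Longrightarrow> gdist E x o0 = gdist E y o0 \<Longrightarrow> f x = f y"
  unfolding is_rad_def by blast

lemma is_rad_profile: "is_rad E o0 f \<Longrightarrow> f x = f (sphere_rep o0 (gdist E x o0))"
  by (erule is_rad_eq) simp

lemma is_rad_iff: "is_rad E o0 f \<longleftrightarrow> is_l2 f \<and> (\<exists>\<phi>. f = (\<lambda>y. \<phi> (gdist E y o0)))"
proof
  assume f: "is_rad E o0 f"
  have "f = (\<lambda>y. f (sphere_rep o0 (gdist E y o0)))"
    by (rule ext) (rule is_rad_profile[OF f])
  then have "\<exists>\<phi>. f = (\<lambda>y. \<phi> (gdist E y o0))"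
    by (rule exI[of _ "\<lambda>n. f (sphere_rep o0 n)"])
  then show "is_l2 f \<and> (\<exists>\<phi>. f = (\<lambda>y. \<phi> (gdist E y o0)))"
    using f unfolding is_rad_def by blast
qed (auto simp: is_rad_def)

lemma is_rad_lincomb: "is_rad E o0 f \<Longrightarrow> is_rad E o0 g \<Longrightarrow> is_rad E o0 (\<lambda>x. a * f x + b * g x)"
  unfolding is_rad_def by (metis is_l2_add is_l2_scale)

lemma is_rad_cnj: "is_rad E o0 f \<Longrightarrow> is_rad E o0 (\<lambda>x. cnj (f x))"
  unfolding is_rad_def by (metis is_l2_cnj)

lemma is_rad_kapply:
  assumes "T \<in> BGamma E" "is_rad E o0 f"
  shows "is_rad E o0 (kapply T f)"
proof -
  obtain \<phi> where \<phi>: "f = (\<lambda>y. \<phi> (gdist E y o0))" "is_l2 f"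
    using assms(2) by (auto simp: is_rad_iff)
  then show ?thesis
    using kapply_radial[OF assms(1), of \<phi>] is_l2_kapply[of T f] assms(1)
    by (auto simp: is_rad_iff BGamma_def)
qed

lemma Prad_radial:
  assumes "is_rad E o0 f"
  shows "Prad E o0 f = f"
proof
  fix x
  have "(\<Sum>y\<in>sphere E o0 (gdist E x o0). f y) = (\<Sum>y\<in>sphere E o0 (gdist E x o0). f x)"
    by (intro sum.cong refl is_rad_eq[OF assms]) (simp add: sphere_def)
  moreover have "sphere_size (gdist E x o0) \<noteq> 0"
    using sphere_size_pos by simp
  ultimately show "Prad E o0 f x = f x"
    by (simp add: Prad_def card_sphere)
qed

lemma jo_eq_kapply: "T \<in> BGamma E \<Longrightarrow> is_rad E o0 f \<Longrightarrow> jo E o0 T f = kapply T f"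
  by (simp add: jo_def Prad_radial is_rad_kapply)

lemma BGamma_bounded: "T \<in> BGamma E \<Longrightarrow> bounded_kernel T"
  by (simp add: BGamma_def)

lemma BGamma_sym: "T \<in> BGamma E \<Longrightarrow> T x y = T y x"
  by (auto simp: BGamma_def gdist_commute)

lemma kapply_kadj:
  assumes "T \<in> BGamma E"
  shows "kapply (kadj T) f = (\<lambda>x. cnj (kapply T (\<lambda>y. cnj (f y)) x))"
  using BGamma_sym[OF assms] by (auto simp: kapply_def kadj_def simp flip: infsum_cnj)

lemma kadj_BGamma:
  assumes T: "T \<in> BGamma E"
  shows "kadj T \<in> BGamma E"
proof -
  obtain \<alpha> where \<alpha>: "\<And>x y. T x y = \<alpha> (gdist E x y)"
    using T unfolding BGamma_def by auto
  obtain C where C: "0 \<le> C" "\<And>f x. is_l2 f \<Longrightarrow> (\<lambda>y. T x y * f y) summable_on UNIV"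
    "\<And>f. is_l2 f \<Longrightarrow> is_l2 (kapply T f)" "\<And>f. is_l2 f \<Longrightarrow> l2norm (kapply T f) \<le> C * l2norm f"
    using bounded_kernelE[OF BGamma_bounded[OF T]] by metis
  have "bounded_kernel (kadj T)"
    unfolding bounded_kernel_def
  proof (intro exI[of _ C] allI impI conjI)
    fix f :: "'v \<Rightarrow> complex" and x assume f: "is_l2 f"
    have "(\<lambda>y. cnj (T x y * cnj (f y))) summable_on UNIV"
      unfolding summable_on_cnj_iff by (rule C(2)[OF is_l2_cnj[OF f]])
    then show "(\<lambda>y. kadj T x y * f y) summable_on UNIV"
      by (simp add: kadj_def BGamma_sym[OF T, of _ x])
    show "is_l2 (kapply (kadj T) f)"
      unfolding kapply_kadj[OF T] by (intro is_l2_cnj C f)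
    show "l2norm (kapply (kadj T) f) \<le> C * l2norm f"
      unfolding kapply_kadj[OF T] l2norm_cnj using C(4)[OF is_l2_cnj[OF f]] by (simp add: l2norm_cnj)
  qed
  moreover have "kadj T x y = cnj (\<alpha> (gdist E x y))" for x y
    by (simp add: kadj_def \<alpha> gdist_commute)
  ultimately show ?thesis
    unfolding BGamma_def by (auto intro: exI[of _ "\<lambda>n. cnj (\<alpha> n)"])
qed

lemma is_rad_delta: "is_rad E o0 (delta o0)"
  using is_l2_delta by (auto simp: is_rad_def delta_def)

end

section \<open>The norm of a kernel recovered from radial vectors\<close>

lemma le_of_power_le:
  fixes q r A b :: real
  assumes le: "\<And>j. q ^ 2 ^ j * b \<le> A * r ^ 2 ^ j" and "0 < b" "0 \<le> r"
  shows "q \<le> r"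
proof (rule ccontr)
  assume "\<not> q \<le> r"
  then have qr: "r < q" by simp
  show False
  proof (cases "r = 0")
    case True
    then show False
      using le[of 0] mult_pos_pos[OF _ \<open>0 < b\<close>, of q] qr by simp
  next
    case False
    then have r: "0 < r" using assms(3) by simp
    obtain n where n: "A / b < (q / r) ^ n"
      using real_arch_pow[of "q / r" "A / b"] qr r by auto
    \<comment> \<open>The Archimedean property gives some exponent n; n \<le> 2^n moves it to an
      exponent at which the hypothesis is available.\<close>
    have "(q / r) ^ n \<le> (q / r) ^ 2 ^ n"
      using qr r by (intro power_increasing) (auto intro: less_imp_le)
    also have "\<dots> \<le> A / b"
      using le[of n] r \<open>0 < b\<close> by (simp add: power_divide field_simps)
    finally show False using n by simp
  qed
qed

context tree_graph
begin

context
  fixes T :: "'v \<Rightarrow> 'v \<Rightarrow> complex"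
  assumes T: "T \<in> BGamma E"
begin

definition gram_op :: "('v \<Rightarrow> complex) \<Rightarrow> 'v \<Rightarrow> complex" where
  "gram_op f = kapply (kadj T) (kapply T f)"

lemma is_l2_gram_op: "is_l2 f \<Longrightarrow> is_l2 ((gram_op ^^ n) f)"
proof (induction n)
  case (Suc n)
  then show ?case
    using is_l2_kapply[OF BGamma_bounded[OF T]] is_l2_kapply[OF BGamma_bounded[OF kadj_BGamma[OF T]]]
    by (simp add: gram_op_def)
qed simp

lemma gram_op_selfadjoint:
  assumes "is_l2 f" "is_l2 g"
  shows "l2inner ((gram_op ^^ n) f) g = l2inner f ((gram_op ^^ n) g)"
  using assms(2)
proof (induction n arbitrary: g)
  case (Suc n)
  note bd = BGamma_bounded[OF T] BGamma_bounded[OF kadj_BGamma[OF T]]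
  have one: "l2inner (gram_op u) v = l2inner u (gram_op v)" if "is_l2 u" "is_l2 v" for u v
  proof -
    have "l2inner (gram_op u) v = l2inner (kapply T u) (kapply T v)"
      unfolding gram_op_def using l2inner_kapply[OF bd(2), of "kapply T u" v] bd that
      by (simp add: kadj_kadj is_l2_kapply)
    also have "\<dots> = l2inner u (gram_op v)"
      unfolding gram_op_def using bd that by (intro l2inner_kapply) (auto intro: is_l2_kapply)
    finally show ?thesis .
  qed
  have "l2inner ((gram_op ^^ Suc n) f) g = l2inner ((gram_op ^^ n) f) (gram_op g)"
    using one[OF is_l2_gram_op[OF assms(1)] Suc.prems, of n] by simp
  also have "\<dots> = l2inner f ((gram_op ^^ n) (gram_op g))"
    using Suc.IH[of "gram_op g"] is_l2_gram_op[OF Suc.prems, of 1] by simp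
  finally show ?case by (simp add: funpow_swap1)
qed simp

lemma gram_op_sum:
  fixes u :: "'v \<Rightarrow> 'v \<Rightarrow> complex"
  assumes u: "\<And>y. is_l2 (u y)"
  shows "(gram_op ^^ n) (\<lambda>x. \<Sum>y\<in>F. c y * u y x) = (\<lambda>x. \<Sum>y\<in>F. c y * (gram_op ^^ n) (u y) x)"
proof (induction n)
  case (Suc n)
  note bd = BGamma_bounded[OF T] BGamma_bounded[OF kadj_BGamma[OF T]]
  have "gram_op (\<lambda>x. \<Sum>y\<in>F. c y * (gram_op ^^ n) (u y) x) = (\<lambda>x. \<Sum>y\<in>F. c y * gram_op ((gram_op ^^ n) (u y)) x)"
    unfolding gram_op_def
    by (simp add: kapply_sum[OF bd(1)] kapply_sum[OF bd(2)] kapply_scale[OF bd(1)] kapply_scale[OF bd(2)]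
        is_l2_scale is_l2_kapply[OF bd(1)] is_l2_gram_op[OF u, unfolded gram_op_def])
  then show ?case using Suc by simp
qed simp

text \<open>The profile \<phi> is independent of x: iterates started at different vertices have the
  same values on corresponding spheres, hence equal norms.\<close>

lemma gram_op_delta_radial: "\<exists>\<phi>. \<forall>x. (gram_op ^^ n) (delta x) = (\<lambda>y. \<phi> (gdist E y x))"
proof (induction n)
  case 0
  show ?case
    by (intro exI[of _ "\<lambda>n. if n = 0 then 1 else 0"]) (auto simp: delta_def fun_eq_iff)
next
  case (Suc n)
  then obtain \<phi> where \<phi>: "\<And>x. (gram_op ^^ n) (delta x) = (\<lambda>y. \<phi> (gdist E y x))" by blast
  have l2: "is_l2 (\<lambda>y. \<phi> (gdist E y x))" for x
    using is_l2_gram_op[OF is_l2_delta, of n x] by (simp add: \<phi>)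
  obtain \<psi> where \<psi>: "\<And>x. kapply T (\<lambda>y. \<phi> (gdist E y x)) = (\<lambda>y. \<psi> (gdist E y x))"
    using kapply_radial[OF T, of \<phi>] l2 by blast
  have "is_l2 (\<lambda>y. \<psi> (gdist E y x))" for x
    using is_l2_kapply[OF BGamma_bounded[OF T] l2, of x] by (simp add: \<psi>)
  then obtain \<omega> where "\<And>x. kapply (kadj T) (\<lambda>y. \<psi> (gdist E y x)) = (\<lambda>y. \<omega> (gdist E y x))"
    using kapply_radial[OF kadj_BGamma[OF T], of \<psi>] by blast
  then have "(gram_op ^^ Suc n) (delta x) = (\<lambda>y. \<omega> (gdist E y x))" for x
    by (simp add: gram_op_def[of "\<lambda>y. \<phi> (gdist E y x)"] \<phi> \<psi>)
  then show ?case by blast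
qed

lemma l2norm_gram_op_delta: "l2norm ((gram_op ^^ n) (delta x)) = l2norm ((gram_op ^^ n) (delta y))"
proof -
  obtain \<phi> where \<phi>: "\<And>x. (gram_op ^^ n) (delta x) = (\<lambda>y. \<phi> (gdist E y x))"
    using gram_op_delta_radial by blast
  have "(\<lambda>m. real (sphere_size m) * (cmod (\<phi> m))\<^sup>2) sums (l2norm ((gram_op ^^ n) (delta x)))\<^sup>2" for x
    using l2norm_radial[of \<phi> x] is_l2_gram_op[OF is_l2_delta, of n x] by (simp add: \<phi>)
  then have "(l2norm ((gram_op ^^ n) (delta x)))\<^sup>2 = (l2norm ((gram_op ^^ n) (delta y)))\<^sup>2"
    using sums_unique2 by blast
  then show ?thesis by simp
qed

lemma radial_bound_imp_bound:
  assumes R: "0 \<le> R" "\<And>f. is_rad E o0 f \<Longrightarrow> l2norm (kapply T f) \<le> R * l2norm f" and f: "is_l2 f"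
  shows "l2norm (kapply T f) \<le> R * l2norm f"
proof (rule kapply_bound_if_finite_support[OF BGamma_bounded[OF T] _ R(1) f])
  fix F :: "'v set" and f :: "'v \<Rightarrow> complex" assume F: "finite F"
  define g where "g = trunc f F"
  \<comment> \<open>The l1 norm of f on F is the price of expanding the truncation into deltas;
    being independent of n, it disappears when roots are taken.\<close>
  define A where "A = (\<Sum>y\<in>F. cmod (f y))"
  have g: "is_l2 g" using F by (simp add: g_def is_l2_trunc)
  \<comment> \<open>The kernel is symmetric, so its adjoint is T conjugated by complex conjugation,
    which preserves radial vectors and norms.\<close>
  have R': "l2norm (kapply (kadj T) h) \<le> R * l2norm h" if "is_rad E o0 h" for h
    using R(2)[OF is_rad_cnj[OF that]] by (simp add: kapply_kadj[OF T] l2norm_cnj)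
  have rad: "is_rad E o0 ((gram_op ^^ n) (delta o0)) \<and> l2norm ((gram_op ^^ n) (delta o0)) \<le> (R\<^sup>2) ^ n" for n
  proof (induction n)
    case 0
    show ?case by (simp add: is_rad_delta l2norm_delta)
  next
    case (Suc n)
    let ?h = "(gram_op ^^ n) (delta o0)"
    have "l2norm (gram_op ?h) \<le> R * l2norm (kapply T ?h)"
      unfolding gram_op_def[of ?h] using Suc is_rad_kapply[OF T] by (intro R') auto
    also have "\<dots> \<le> R * (R * l2norm ?h)"
      using Suc R by (intro mult_left_mono) auto
    also have "\<dots> \<le> R * (R * (R\<^sup>2) ^ n)"
      using Suc R by (intro mult_left_mono) auto
    finally show ?case
      using Suc is_rad_kapply[OF T] is_rad_kapply[OF kadj_BGamma[OF T]]
      by (simp add: power2_eq_square mult.assoc gram_op_def[of ?h])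
  qed
  have upper: "l2norm ((gram_op ^^ n) g) \<le> A * (R\<^sup>2) ^ n" for n
  proof -
    have "l2norm ((gram_op ^^ n) g) = l2norm (\<lambda>x. \<Sum>y\<in>F. f y * (gram_op ^^ n) (delta y) x)"
      unfolding g_def trunc_eq_sum_delta[OF F] by (simp add: gram_op_sum[OF is_l2_delta])
    also have "\<dots> \<le> (\<Sum>y\<in>F. l2norm (\<lambda>x. f y * (gram_op ^^ n) (delta y) x))"
      unfolding l2norm_eq_L2nrm
      by (rule L2nrm_sum_le) (use is_l2_scale[OF is_l2_gram_op[OF is_l2_delta]] in \<open>simp add: is_l2_iff_sqint\<close>)
    also have "\<dots> \<le> (\<Sum>y\<in>F. cmod (f y) * (R\<^sup>2) ^ n)"
      unfolding l2norm_scale using rad[of n] l2norm_gram_op_delta[of n]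
      by (intro sum_mono mult_left_mono) (metis, simp)
    finally show ?thesis by (simp add: A_def sum_distrib_right)
  qed
  have double: "(l2norm ((gram_op ^^ n) g))\<^sup>2 \<le> l2norm ((gram_op ^^ (2 * n)) g) * l2norm g" for n
  proof -
    have "complex_of_real ((l2norm ((gram_op ^^ n) g))\<^sup>2) = l2inner ((gram_op ^^ (2 * n)) g) g"
      unfolding l2inner_self[symmetric] mult_2 funpow_add comp_apply
      by (rule gram_op_selfadjoint[OF is_l2_gram_op[OF g] g, symmetric])
    then have "(l2norm ((gram_op ^^ n) g))\<^sup>2 = cmod (l2inner ((gram_op ^^ (2 * n)) g) g)"
      by (metis abs_of_nonneg norm_of_real zero_le_power2)
    also have "\<dots> \<le> l2norm ((gram_op ^^ (2 * n)) g) * l2norm g"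
      by (intro l2_Cauchy_Schwarz is_l2_gram_op g)
    finally show ?thesis .
  qed
  have first: "(l2norm (kapply T g))\<^sup>2 \<le> l2norm (gram_op g) * l2norm g"
  proof -
    have "complex_of_real ((l2norm (kapply T g))\<^sup>2) = l2inner g (gram_op g)"
      unfolding l2inner_self[symmetric] gram_op_def
      using T g by (intro l2inner_kapply BGamma_bounded kadj_BGamma is_l2_kapply) auto
    then have "(l2norm (kapply T g))\<^sup>2 = cmod (l2inner g (gram_op g))"
      by (metis abs_of_nonneg norm_of_real zero_le_power2)
    also have "\<dots> \<le> l2norm g * l2norm (gram_op g)"
      using is_l2_gram_op[OF g, of 1] g by (intro l2_Cauchy_Schwarz) auto
    finally show ?thesis by (simp add: mult.commute)
  qed
  show "l2norm (kapply T (trunc f F)) \<le> R * l2norm (trunc f F)"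
    unfolding g_def[symmetric]
  proof (cases "l2norm g = 0")
    case True
    then have "(l2norm (kapply T g))\<^sup>2 \<le> 0" using first by simp
    then show "l2norm (kapply T g) \<le> R * l2norm g" using True by simp
  next
    case False
    then have pos: "0 < l2norm g" using l2norm_nonneg[of g] by linarith
    \<comment> \<open>If H stretches g by q, repeated doubling shows that its 2^j-th power stretches
      g by at least q^(2^j), while the upper bound grows only like the 2^j-th power of R^2.\<close>
    define q where "q = l2norm (gram_op g) / l2norm g"
    have q: "0 \<le> q" by (simp add: q_def)
    have lower: "q ^ 2 ^ j * l2norm g \<le> l2norm ((gram_op ^^ (2 ^ j)) g)" for j
    proof (induction j)
      case 0
      show ?case using pos by (simp add: q_def)
    next
      case (Suc j)
      have "(q ^ 2 ^ Suc j * l2norm g) * l2norm g = (q ^ 2 ^ j * l2norm g)\<^sup>2"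
        by (simp add: power_mult_distrib power_mult[symmetric] power2_eq_square[of "l2norm g"] mult.commute)
      also have "\<dots> \<le> (l2norm ((gram_op ^^ (2 ^ j)) g))\<^sup>2"
        using Suc q pos by (intro power_mono) auto
      also have "\<dots> \<le> l2norm ((gram_op ^^ (2 ^ Suc j)) g) * l2norm g"
        using double[of "2 ^ j"] by simp
      finally show ?case using pos by simp
    qed
    have "q \<le> R\<^sup>2"
    proof (rule le_of_power_le)
      show "q ^ 2 ^ j * l2norm g \<le> A * (R\<^sup>2) ^ 2 ^ j" for j
        using lower[of j] upper[of "2 ^ j"] by linarith
    qed (use pos in auto)
    then have "l2norm (gram_op g) \<le> R\<^sup>2 * l2norm g"
      using pos by (simp add: q_def pos_divide_le_eq)
    then have "(l2norm (kapply T g))\<^sup>2 \<le> (R * l2norm g)\<^sup>2"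
      using first mult_right_mono[of "l2norm (gram_op g)" "R\<^sup>2 * l2norm g" "l2norm g"]
      by (simp add: power2_eq_square mult_ac)
    then show "l2norm (kapply T g) \<le> R * l2norm g"
      using R(1) by (rule_tac power2_le_imp_le) auto
  qed
qed

end

theorem rad_opnorm_jo:
  assumes T: "T \<in> BGamma E"
  shows "rad_opnorm E o0 (jo E o0 T) = opnorm T"
proof -
  obtain C where C: "0 \<le> C" "\<And>f. is_l2 f \<Longrightarrow> l2norm (kapply T f) \<le> C * l2norm f"
    using bounded_kernelE[OF BGamma_bounded[OF T]] by metis
  let ?A = "(\<lambda>f. l2norm (kapply T f)) ` {f. is_rad E o0 f \<and> l2norm f \<le> 1}"
  let ?B = "(\<lambda>f. l2norm (kapply T f)) ` {f. is_l2 f \<and> l2norm f \<le> 1}"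
  have A: "rad_opnorm E o0 (jo E o0 T) = Sup ?A"
    unfolding rad_opnorm_def by (rule arg_cong[where f = Sup], rule image_cong) (auto simp: jo_eq_kapply[OF T])
  have "l2norm (kapply T f) \<le> C" if "is_l2 f" "l2norm f \<le> 1" for f
    using C(2)[OF that(1)] mult_left_mono[OF that(2) C(1)] by simp
  then have bdd: "bdd_above ?B"
    by (auto intro!: bdd_aboveI[of _ C])
  have AB: "?A \<subseteq> ?B" by (auto simp: is_rad_def)
  have "delta o0 \<in> {f. is_rad E o0 f \<and> l2norm f \<le> 1}"
    by (simp add: is_rad_delta l2norm_delta)
  then have ne: "?A \<noteq> {}" by blast
  have bddA: "bdd_above ?A" using bdd AB by (rule bdd_above_mono)
  have R0: "0 \<le> Sup ?A"
    using cSup_upper2[OF _ l2norm_nonneg bddA] ne by blast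
  have rad: "l2norm (kapply T f) \<le> Sup ?A * l2norm f" if f: "is_rad E o0 f" for f
  proof (cases "l2norm f = 0")
    case True
    then show ?thesis using C(2)[of f] f by (simp add: is_rad_def)
  next
    case False
    let ?c = "complex_of_real (1 / l2norm f)"
    have "is_rad E o0 (\<lambda>x. ?c * f x)"
      using is_rad_lincomb[OF f f, of ?c 0] by simp
    moreover have "l2norm (\<lambda>x. ?c * f x) = 1"
      unfolding l2norm_scale norm_of_real using False by simp
    ultimately have "l2norm (kapply T (\<lambda>x. ?c * f x)) \<le> Sup ?A"
      by (intro cSup_upper bddA) auto
    then have "1 / l2norm f * l2norm (kapply T f) \<le> Sup ?A"
      unfolding kapply_scale[OF BGamma_bounded[OF T]] l2norm_scale norm_of_real by simp
    then show ?thesis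
      using False l2norm_nonneg[of f] by (simp add: divide_le_eq less_le)
  qed
  have bound: "l2norm (kapply T f) \<le> Sup ?A * l2norm f" if "is_l2 f" for f
    using T R0 rad that by (rule radial_bound_imp_bound)
  have "Sup ?B \<le> Sup ?A"
  proof (rule cSup_least)
    show "?B \<noteq> {}" using ne AB by blast
    fix b assume "b \<in> ?B"
    then obtain f where f: "is_l2 f" "l2norm f \<le> 1" "b = l2norm (kapply T f)" by auto
    then show "b \<le> Sup ?A"
      using bound[OF f(1)] mult_left_mono[OF f(2) R0] by simp
  qed
  moreover have "Sup ?A \<le> Sup ?B"
    using ne bdd AB by (rule cSup_subset_mono)
  ultimately show ?thesis
    unfolding A opnorm_def by simp
qed

end

section \<open>The spectral representation\<close>

context tree_graph
begin

abbreviation Pim :: "real measure" where "Pim \<equiv> Pi_measure k"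

lemma finite_measure_Pim: "finite_measure Pim"
  by (rule finite_measure_Pi[OF k_pos])

lemma sqint_CD_mult:
  assumes "sqint Pim \<phi>"
  shows "sqint Pim (\<lambda>t. complex_of_real (CD k n t) * \<phi> t)"
proof -
  have "bounded (CD k n ` {- CD_radius k .. CD_radius k})"
    by (intro compact_imp_bounded compact_continuous_image CD_continuous) auto
  then obtain B where B: "\<And>t. t \<in> {- CD_radius k .. CD_radius k} \<Longrightarrow> \<bar>CD k n t\<bar> \<le> B"
    unfolding bounded_iff by (auto simp del: atLeastAtMost_iff)
  have "AE t in Pim. cmod (complex_of_real (CD k n t)) \<le> B"
    using AE_Pi_support by eventually_elim (use B in simp)
  then show ?thesis
    using assms by (intro sqint_mult_bounded[where C = B]) auto
qed

lemma integrable_CD_mult: "sqint Pim \<phi> \<Longrightarrow> integrable Pim (\<lambda>t. complex_of_real (CD k n t) * \<phi> t)"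
  by (rule finite_measure.sqint_integrable[OF finite_measure_Pim sqint_CD_mult])

text \<open>This is the product formula integrated against \<phi>. Orthogonality, boundedness of
  T[\<phi>] and the intertwining relation all rest on it.\<close>

lemma hat_sphere_sum:
  assumes \<phi>: "sqint Pim \<phi>"
  shows "(\<Sum>y\<in>sphere E z m. hat k \<phi> (gdist E y x)) =
    of_nat (sphere_size m) * hat k (\<lambda>t. complex_of_real (CD k (gdist E z x) t) * \<phi> t) m"
proof -
  have "(\<Sum>y\<in>sphere E z m. hat k \<phi> (gdist E y x)) =
      (\<integral>t. (\<Sum>y\<in>sphere E z m. complex_of_real (CD k (gdist E y x) t) * \<phi> t) \<partial>Pim)"
    unfolding hat_def by (rule Bochner_Integration.integral_sum[symmetric]) (rule integrable_CD_mult[OF \<phi>])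
  also have "\<dots> = (\<integral>t. of_nat (sphere_size m) *
      (complex_of_real (CD k m t) * (complex_of_real (CD k (gdist E z x) t) * \<phi> t)) \<partial>Pim)"
  proof (rule Bochner_Integration.integral_cong[OF refl])
    fix t
    have "(\<Sum>y\<in>sphere E z m. complex_of_real (CD k (gdist E y x) t) * \<phi> t) =
        complex_of_real (\<Sum>y\<in>sphere E z m. CD k (gdist E y x) t) * \<phi> t"
      by (simp only: sum_distrib_right of_real_sum)
    then show "(\<Sum>y\<in>sphere E z m. complex_of_real (CD k (gdist E y x) t) * \<phi> t) =
        of_nat (sphere_size m) * (complex_of_real (CD k m t) * (complex_of_real (CD k (gdist E z x) t) * \<phi> t))"
      unfolding sphere_sum_CD by simp
  qed
  also have "\<dots> = of_nat (sphere_size m) * hat k (\<lambda>t. complex_of_real (CD k (gdist E z x) t) * \<phi> t) m"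
    unfolding hat_def by simp
  finally show ?thesis .
qed

lemma hat_const: "hat k (\<lambda>t. c) n = (if n = 0 then c else 0)"
proof -
  have "hat k (\<lambda>t. c) n = complex_of_real (\<integral>t. CD k n t \<partial>Pim) * c"
    unfolding hat_def by simp
  then show ?thesis
    by (simp add: integral_Pi_CD[OF k_pos])
qed

text \<open>The symbol 1 has the kernel of the identity, so the integrated product formula merely
  asks whether x lies on the sphere of radius m about z, where d(z, x) = n.\<close>

lemma CD_orthogonal:
  "hat k (\<lambda>t. complex_of_real (CD k n t)) m = (if m = n then 1 / of_nat (sphere_size n) else 0)"
proof -
  obtain z x where zx: "gdist E z x = n"
    using sphere_nonempty by blast
  have one: "sqint Pim (\<lambda>t. 1)"
    using sqint_CD[OF k_pos, of 0] by simp
  have "of_nat (sphere_size m) * hat k (\<lambda>t. complex_of_real (CD k n t)) m =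
      (\<Sum>y\<in>sphere E z m. hat k (\<lambda>t. 1) (gdist E y x))"
    using hat_sphere_sum[OF one, where z = z and m = m and x = x] by (simp add: zx)
  also have "\<dots> = (\<Sum>y\<in>sphere E z m. if y = x then 1 else 0)"
    by (simp add: hat_const)
  also have "\<dots> = (if m = n then 1 else 0)"
  proof -
    have "x \<in> sphere E z m \<longleftrightarrow> m = n"
      using zx by (auto simp: sphere_def gdist_commute[of x z])
    then show ?thesis by (simp add: finite_sphere)
  qed
  finally show ?thesis
    using sphere_size_pos[of m] by (simp add: field_simps split: if_splits)
qed

definition onp :: "nat \<Rightarrow> real \<Rightarrow> complex" where
  "onp n t = complex_of_real (sqrt (real (sphere_size n)) * CD k n t)"

lemma sqint_onp: "sqint Pim (onp n)"
  unfolding onp_def of_real_mult by (intro sqint_scale sqint_CD k_pos)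

lemma L2ip_onp: "L2ip Pim h (onp n) = complex_of_real (sqrt (real (sphere_size n))) * hat k h n"
proof -
  have "L2ip Pim h (onp n) = (\<integral>t. complex_of_real (sqrt (real (sphere_size n))) * (complex_of_real (CD k n t) * h t) \<partial>Pim)"
    unfolding L2ip_def onp_def by (intro Bochner_Integration.integral_cong) auto
  then show ?thesis
    unfolding hat_def by simp
qed

lemma hat_scale: "hat k (\<lambda>t. c * h t) n = c * hat k h n"
  unfolding hat_def by (simp add: mult.left_commute)

lemma sqrt_sphere_size: "complex_of_real (sqrt (real (sphere_size n))) * complex_of_real (sqrt (real (sphere_size n))) = of_nat (sphere_size n)"
  by (simp flip: of_real_mult)

lemma sphere_size_nz [simp]: "complex_of_real (sqrt (real (sphere_size n))) \<noteq> 0" "sphere_size n \<noteq> 0"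
  using sphere_size_pos[of n] by auto

sublocale basis: orthonormal_basis Pim onp
proof (intro orthonormal_basis.intro orthonormal_basis_axioms.intro finite_measure_Pim sqint_onp)
  fix m n
  have "hat k (onp m) n = complex_of_real (sqrt (real (sphere_size m))) * hat k (\<lambda>t. complex_of_real (CD k m t)) n"
    unfolding onp_def of_real_mult by (rule hat_scale)
  then show "L2ip Pim (onp m) (onp n) = (if m = n then 1 else 0)"
    using sqrt_sphere_size[of n] by (simp add: L2ip_onp CD_orthogonal mult.assoc[symmetric])
next
  fix h assume h: "sqint Pim h" "\<And>n. L2ip Pim h (onp n) = 0"
  then have "hat k h n = 0" for n
    by (auto simp: L2ip_onp)
  then show "AE t in Pim. h t = 0"
    using h(1) by (intro CD_total[OF k_pos]) (auto simp: hat_def)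
qed

lemma hat_summable:
  assumes "sqint Pim \<phi>"
  shows "summable (\<lambda>n. real (sphere_size n) * (cmod (hat k \<phi> n))\<^sup>2)"
  using basis.Bessel[OF assms] by (simp add: L2ip_onp norm_mult power_mult_distrib)

lemma is_l2_hat: "sqint Pim \<phi> \<Longrightarrow> is_l2 (\<lambda>y. hat k \<phi> (gdist E y x))"
  by (intro is_l2_radialI hat_summable)

text \<open>In operator terms, T[\<phi>]* T[\<phi>] = T[|\<phi>|^2] at one pair of vertices. Sphere
  sums about x turn the inner product into a Parseval series for \<phi> and its product with the
  polynomial of degree d(x, y).\<close>

lemma l2inner_hat:
  assumes \<phi>: "sqint Pim \<phi>"
  shows "l2inner (\<lambda>z. hat k \<phi> (gdist E z x)) (\<lambda>z. hat k \<phi> (gdist E z y)) =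
    hat k (\<lambda>t. \<phi> t * cnj (\<phi> t)) (gdist E x y)"
proof -
  let ?l = "gdist E x y"
  let ?g = "\<lambda>t. complex_of_real (CD k ?l t) * \<phi> t"
  have "(\<Sum>z\<in>sphere E x m. hat k \<phi> (gdist E z x) * cnj (hat k \<phi> (gdist E z y))) =
      L2ip Pim \<phi> (onp m) * cnj (L2ip Pim ?g (onp m))" for m
  proof -
    have "(\<Sum>z\<in>sphere E x m. hat k \<phi> (gdist E z x) * cnj (hat k \<phi> (gdist E z y))) =
        hat k \<phi> m * cnj (\<Sum>z\<in>sphere E x m. hat k \<phi> (gdist E z y))"
      unfolding sum_distrib_left cnj_sum by (intro sum.cong) (auto simp: sphere_def)
    also have "\<dots> = hat k \<phi> m * (of_nat (sphere_size m) * cnj (hat k ?g m))"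
      unfolding hat_sphere_sum[OF \<phi>] by simp
    finally show ?thesis
      unfolding L2ip_onp sqrt_sphere_size[symmetric] by simp
  qed
  then have s1: "(\<lambda>m. L2ip Pim \<phi> (onp m) * cnj (L2ip Pim ?g (onp m))) sums
      l2inner (\<lambda>z. hat k \<phi> (gdist E z x)) (\<lambda>z. hat k \<phi> (gdist E z y))"
    using sphere_sums[OF l2_mult_summable[OF is_l2_hat[OF \<phi>, of x] is_l2_cnj[OF is_l2_hat[OF \<phi>, of y]]], of x]
    unfolding l2inner_def by simp
  have s2: "(\<lambda>m. L2ip Pim \<phi> (onp m) * cnj (L2ip Pim ?g (onp m))) sums L2ip Pim \<phi> ?g"
    by (intro basis.Parseval_ip \<phi> sqint_CD_mult)
  have "L2ip Pim \<phi> ?g = hat k (\<lambda>t. \<phi> t * cnj (\<phi> t)) ?l"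
    unfolding L2ip_def hat_def by (intro Bochner_Integration.integral_cong) auto
  then show ?thesis
    using sums_unique2[OF s1 s2] by simp
qed

lemma hat_cong_AE:
  assumes "f \<in> borel_measurable Pim" "g \<in> borel_measurable Pim" "AE t in Pim. f t = g t"
  shows "hat k f n = hat k g n"
  unfolding hat_def using assms by (intro integral_cong_AE) auto

lemma hat_diff: "sqint Pim f \<Longrightarrow> sqint Pim g \<Longrightarrow> hat k (\<lambda>t. f t - g t) n = hat k f n - hat k g n"
  unfolding hat_def by (simp add: right_diff_distrib integrable_CD_mult)

lemma l2norm_hat_sum:
  assumes \<phi>: "sqint Pim \<phi>"
  shows "complex_of_real ((l2norm (\<lambda>x. \<Sum>y\<in>F. f y * hat k \<phi> (gdist E x y)))\<^sup>2) =
    (\<Sum>y\<in>F. \<Sum>z\<in>F. f y * cnj (f z) * hat k (\<lambda>t. \<phi> t * cnj (\<phi> t)) (gdist E y z))"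
proof -
  let ?c = "\<lambda>y x. hat k \<phi> (gdist E x y)"
  have sq: "sqint counting (?c y)" for y
    using is_l2_hat[OF \<phi>] by (simp add: is_l2_iff_sqint)
  have sq': "sqint counting (\<lambda>x. f y * ?c y x)" for y
    by (rule sqint_scale[OF sq])
  let ?u = "\<lambda>x. \<Sum>y\<in>F. f y * ?c y x"
  have u: "sqint counting ?u" by (rule sqint_sum[OF sq'])
  have "L2ip counting ?u ?u = (\<Sum>y\<in>F. f y * L2ip counting (?c y) ?u)"
    by (subst L2ip_sum_left) (auto intro: sq' u simp: L2ip_scale_left)
  also have "\<dots> = (\<Sum>y\<in>F. f y * cnj (L2ip counting ?u (?c y)))"
    by (subst (1) L2ip_commute) (rule refl)
  also have "\<dots> = (\<Sum>y\<in>F. f y * cnj (\<Sum>z\<in>F. f z * L2ip counting (?c z) (?c y)))"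
    by (subst L2ip_sum_left) (auto intro: sq' sq simp: L2ip_scale_left)
  also have "\<dots> = (\<Sum>y\<in>F. f y * (\<Sum>z\<in>F. cnj (f z) * L2ip counting (?c y) (?c z)))"
    by (simp add: L2ip_commute[of _ _ "?c _", symmetric])
  finally show ?thesis
    unfolding l2inner_self[symmetric] l2inner_eq_L2ip
    by (simp add: sum_distrib_left mult.assoc l2inner_hat[OF \<phi>, unfolded l2inner_eq_L2ip])
qed

lemma is_Linf_bound:
  assumes "is_Linf k \<phi>"
  obtains C where "0 \<le> C" "AE t in Pim. cmod (\<phi> t) \<le> C" "\<phi> \<in> borel_measurable Pim"
proof -
  obtain C where C: "AE t in Pim. cmod (\<phi> t) \<le> C" "\<phi> \<in> borel_measurable Pim"
    using assms by (auto simp: is_Linf_def)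
  have "AE t in Pim. cmod (\<phi> t) \<le> max 0 C"
    using C(1) by eventually_elim simp
  then show ?thesis using that[of "max 0 C"] C(2) by simp
qed

lemma is_Linf_sqint: "is_Linf k \<phi> \<Longrightarrow> sqint Pim \<phi>"
  using is_Linf_bound finite_measure.sqint_bounded[OF finite_measure_Pim] by metis

text \<open>If C bounds \<phi> and \<omega> is the square root of C^2 - |\<phi>|^2, then the squared norms of T[\<phi>] f and T[\<omega>] f
  add up to C^2 \<parallel>f\<parallel>^2 for finitely supported f, because each is a quadratic form that is linear
  in the squared modulus of its symbol.\<close>

theorem Tphi_BGamma:
  assumes "is_Linf k \<phi>"
  shows "Tphi k E \<phi> \<in> BGamma E"
proof -
  obtain C where C: "0 \<le> C" "AE t in Pim. cmod (\<phi> t) \<le> C" and [measurable]: "\<phi> \<in> borel_measurable Pim"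
    using is_Linf_bound[OF assms] by blast
  note bounded = finite_measure.sqint_bounded[OF finite_measure_Pim]
  have \<phi>: "sqint Pim \<phi>"
    by (rule is_Linf_sqint[OF assms])
  \<comment> \<open>The bound by C holds only almost everywhere; \<open>max 0\<close> keeps the
    radicand nonnegative on the exceptional null set.\<close>
  define \<omega> where "\<omega> t = complex_of_real (sqrt (max 0 (C\<^sup>2 - (cmod (\<phi> t))\<^sup>2)))" for t
  have [measurable]: "\<omega> \<in> borel_measurable Pim"
    unfolding \<omega>_def by measurable
  have "cmod (\<omega> t) \<le> C" for t
    unfolding \<omega>_def using C(1) by (auto intro!: real_le_lsqrt)
  then have \<omega>: "sqint Pim \<omega>"
    by (intro bounded[where C = C]) auto
  have \<phi>2: "sqint Pim (\<lambda>t. \<phi> t * cnj (\<phi> t))"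
    using \<phi> C by (intro sqint_mult_bounded[where C = C] sqint_cnj) auto
  have const: "sqint Pim (\<lambda>t. complex_of_real (C\<^sup>2))"
    by (intro bounded[where C = "C\<^sup>2"]) (auto simp: norm_power)
  have hat: "hat k (\<lambda>t. \<phi> t * cnj (\<phi> t)) n = (if n = 0 then complex_of_real (C\<^sup>2) else 0) - hat k (\<lambda>t. \<omega> t * cnj (\<omega> t)) n" for n
  proof -
    have "hat k (\<lambda>t. \<omega> t * cnj (\<omega> t)) n = hat k (\<lambda>t. complex_of_real (C\<^sup>2) - \<phi> t * cnj (\<phi> t)) n"
    proof (rule hat_cong_AE)
      show "AE t in Pim. \<omega> t * cnj (\<omega> t) = complex_of_real (C\<^sup>2) - \<phi> t * cnj (\<phi> t)"
        using C(2)
      proof eventually_elim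
        case (elim t)
        then have "(cmod (\<phi> t))\<^sup>2 \<le> C\<^sup>2" by (intro power_mono) auto
        then show ?case
          unfolding complex_norm_square[symmetric] \<omega>_def by (simp flip: of_real_diff of_real_power)
      qed
    qed (use sqint_measurable[OF \<phi>2] sqint_measurable[OF \<omega>] sqint_measurable[OF sqint_cnj[OF \<omega>]] in measurable)
    then show ?thesis
      using hat_diff[OF const \<phi>2, of n] hat_const[of "complex_of_real (C\<^sup>2)" n] by simp
  qed
  have bound: "l2norm (\<lambda>x. \<Sum>y\<in>F. f y * hat k \<phi> (gdist E x y)) \<le> C * l2norm (trunc f F)" if F: "finite F" for f F
  proof -
    have "(\<Sum>y\<in>F. \<Sum>z\<in>F. f y * cnj (f z) * (if gdist E y z = 0 then complex_of_real (C\<^sup>2) else 0)) =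
        (\<Sum>y\<in>F. f y * cnj (f y) * complex_of_real (C\<^sup>2))"
      using F by (intro sum.cong) (auto simp: if_distrib[of "\<lambda>u. _ * u"] cong: if_cong)
    also have "\<dots> = complex_of_real ((C * l2norm (trunc f F))\<^sup>2)"
      using F by (simp only: power_mult_distrib l2norm_trunc_sq complex_norm_square[symmetric]
          of_real_sum[symmetric] of_real_mult[symmetric] mult.commute sum_distrib_left)
    finally have "complex_of_real ((l2norm (\<lambda>x. \<Sum>y\<in>F. f y * hat k \<phi> (gdist E x y)))\<^sup>2) =
        complex_of_real ((C * l2norm (trunc f F))\<^sup>2)
        - complex_of_real ((l2norm (\<lambda>x. \<Sum>y\<in>F. f y * hat k \<omega> (gdist E x y)))\<^sup>2)"
      unfolding l2norm_hat_sum[OF \<phi>] l2norm_hat_sum[OF \<omega>] hat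
      by (simp only: right_diff_distrib sum_subtractf)
    then have "(l2norm (\<lambda>x. \<Sum>y\<in>F. f y * hat k \<phi> (gdist E x y)))\<^sup>2 \<le> (C * l2norm (trunc f F))\<^sup>2"
      by (simp only: of_real_diff[symmetric] of_real_eq_iff) simp
    then show ?thesis
      using C(1) by (rule_tac power2_le_imp_le) auto
  qed
  have "bounded_kernel (Tphi k E \<phi>)"
  proof (rule bounded_kernelI_finite_support[OF _ C(1)])
    show "is_l2 (Tphi k E \<phi> x)" for x
      unfolding Tphi_def gdist_commute[of x] by (rule is_l2_hat[OF \<phi>])
    fix f :: "'v \<Rightarrow> complex" and F :: "'v set" assume F: "finite F"
    have "is_l2 (\<lambda>x. \<Sum>y\<in>F. f y * hat k \<phi> (gdist E x y))"
      unfolding is_l2_iff_sqint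
      by (intro sqint_sum sqint_scale is_l2_hat[OF \<phi>, unfolded is_l2_iff_sqint])
    then show "is_l2 (\<lambda>x. \<Sum>y\<in>F. f y * Tphi k E \<phi> x y) \<and>
        l2norm (\<lambda>x. \<Sum>y\<in>F. f y * Tphi k E \<phi> x y) \<le> C * l2norm (trunc f F)"
      using bound[OF F] by (simp add: Tphi_def)
  qed
  then show ?thesis
    unfolding BGamma_def Tphi_def by auto
qed

text \<open>The inner product of a radial f with the normalised indicator of the sphere of radius n:
  #S_n equal terms, each divided by the square root of #S_n.\<close>

definition rcoeff :: "'v \<Rightarrow> ('v \<Rightarrow> complex) \<Rightarrow> nat \<Rightarrow> complex" where
  "rcoeff o0 f n = complex_of_real (sqrt (real (sphere_size n))) * f (sphere_rep o0 n)"

lemma rcoeff_sums: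
  assumes f: "is_rad E o0 f"
  shows "(\<lambda>n. (cmod (rcoeff o0 f n))\<^sup>2) sums (l2norm f)\<^sup>2"
proof -
  have eq: "(\<lambda>y. f (sphere_rep o0 (gdist E y o0))) = f"
    by (rule ext) (rule is_rad_profile[OF f, symmetric])
  have "is_l2 (\<lambda>y. f (sphere_rep o0 (gdist E y o0)))"
    unfolding eq using f by (simp add: is_rad_def)
  from l2norm_radial[OF this] have "(\<lambda>n. real (sphere_size n) * (cmod (f (sphere_rep o0 n)))\<^sup>2) sums (l2norm f)\<^sup>2"
    unfolding eq .
  then show ?thesis
    by (simp add: rcoeff_def norm_mult power_mult_distrib)
qed

lemma rcoeff_lincomb: "rcoeff o0 (\<lambda>x. a * f x + b * g x) n = a * rcoeff o0 f n + b * rcoeff o0 g n"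
  by (simp add: rcoeff_def algebra_simps)

lemma is_rad_of_coeffs:
  assumes "summable (\<lambda>n. (cmod (c n))\<^sup>2)"
  shows "\<exists>f. is_rad E o0 f \<and> rcoeff o0 f = c"
proof -
  define \<phi> where "\<phi> n = c n / complex_of_real (sqrt (real (sphere_size n)))" for n
  have "real (sphere_size n) * (cmod (\<phi> n))\<^sup>2 = (cmod (c n))\<^sup>2" for n
    by (simp add: \<phi>_def norm_divide power_divide)
  then have "is_l2 (\<lambda>y. \<phi> (gdist E y o0))"
    using assms by (intro is_l2_radialI) simp
  then have "is_rad E o0 (\<lambda>y. \<phi> (gdist E y o0))"
    unfolding is_rad_iff by blast
  moreover have "rcoeff o0 (\<lambda>y. \<phi> (gdist E y o0)) = c"
    by (simp add: rcoeff_def \<phi>_def fun_eq_iff)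
  ultimately show ?thesis by blast
qed

lemma is_rad_sph_vec: "is_rad E o0 (sph_vec E o0 n)"
proof -
  have "{x. sph_vec E o0 n x \<noteq> 0} \<subseteq> sphere E o0 n"
    by (auto simp: sph_vec_def sphere_def)
  then have "is_l2 (sph_vec E o0 n)"
    by (intro is_l2_finite_support) (rule finite_subset[OF _ finite_sphere])
  then show ?thesis
    by (auto simp: is_rad_def sph_vec_def)
qed

lemma rcoeff_sph_vec: "rcoeff o0 (sph_vec E o0 n) m = (if m = n then 1 else 0)"
  by (simp add: rcoeff_def sph_vec_def card_sphere)

lemma CD_normalised: "complex_of_real (CD k n t / L2norm k (\<lambda>s. complex_of_real (CD k n s))) = onp n t"
proof -
  have "complex_of_real ((L2nrm Pim (\<lambda>s. complex_of_real (CD k n s)))\<^sup>2) = hat k (\<lambda>s. complex_of_real (CD k n s)) n"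
    unfolding L2ip_self[symmetric] L2ip_def hat_def by simp
  then have "complex_of_real ((L2nrm Pim (\<lambda>s. complex_of_real (CD k n s)))\<^sup>2) = complex_of_real (1 / real (sphere_size n))"
    by (simp add: CD_orthogonal)
  then have "(L2nrm Pim (\<lambda>s. complex_of_real (CD k n s)))\<^sup>2 = 1 / real (sphere_size n)"
    by (simp only: of_real_eq_iff)
  then have "L2nrm Pim (\<lambda>s. complex_of_real (CD k n s)) = 1 / sqrt (real (sphere_size n))"
    by (metis L2nrm_nonneg real_sqrt_divide real_sqrt_one real_sqrt_unique)
  then have "L2norm k (\<lambda>s. complex_of_real (CD k n s)) = 1 / sqrt (real (sphere_size n))"
    by (simp add: L2norm_def L2nrm_def)
  then show ?thesis by (simp add: onp_def mult.commute)
qed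

lemma is_L2_iff_sqint: "is_L2 k g \<longleftrightarrow> sqint Pim g"
  by (simp add: is_L2_def sqint_def)

lemma L2norm_eq_L2nrm: "L2norm k g = L2nrm Pim g"
  by (simp add: L2norm_def L2nrm_def)

theorem ex_unitary_rad: "\<exists>U. unitary_rad k E o0 U \<and> U_values k E o0 U"
proof -
  \<comment> \<open>A Fourier sum is unique only up to null sets. Any choice will do, since
    linearity and the values on sphere vectors are demanded almost everywhere.\<close>
  define U where "U f = (SOME h. basis.is_fsum (rcoeff o0 f) h)" for f
  have U: "basis.is_fsum (rcoeff o0 f) (U f)" if "is_rad E o0 f" for f
    unfolding U_def by (rule someI_ex[OF basis.ex_fsum[OF sums_summable[OF rcoeff_sums[OF that]]]])
  have sq: "sqint Pim (U f)" if "is_rad E o0 f" for f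
    using U[OF that] by (simp add: basis.is_fsum_def)
  have coeff: "L2ip Pim (U f) (onp n) = rcoeff o0 f n" if "is_rad E o0 f" for f n
    by (rule basis.fsum_coeff[OF U[OF that]])
  have "unitary_rad k E o0 U"
    unfolding unitary_rad_def is_L2_iff_sqint L2norm_eq_L2nrm
  proof (intro conjI allI impI)
    fix f assume f: "is_rad E o0 f"
    show "sqint Pim (U f)" by (rule sq[OF f])
    have "(L2nrm Pim (U f))\<^sup>2 = (l2norm f)\<^sup>2"
      using basis.fsum_norm[OF U[OF f]] rcoeff_sums[OF f] by (rule sums_unique2)
    then show "L2nrm Pim (U f) = l2norm f" by simp
  next
    fix f g a b assume fg: "is_rad E o0 f" "is_rad E o0 g"
    show "AE t in Pim. U (\<lambda>x. a * f x + b * g x) t = a * U f t + b * U g t"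
    proof (rule basis.eq_AE_if_coeffs_eq)
      show "L2ip Pim (U (\<lambda>x. a * f x + b * g x)) (onp n) = L2ip Pim (\<lambda>t. a * U f t + b * U g t) (onp n)" for n
        by (simp add: coeff fg is_rad_lincomb rcoeff_lincomb L2ip_add_left L2ip_scale_left sqint_scale sq sqint_onp)
    qed (intro sq fg is_rad_lincomb sqint_add sqint_scale)+
  next
    fix h assume h: "sqint Pim h"
    obtain f where f: "is_rad E o0 f" "rcoeff o0 f = (\<lambda>n. L2ip Pim h (onp n))"
      using is_rad_of_coeffs[OF basis.Bessel[OF h]] by blast
    have "AE t in Pim. U f t = h t"
      using f by (intro basis.eq_AE_if_coeffs_eq sq h) (auto simp: coeff)
    then show "\<exists>f. is_rad E o0 f \<and> (AE t in Pim. U f t = h t)"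
      using f(1) by blast
  qed
  moreover have "U_values k E o0 U"
    unfolding U_values_def CD_normalised
  proof
    fix n
    show "AE t in Pim. U (sph_vec E o0 n) t = onp n t"
      by (rule basis.eq_AE_if_coeffs_eq)
        (auto intro: sq is_rad_sph_vec sqint_onp simp: coeff is_rad_sph_vec rcoeff_sph_vec basis.orthonormal)
  qed
  ultimately show ?thesis by blast
qed

text \<open>Every admissible U is fixed by its values on sphere vectors: linearity gives finite
  combinations, and the isometry carries them to the limit.\<close>

lemma unitary_coeff:
  assumes U: "unitary_rad k E o0 U" "U_values k E o0 U" and f: "is_rad E o0 f"
  shows "sqint Pim (U f)" "L2ip Pim (U f) (onp n) = rcoeff o0 f n"
proof -
  have sq: "sqint Pim (U g)" and norm: "L2nrm Pim (U g) = l2norm g" if "is_rad E o0 g" for g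
    using U(1) that unfolding unitary_rad_def is_L2_iff_sqint L2norm_eq_L2nrm by blast+
  have lin: "AE t in Pim. U (\<lambda>x. a * g x + b * h x) t = a * U g t + b * U h t"
    if "is_rad E o0 g" "is_rad E o0 h" for a b g h
    using U(1) that unfolding unitary_rad_def by blast
  show "sqint Pim (U f)" by (rule sq[OF f])
  define c where "c = rcoeff o0 f"
  define p where "p N x = (\<Sum>n<N. c n * sph_vec E o0 n x)" for N x
  have p: "is_rad E o0 (p N) \<and> (AE t in Pim. U (p N) t = basis.fpart c {..<N} t)" for N
  proof (induction N)
    case 0
    \<comment> \<open>Writing the zero vector as a combination of f with itself lets linearity yield
      U 0 = 0 almost everywhere.\<close>
    have p0: "p 0 = (\<lambda>x. 0 * f x + 0 * f x)" by (simp add: p_def fun_eq_iff)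
    show ?case
      unfolding p0 using lin[OF f f, of 0 0] is_rad_lincomb[OF f f, of 0 0] by (simp add: basis.fpart_def)
  next
    case (Suc N)
    have pS: "p (Suc N) = (\<lambda>x. 1 * p N x + c N * sph_vec E o0 N x)"
      by (simp add: p_def fun_eq_iff)
    have v: "AE t in Pim. U (sph_vec E o0 N) t = onp N t"
      using U(2) unfolding U_values_def CD_normalised by blast
    have "AE t in Pim. U (p (Suc N)) t = 1 * U (p N) t + c N * U (sph_vec E o0 N) t"
      unfolding pS using Suc by (intro lin is_rad_sph_vec) blast
    then have "AE t in Pim. U (p (Suc N)) t = basis.fpart c {..<Suc N} t"
      using Suc[THEN conjunct2] v by eventually_elim (simp add: basis.fpart_def)
    moreover have "is_rad E o0 (p (Suc N))"
      unfolding pS using Suc by (intro is_rad_lincomb is_rad_sph_vec) blast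
    ultimately show ?case by blast
  qed
  have "(\<lambda>N. L2nrm Pim (\<lambda>t. U f t - basis.fpart c {..<N} t)) \<longlonglongrightarrow> 0"
  proof -
    have cp: "rcoeff o0 (p N) m = (if m < N then c m else 0)" for N m
    proof -
      have "rcoeff o0 (p N) m = (\<Sum>n<N. c n * rcoeff o0 (sph_vec E o0 n) m)"
        by (simp add: rcoeff_def p_def sum_distrib_left mult.left_commute)
      then show ?thesis
        by (simp add: rcoeff_sph_vec if_distrib cong: if_cong)
    qed
    \<comment> \<open>By linearity and isometry the error is the norm of f - p_N, whose square is a
      tail of the coefficient series of f.\<close>
    have eq: "(L2nrm Pim (\<lambda>t. U f t - basis.fpart c {..<N} t))\<^sup>2 = (l2norm f)\<^sup>2 - (\<Sum>m<N. (cmod (c m))\<^sup>2)" for N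
    proof -
      define g where "g = (\<lambda>x. 1 * f x + (- 1) * p N x)"
      have g: "is_rad E o0 g"
        unfolding g_def using p f by (intro is_rad_lincomb) blast+
      have "AE t in Pim. U f t - basis.fpart c {..<N} t = U g t"
        unfolding g_def using lin[OF f p[THEN conjunct1], of 1 "- 1" N] p[THEN conjunct2, of N]
        by eventually_elim simp
      then have "L2nrm Pim (\<lambda>t. U f t - basis.fpart c {..<N} t) = l2norm g"
        unfolding norm[OF g, symmetric]
        by (intro L2nrm_cong_AE sqint_diff sq f g basis.sqint_fpart)
      moreover have "(cmod (rcoeff o0 g m))\<^sup>2 = (cmod (c m))\<^sup>2 - (if m \<in> {..<N} then (cmod (c m))\<^sup>2 else 0)" for m
        unfolding g_def rcoeff_lincomb cp by (simp add: c_def)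
      then have s1: "(\<lambda>m. (cmod (c m))\<^sup>2 - (if m \<in> {..<N} then (cmod (c m))\<^sup>2 else 0)) sums (l2norm g)\<^sup>2"
        using rcoeff_sums[OF g] by simp
      moreover have s2: "(\<lambda>m. (cmod (c m))\<^sup>2 - (if m \<in> {..<N} then (cmod (c m))\<^sup>2 else 0)) sums
          ((l2norm f)\<^sup>2 - (\<Sum>m<N. (cmod (c m))\<^sup>2))"
        using rcoeff_sums[OF f] unfolding c_def by (intro sums_diff sums_If_finite_set) auto
      ultimately show ?thesis
        using sums_unique2[OF s1 s2] by simp
    qed
    have "(\<lambda>N. (l2norm f)\<^sup>2 - (\<Sum>m<N. (cmod (c m))\<^sup>2)) \<longlonglongrightarrow> (l2norm f)\<^sup>2 - (l2norm f)\<^sup>2"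
      using rcoeff_sums[OF f] unfolding sums_def c_def by (intro tendsto_intros)
    then have "(\<lambda>N. sqrt ((L2nrm Pim (\<lambda>t. U f t - basis.fpart c {..<N} t))\<^sup>2)) \<longlonglongrightarrow> sqrt 0"
      unfolding eq by (intro tendsto_real_sqrt) simp
    then show ?thesis by simp
  qed
  then have "basis.is_fsum c (U f)"
    using sq[OF f] by (simp add: basis.is_fsum_def)
  then show "L2ip Pim (U f) (onp n) = rcoeff o0 f n"
    using basis.fsum_coeff by (simp add: c_def)
qed

text \<open>Let d(z, o0) = n. Up to the factor sqrt(#S_n) in \<open>rcoeff\<close>, what the sphere
  S_m about o0 contributes to (T[\<phi>] f)(z) is the m-th term of the Parseval series for the n-th
  coefficient of \<phi> U f.\<close>

theorem unitary_intertwines: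
  assumes U: "unitary_rad k E o0 U" "U_values k E o0 U" and \<phi>: "is_Linf k \<phi>" and f: "is_rad E o0 f"
  shows "AE t in Pim. U (jo E o0 (Tphi k E \<phi>) f) t = \<phi> t * U f t"
proof -
  obtain C where C: "AE t in Pim. cmod (\<phi> t) \<le> C" and [measurable]: "\<phi> \<in> borel_measurable Pim"
    using is_Linf_bound[OF \<phi>] by blast
  note T = Tphi_BGamma[OF \<phi>]
  define g where "g = kapply (Tphi k E \<phi>) f"
  have g: "is_rad E o0 g"
    unfolding g_def by (rule is_rad_kapply[OF T f])
  have \<phi>U: "sqint Pim (\<lambda>t. \<phi> t * U f t)"
    using C unitary_coeff(1)[OF U f] by (intro sqint_mult_bounded[where C = C]) auto
  have "L2ip Pim (\<lambda>t. \<phi> t * U f t) (onp n) = rcoeff o0 g n" for n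
  proof -
    let ?z = "sphere_rep o0 n"
    \<comment> \<open>Moving \<phi> to the second factor, conjugated, lets the known coefficients of
      U f enter Parseval's formula.\<close>
    define h where "h t = cnj (\<phi> t) * onp n t" for t
    have h: "sqint Pim h"
      unfolding h_def using C sqint_onp sqint_cnj[OF is_Linf_sqint[OF \<phi>], THEN sqint_measurable]
      by (intro sqint_mult_bounded[where C = C]) auto
    let ?s = "\<lambda>m. complex_of_real (sqrt (real (sphere_size m)))"
    let ?h = "\<lambda>m. hat k (\<lambda>t. complex_of_real (CD k n t) * \<phi> t) m"
    have ip: "L2ip Pim (\<lambda>t. \<phi> t * U f t) (onp n) = L2ip Pim (U f) h"
      unfolding L2ip_def h_def by (intro Bochner_Integration.integral_cong) auto
    have coeff: "cnj (L2ip Pim h (onp m)) = ?s m * (?s n * ?h m)" for m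
    proof -
      have "cnj (hat k h m) = hat k (\<lambda>t. ?s n * (complex_of_real (CD k n t) * \<phi> t)) m"
        unfolding hat_def h_def onp_def
        by (subst Bochner_Integration.integral_cnj[symmetric]) (intro Bochner_Integration.integral_cong, auto)
      then show ?thesis
        unfolding L2ip_onp hat_scale by simp
    qed
    have "(\<lambda>m. rcoeff o0 f m * cnj (L2ip Pim h (onp m))) sums L2ip Pim (\<lambda>t. \<phi> t * U f t) (onp n)"
      using basis.Parseval_ip[OF unitary_coeff(1)[OF U f] h] unfolding ip unitary_coeff(2)[OF U f] .
    moreover have "rcoeff o0 f m * cnj (L2ip Pim h (onp m)) =
        ?s n * (\<Sum>y\<in>sphere E o0 m. Tphi k E \<phi> ?z y * f y)" for m
    proof -
      have "(\<Sum>y\<in>sphere E o0 m. Tphi k E \<phi> ?z y * f y) = (\<Sum>y\<in>sphere E o0 m. hat k \<phi> (gdist E y ?z)) * f (sphere_rep o0 m)"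
        unfolding sum_distrib_right
      proof (rule sum.cong[OF refl])
        fix y assume "y \<in> sphere E o0 m"
        then have "f y = f (sphere_rep o0 m)"
          by (intro is_rad_eq[OF f]) (simp add: sphere_def)
        then show "Tphi k E \<phi> ?z y * f y = hat k \<phi> (gdist E y ?z) * f (sphere_rep o0 m)"
          by (simp add: Tphi_def gdist_commute)
      qed
      also have "\<dots> = of_nat (sphere_size m) * ?h m * f (sphere_rep o0 m)"
        unfolding hat_sphere_sum[OF is_Linf_sqint[OF \<phi>]] by (simp add: gdist_commute[of o0])
      finally show ?thesis
        unfolding coeff rcoeff_def sqrt_sphere_size[symmetric] by simp
    qed
    \<comment> \<open>The sum giving the value at \<open>?z\<close> is regrouped around o0 rather
      than \<open>?z\<close>, because f is constant on spheres about o0.\<close>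
    moreover have "(\<lambda>m. ?s n * (\<Sum>y\<in>sphere E o0 m. Tphi k E \<phi> ?z y * f y)) sums rcoeff o0 g n"
    proof -
      have "is_l2 f"
        using f by (simp add: is_rad_def)
      from sums_mult[OF sphere_sums[OF kapply_summable[OF BGamma_bounded[OF T] this], where z = o0], of "?s n" ?z]
      show ?thesis
        unfolding rcoeff_def g_def kapply_def .
    qed
    ultimately show ?thesis
      by (simp add: sums_iff)
  qed
  then have "AE t in Pim. U g t = \<phi> t * U f t"
    using unitary_coeff[OF U g] \<phi>U by (intro basis.eq_AE_if_coeffs_eq) auto
  then show ?thesis
    by (simp add: jo_eq_kapply[OF T f] g_def)
qed

end

section \<open>Algebraic properties of the compression to radial vectors\<close>

context tree_graph
begin

lemma jo_lincomb:
  assumes S: "S \<in> BGamma E" and T: "T \<in> BGamma E" and f: "is_rad E o0 f"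
  shows "jo E o0 (\<lambda>x y. a * S x y + b * T x y) f = (\<lambda>x. a * jo E o0 S f x + b * jo E o0 T f x)"
proof -
  have l2: "is_l2 f"
    using f by (simp add: is_rad_def)
  have "kapply (\<lambda>x y. a * S x y + b * T x y) f = (\<lambda>x. a * kapply S f x + b * kapply T f x)"
    using kapply_summable[OF BGamma_bounded[OF S] l2] kapply_summable[OF BGamma_bounded[OF T] l2]
    by (intro ext)
      (simp add: kapply_def distrib_right mult.assoc infsum_add summable_on_cmult_right infsum_cmult_right')
  moreover have "is_rad E o0 (\<lambda>x. a * kapply S f x + b * kapply T f x)"
    by (intro is_rad_lincomb is_rad_kapply S T f)
  ultimately show ?thesis
    by (simp add: jo_eq_kapply S T f) (simp add: jo_def Prad_radial f)
qed

text \<open>Elements of \<open>BGamma E\<close> preserve radial vectors, so the projections act as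
  the identity and multiplicativity reduces to composition of kernels.\<close>

lemma jo_kcomp:
  assumes S: "S \<in> BGamma E" and T: "T \<in> BGamma E" and f: "is_rad E o0 f"
  shows "jo E o0 (kcomp S T) f = jo E o0 S (jo E o0 T f)"
proof -
  have l2: "is_l2 f"
    using f by (simp add: is_rad_def)
  have row: "is_l2 (S x)" for x
  proof -
    have "(\<lambda>y. S y x) = S x"
      by (rule ext) (rule BGamma_sym[OF S])
    then show ?thesis
      using is_l2_column[OF BGamma_bounded[OF S], of x] by simp
  qed
  have "kapply (kcomp S T) f = kapply S (kapply T f)"
    by (rule ext) (intro kapply_kcomp BGamma_bounded kadj_BGamma S T row l2)
  moreover have "is_rad E o0 (kapply S (kapply T f))"
    by (intro is_rad_kapply S T f)
  ultimately have "jo E o0 (kcomp S T) f = kapply S (kapply T f)"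
    by (simp add: jo_def Prad_radial f)
  then show ?thesis
    by (simp add: jo_eq_kapply[OF T f] jo_eq_kapply[OF S is_rad_kapply[OF T f]])
qed

lemma jo_adjoint:
  assumes T: "T \<in> BGamma E" and f: "is_rad E o0 f" and g: "is_rad E o0 g"
  shows "l2inner (jo E o0 T f) g = l2inner f (jo E o0 (kadj T) g)"
  unfolding jo_eq_kapply[OF T f] jo_eq_kapply[OF kadj_BGamma[OF T] g]
  using f g by (intro l2inner_kapply BGamma_bounded kadj_BGamma T) (simp_all add: is_rad_def)

end

theorem theorem1p4:
  fixes \<kappa> :: nat and E :: "'v \<Rightarrow> 'v \<Rightarrow> bool" and o0 :: 'v
  assumes "1 \<le> \<kappa>" and "cayley_tree \<kappa> E"
  shows
    "(\<forall>S\<in>BGamma E. \<forall>T\<in>BGamma E. \<forall>a b f. is_rad E o0 f \<longrightarrow>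
        jo E o0 (\<lambda>x y. a * S x y + b * T x y) f = (\<lambda>x. a * jo E o0 S f x + b * jo E o0 T f x))
   \<and> (\<forall>S\<in>BGamma E. \<forall>T\<in>BGamma E. \<forall>f. is_rad E o0 f \<longrightarrow>
        jo E o0 (kcomp S T) f = jo E o0 S (jo E o0 T f))
   \<and> (\<forall>T\<in>BGamma E. \<forall>f g. is_rad E o0 f \<longrightarrow> is_rad E o0 g \<longrightarrow>
        l2inner (jo E o0 T f) g = l2inner f (jo E o0 (kadj T) g))
   \<and> (\<forall>T\<in>BGamma E. rad_opnorm E o0 (jo E o0 T) = opnorm T)
   \<and> (\<forall>\<phi>. is_Linf \<kappa> \<phi> \<longrightarrow> Tphi \<kappa> E \<phi> \<in> BGamma E)
   \<and> (\<exists>U. unitary_rad \<kappa> E o0 U \<and> U_values \<kappa> E o0 U)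
   \<and> (\<forall>U. unitary_rad \<kappa> E o0 U \<and> U_values \<kappa> E o0 U \<longrightarrow>
        (\<forall>\<phi>. is_Linf \<kappa> \<phi> \<longrightarrow> (\<forall>f. is_rad E o0 f \<longrightarrow>
           (AE t in Pi_measure \<kappa>. U (jo E o0 (Tphi \<kappa> E \<phi>) f) t = \<phi> t * U f t))))"
proof -
  interpret tree_graph \<kappa> E
    using assms by unfold_locales
  show ?thesis
    by (intro conjI ballI allI impI jo_lincomb jo_kcomp jo_adjoint rad_opnorm_jo Tphi_BGamma
        ex_unitary_rad unitary_intertwines) blast+
qed

end
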